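(* Let $G$ be a two-step nilpotent Lie group identified with its Lie algebra $\mathfrak g=\mathfrak g_1\oplus\mathfrak g_2$, with $\dim\mathfrak g_1=d\ge 2$ and $\dim \mathfrak g_2=m$. Let $\Lambda:\mathfrak g_1\to\mathfrak g_2$ be a linear map with $\Lambda\neq 0$. Let $\Sigma$ be a $k$-dimensional $C^1$-submanifold of $\mathfrak g_1$ with surface measure $\sigma$, let $\chi\in C_c^\infty(\mathfrak g_1)$ be nontrivial and nonnegative, let $I\subset(0,\infty)$ be a compact interval of positive length, and let $\mathfrak M_I=\mathfrak M_I^\Lambda$ be the maximal operator defined in the context. Let $r$ be an integer with $1\le r\le k\le d$, and let $1\le p\le\infty$. Assume that there exist $\vartheta\in\mathfrak g_2^*$ and $\omega^\circ\in\Sigma$ with $\chi(\omega^\circ)\ne 0$ such that - $\vartheta\circ\Lambda\neq 0$, - $\mathbb V_{\Lambda,\vartheta}\cap (T_{\omega^\circ}\Sigma)^0=\{0\}$, - $\dim(\mathbb V_{\Lambda,\vartheta})=r$, where $\mathbb V_{\Lambda,\vartheta}\subset\mathfrak g_1^*$ and $(T_{\omega^\circ}\Sigma)^0\subset \mathfrak g_1^*$ are the subspaces defined in the context. Then: (i) If $2\le r\le k$ and $\mathfrak M_I$ extends to a bounded operator on $L^p(G)$, then $p>\frac{r+1}{r}$. (ii) If $r=1$ and $\mathfrak M_I$ extends to a bounded operator on $L^p(G)$, then $p=\infty$.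
   Context: **Group.** $\mathfrak g$ is a finite-dimensional real Lie algebra with a fixed direct sum decomposition $\mathfrak g=\mathfrak g_1\oplus\mathfrak g_2$, where $\dim\mathfrak g_1=d$, $\dim\mathfrak g_2=m\ge1$, $[\mathfrak g,\mathfrak g]\subset\mathfrak g_2$, and $\mathfrak g_2$ is contained in the center of $\mathfrak g$ (the commutative case $[\mathfrak g,\mathfrak g]=0$ is allowed). The group $G$ is identified with $\mathfrak g$ via the exponential map, so that its group law is $$(X,U)\cdot(Y,V)=\big(X+Y,\;U+V+\tfrac12[X,Y]\big),\qquad X,Y\in\mathfrak g_1,\ U,V\in\mathfrak g_2.$$ $L^p(G)$ is taken with respect to Haar measure, which is Lebesgue measure on $\mathfrak g$. A scalar product is fixed on $\mathfrak g_1$; the surface measure $\sigma$ on $\Sigma$ is the induced $k$-dimensional surface measure (if $k=d$ it is Lebesgue measure on $\mathfrak g_1$ restricted to $\Sigma$). **Measures and maximal operator.** For $t>0$ the measure $\mu_t$ on $G$ is defined by $$\langle f,\mu_t\rangle=\int_\Sigma f\big(tX,\,t^2\Lambda(X)\big)\,\chi(X)\,d\sigma(X).$$ The (noncommutative) convolution is $$f*\mu_t(X,U)=\int_\Sigma f\Big((X,U)\cdot\big(t\omega,t^2\Lambda(\omega)\big)^{-1}\Big)\chi(\omega)\,d\sigma(\omega)=\int_\Sigma f\big(X-t\omega,\;U-\tfrac t2[X,\omega]-t^2\Lambda(\omega)\big)\chi(\omega)\,d\sigma(\omega).$$ For continuous functions $f$ with compact support on $G$, set $$\mathfrak M_I f(X,U)=\sup_{t\in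 I}|f*\mu_t(X,U)|.$$ "$\mathfrak M_I$ extends to a bounded operator on $L^p(G)$" means that there is a constant $C$ with $\|\mathfrak M_I f\|_{L^p(G)}\le C\|f\|_{L^p(G)}$ for all continuous compactly supported $f$. **Subspaces of $\mathfrak g_1^*$.** For $\vartheta\in\mathfrak g_2^*$ let $\mathcal J^\vartheta:\mathfrak g_1\to\mathfrak g_1^*$ be the linear map sending $X$ to the functional $Y\mapsto\frac12\vartheta([X,Y])$. Define $$\mathbb V_{\Lambda,\vartheta}=\mathrm{range}(\mathcal J^\vartheta)+\mathbb R\,(\vartheta\circ\Lambda)\subset\mathfrak g_1^*.$$ For $\omega^\circ\in\Sigma$, with tangent space $T_{\omega^\circ}\Sigma\subset\mathfrak g_1$, the annihilator of the tangent space is $$(T_{\omega^\circ}\Sigma)^0=\{\phi\in\mathfrak g_1^*:\ \phi(v)=0\ \text{for all } v\in T_{\omega^\circ}\Sigma\}.$$ *)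

theory Defs
  imports "HOL-Analysis.Analysis" "HOL-Probability.Essential_Supremum"
begin

text \<open>The Lie algebra is the direct sum of the Euclidean spaces \<open>'a\<close> (first layer, with its
  fixed scalar product) and \<open>'b\<close> (second layer), realised on the type \<open>'a \<times> 'b\<close>.\<close>

definition lie_bracket :: "('g::real_vector \<Rightarrow> 'g \<Rightarrow> 'g) \<Rightarrow> bool" where
  "lie_bracket br \<longleftrightarrow> bilinear br \<and> (\<forall>x. br x x = 0) \<and>
     (\<forall>x y z. br x (br y z) + br y (br z x) + br z (br x y) = 0)"

definition two_step_bracket ::
  "('a::real_vector \<times> 'b::real_vector \<Rightarrow> 'a \<times> 'b \<Rightarrow> 'a \<times> 'b) \<Rightarrow> bool" where
  "two_step_bracket br \<longleftrightarrow> lie_bracket br \<and>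
     (\<forall>x y. br x y \<in> {0} \<times> UNIV) \<and> (\<forall>z \<in> {0} \<times> UNIV. \<forall>x. br z x = 0)"

definition layer_bracket ::
  "('a::real_vector \<times> 'b::real_vector \<Rightarrow> 'a \<times> 'b \<Rightarrow> 'a \<times> 'b) \<Rightarrow> 'a \<Rightarrow> 'a \<Rightarrow> 'b" where
  "layer_bracket br X Y = snd (br (X, 0) (Y, 0))"

definition group_mult ::
  "('a::real_vector \<times> 'b::real_vector \<Rightarrow> 'a \<times> 'b \<Rightarrow> 'a \<times> 'b) \<Rightarrow> 'a \<times> 'b \<Rightarrow> 'a \<times> 'b \<Rightarrow> 'a \<times> 'b" where
  "group_mult br x y =
     (fst x + fst y, snd x + snd y + (1/2) *\<^sub>R layer_bracket br (fst x) (fst y))"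

lemma layer_bracket_bilinear:
  assumes "two_step_bracket br"
  shows "bilinear (layer_bracket br)"
proof -
  have b: "bilinear br"
    using assms by (simp add: two_step_bracket_def lie_bracket_def)
  have "br (x + y, 0) z = br (x, 0) z + br (y, 0) z" "br z (x + y, 0) = br z (x, 0) + br z (y, 0)"
    "br (c *\<^sub>R x, 0) z = c *\<^sub>R br (x, 0) z" "br z (c *\<^sub>R x, 0) = c *\<^sub>R br z (x, 0)" for x y z c
    using bilinear_ladd[OF b, of "(x, 0)" "(y, 0)" z] bilinear_radd[OF b, of z "(x, 0)" "(y, 0)"]
      bilinear_lmul[OF b, of c "(x, 0)" z] bilinear_rmul[OF b, of z c "(x, 0)"]
    by simp_all
  then show ?thesis
    by (simp add: bilinear_def linear_iff layer_bracket_def)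
qed

lemma layer_bracket_self:
  "two_step_bracket br \<Longrightarrow> layer_bracket br X X = 0"
  by (simp add: two_step_bracket_def lie_bracket_def layer_bracket_def)

text \<open>The group inverse of \<open>x\<close> is \<open>- x\<close>.\<close>

lemma group_mult_uminus:
  assumes "two_step_bracket br"
  shows "group_mult br x (- x) = 0" "group_mult br (- x) x = 0"
  using bilinear_rneg[OF layer_bracket_bilinear[OF assms]]
    bilinear_lneg[OF layer_bracket_bilinear[OF assms]] layer_bracket_self[OF assms]
  by (simp_all add: group_mult_def zero_prod_def)

text \<open>\<open>C^n\<close> functions on an open set; \<open>C^\<infinity>\<close> is \<open>\<forall>n. Ck_on n\<close>.\<close>

primrec Ck_on :: "nat \<Rightarrow> 'a::euclidean_space set \<Rightarrow> ('a \<Rightarrow> 'c::real_normed_vector) \<Rightarrow> bool" where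
  "Ck_on 0 W f \<longleftrightarrow> continuous_on W f"
| "Ck_on (Suc n) W f \<longleftrightarrow> (\<forall>x\<in>W. f differentiable (at x)) \<and>
     (\<forall>v. Ck_on n W (\<lambda>x. frechet_derivative f (at x) v))"

definition compactly_supported :: "('a::topological_space \<Rightarrow> 'c::zero) \<Rightarrow> bool" where
  "compactly_supported f \<longleftrightarrow> compact (closure {x. f x \<noteq> 0})"

definition local_param ::
  "'a::euclidean_space set \<Rightarrow> (real^'k) set \<Rightarrow> (real^'k \<Rightarrow> 'a) \<Rightarrow> bool" where
  "local_param S W \<phi> \<longleftrightarrow> open W \<and> Ck_on 1 W \<phi> \<and>
     (\<forall>x\<in>W. inj (frechet_derivative \<phi> (at x))) \<and>
     openin (top_of_set S) (\<phi> ` W) \<and> (\<exists>\<psi>. homeomorphism W (\<phi> ` W) \<phi> \<psi>)"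

definition C1_submanifold :: "'k::finite itself \<Rightarrow> 'a::euclidean_space set \<Rightarrow> bool" where
  "C1_submanifold k S \<longleftrightarrow>
     (\<forall>p\<in>S. \<exists>(W :: (real^'k) set) \<phi>. local_param S W \<phi> \<and> p \<in> \<phi> ` W)"

definition gram_density :: "(real^'k \<Rightarrow> 'a::euclidean_space) \<Rightarrow> real^'k \<Rightarrow> real" where
  "gram_density \<phi> x = sqrt (det (\<chi> i j. frechet_derivative \<phi> (at x) (axis i 1) \<bullet>
                                           frechet_derivative \<phi> (at x) (axis j 1)))"

text \<open>The induced surface measure is the measure on the Borel sets of \<open>S\<close> given by the usual
  area formula in every local parametrization. As countably many parametrizations cover \<open>S\<close>,
  this determines \<open>\<sigma>\<close> uniquely; the change of variables formula makes the prescribed values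
  consistent, so that \<open>\<sigma>\<close> exists for every \<open>C^1\<close> submanifold.\<close>

definition surface_measure ::
  "'k::finite itself \<Rightarrow> 'a::euclidean_space set \<Rightarrow> 'a measure \<Rightarrow> bool" where
  "surface_measure k S \<sigma> \<longleftrightarrow> space \<sigma> = S \<and> sets \<sigma> = sets (restrict_space borel S) \<and>
     (\<forall>(W :: (real^'k) set) \<phi> B. local_param S W \<phi> \<longrightarrow> B \<in> sets borel \<longrightarrow> B \<subseteq> W \<longrightarrow>
        emeasure \<sigma> (\<phi> ` B) = (\<integral>\<^sup>+x\<in>B. ennreal (gram_density \<phi> x) \<partial>lborel))"

definition tangent_space :: "'a::euclidean_space set \<Rightarrow> 'a \<Rightarrow> 'a set" where
  "tangent_space S p = {v. \<exists>e>0. \<exists>\<gamma>. \<gamma> C1_differentiable_on {-e<..<e} \<and>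
     \<gamma> ` {-e<..<e} \<subseteq> S \<and> \<gamma> 0 = p \<and> (\<gamma> has_vector_derivative v) (at 0)}"

text \<open>Dual spaces are the (finite-dimensional) spaces \<open>_ \<Rightarrow>\<^sub>L real\<close>.\<close>

definition annihilator :: "'a::euclidean_space set \<Rightarrow> ('a \<Rightarrow>\<^sub>L real) set" where
  "annihilator T = {\<phi>. \<forall>v\<in>T. blinfun_apply \<phi> v = 0}"

definition J_map ::
  "('a::euclidean_space \<times> 'b::euclidean_space \<Rightarrow> 'a \<times> 'b \<Rightarrow> 'a \<times> 'b) \<Rightarrow> ('b \<Rightarrow>\<^sub>L real)
     \<Rightarrow> 'a \<Rightarrow> ('a \<Rightarrow>\<^sub>L real)" where
  "J_map br \<theta> X = Blinfun (\<lambda>Y. (1/2) * \<theta> (layer_bracket br X Y))"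

lemma J_map_apply:
  assumes "two_step_bracket br"
  shows "J_map br \<theta> X Y = (1/2) * \<theta> (layer_bracket br X Y)"
proof -
  have "linear (layer_bracket br X)"
    using layer_bracket_bilinear[OF assms] by (simp add: bilinear_def)
  then have "bounded_linear (\<lambda>Y. (1/2) * \<theta> (layer_bracket br X Y))"
    by (intro bounded_linear_const_mult blinfun.bounded_linear_right
        bounded_linear_compose[OF blinfun.bounded_linear_right] linear_conv_bounded_linear[THEN iffD1])
  then show ?thesis
    by (simp add: J_map_def bounded_linear_Blinfun_apply)
qed

definition V_space ::
  "('a::euclidean_space \<times> 'b::euclidean_space \<Rightarrow> 'a \<times> 'b \<Rightarrow> 'a \<times> 'b) \<Rightarrow> ('a \<Rightarrow>\<^sub>L 'b)
     \<Rightarrow> ('b \<Rightarrow>\<^sub>L real) \<Rightarrow> ('a \<Rightarrow>\<^sub>L real) set" where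
  "V_space br \<Lambda> \<theta> = {\<phi> + c *\<^sub>R (\<theta> o\<^sub>L \<Lambda>) | \<phi> c. \<phi> \<in> range (J_map br \<theta>)}"

definition conv_mu ::
  "('a::euclidean_space \<times> 'b::euclidean_space \<Rightarrow> 'a \<times> 'b \<Rightarrow> 'a \<times> 'b) \<Rightarrow> ('a \<Rightarrow>\<^sub>L 'b)
     \<Rightarrow> 'a measure \<Rightarrow> ('a \<Rightarrow> real) \<Rightarrow> real \<Rightarrow> ('a \<times> 'b \<Rightarrow> complex) \<Rightarrow> 'a \<times> 'b \<Rightarrow> complex" where
  "conv_mu br \<Lambda> \<sigma> chi t f x =
     (LINT \<omega>|\<sigma>. chi \<omega> *\<^sub>R f (group_mult br x (- (t *\<^sub>R \<omega>, t\<^sup>2 *\<^sub>R \<Lambda> \<omega>))))"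

lemma conv_mu_explicit:
  assumes "two_step_bracket br"
  shows "conv_mu br \<Lambda> \<sigma> chi t f (X, U) = (LINT \<omega>|\<sigma>. chi \<omega> *\<^sub>R
     f (X - t *\<^sub>R \<omega>, U - (t/2) *\<^sub>R layer_bracket br X \<omega> - t\<^sup>2 *\<^sub>R \<Lambda> \<omega>))"
proof -
  have "layer_bracket br X (- (t *\<^sub>R \<omega>)) = - (t *\<^sub>R layer_bracket br X \<omega>)" for \<omega>
    using layer_bracket_bilinear[OF assms] by (simp add: bilinear_rneg bilinear_rmul)
  then show ?thesis
    by (simp add: conv_mu_def group_mult_def algebra_simps)
qed

definition maximal_op ::
  "('a::euclidean_space \<times> 'b::euclidean_space \<Rightarrow> 'a \<times> 'b \<Rightarrow> 'a \<times> 'b) \<Rightarrow> ('a \<Rightarrow>\<^sub>L 'b)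
     \<Rightarrow> 'a measure \<Rightarrow> ('a \<Rightarrow> real) \<Rightarrow> real set \<Rightarrow> ('a \<times> 'b \<Rightarrow> complex) \<Rightarrow> 'a \<times> 'b \<Rightarrow> ennreal" where
  "maximal_op br \<Lambda> \<sigma> chi I f x = (SUP t\<in>I. ennreal (norm (conv_mu br \<Lambda> \<sigma> chi t f x)))"

definition ennreal_powr :: "ennreal \<Rightarrow> real \<Rightarrow> ennreal" where
  "ennreal_powr x a = (if x = \<infinity> then \<infinity> else ennreal (enn2real x powr a))"

definition Lp_norm :: "ennreal \<Rightarrow> 'g measure \<Rightarrow> ('g \<Rightarrow> ennreal) \<Rightarrow> ennreal" where
  "Lp_norm p M g = (if p = \<infinity> then esssup M g
     else ennreal_powr (\<integral>\<^sup>+x. ennreal_powr (g x) (enn2real p) \<partial>M) (1 / enn2real p))"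

text \<open>Lebesgue measure on \<open>'a \<times> 'b\<close> is a Haar measure of the group.\<close>

definition maximal_op_bounded ::
  "('a::euclidean_space \<times> 'b::euclidean_space \<Rightarrow> 'a \<times> 'b \<Rightarrow> 'a \<times> 'b) \<Rightarrow> ('a \<Rightarrow>\<^sub>L 'b)
     \<Rightarrow> 'a measure \<Rightarrow> ('a \<Rightarrow> real) \<Rightarrow> real set \<Rightarrow> ennreal \<Rightarrow> bool" where
  "maximal_op_bounded br \<Lambda> \<sigma> chi I p \<longleftrightarrow>
     (\<exists>C::real. 0 \<le> C \<and> (\<forall>f. continuous_on UNIV f \<longrightarrow> compactly_supported f \<longrightarrow>
        Lp_norm p lborel (maximal_op br \<Lambda> \<sigma> chi I f)
          \<le> ennreal C * Lp_norm p lborel (\<lambda>x. ennreal (norm (f x)))))"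

end

theory Submission
  imports Defs
begin

text \<open>
  Write \<open>\<lambda> = \<theta> \<circ> \<Lambda>\<close> and \<open>J X = J_map br \<theta> X\<close>. For a point \<open>(X, U)\<close>, a time \<open>t\<close> and a surface point \<open>w\<close> let
  \<open>(Y, W)\<close> be the point at which \<open>f\<close> is evaluated in \<open>f * \<mu>\<^sub>t (X, U)\<close>, so that \<open>Y = X - t w\<close>. Because
  \<open>[X, X] = 0\<close>, one has the linear identity (\<open>second_layer_identity\<close>)
  \<open>\<theta> W = (\<theta> U - t \<lambda> X) + (J X + t \<lambda>) Y\<close>,
  in which \<open>J X + t \<lambda>\<close> belongs to \<open>V_space br \<Lambda> \<theta>\<close>. All test functions below depend on \<open>(Y, W)\<close>, up to
  a cutoff, only through \<open>\<theta> W\<close> and the values at \<open>Y\<close> of the functionals in this space.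

  \<^emph>\<open>Exponents \<open>q\<close> with \<open>q r \<le> r + 1\<close>.\<close> Choose \<open>t = \<theta> U / \<lambda> X\<close>. Then \<open>\<theta> W\<close> is controlled by the \<open>r\<close>
  coordinates of \<open>Y\<close>, so \<open>r\<close> conditions on \<open>w\<close> make \<open>r + 1\<close> independent functionals of \<open>(Y, W)\<close>
  small. The test function is \<open>\<Sum>k\<le>K. 2 ^ (k r)\<close> times a bump on which these functionals are of
  size \<open>2 ^ -k\<close>. Each scale contributes a fixed amount to the averages, hence the maximal function
  is of size \<open>K\<close> in the mean over a fixed open set \<open>G\<close>. The \<open>q\<close>-th power of the \<open>L\<^sup>q\<close> norm is only
  \<open>O(\<Sum>k\<le>K. 2 ^ (k (r q - r - 1)))\<close>, which is \<open>O(K)\<close> if \<open>q > 1\<close> and \<open>O(1)\<close> if \<open>q = 1\<close>. Letting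
  \<open>K \<rightarrow> \<infinity>\<close> excludes all these \<open>q\<close>, the endpoint included (\<open>subcritical_maximal_op_unbounded\<close>).
  The mean over \<open>G\<close> is computed by Tonelli's theorem with \<open>w\<close> fixed (\<open>transport_geometry\<close>,
  \<open>transported_slab_integral\<close>): it reduces to the volume of a slab in the variable \<open>X\<close>.

  \<^emph>\<open>Rank one.\<close> Here \<open>J X\<close> is a multiple of \<open>\<lambda>\<close> that annihilates \<open>X\<close>, which forces \<open>J = 0\<close>
  (\<open>J_map_eq_zero_of_rank_one\<close>). The identity now says \<open>\<theta> W - t \<lambda> Y = \<theta> U - t \<lambda> X\<close>: in the plane with
  coordinates \<open>(\<lambda>, \<theta>)\<close> the operator takes averages over segments of slope \<open>t\<close>, with \<open>t\<close> in an interval. Such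
  an operator is unbounded on every \<open>L\<^sup>q\<close> with \<open>q < \<infinity>\<close>, by a construction of Besicovitch type: thin
  neighbourhoods of finitely many lines cover a set of small measure over one interval, but all of a fixed
  rectangle over another interval (\<open>thin_line_family\<close>, \<open>rank_one_maximal_op_unbounded\<close>).

  In both parts one works near a surface point \<open>w1\<close> with \<open>\<lambda> w1 \<noteq> 0\<close> and \<open>chi w1 > 0\<close>, which exists by
  transversality. The cutoff confines \<open>w\<close> to a small ball around \<open>w1\<close>. This is essential: the
  submanifold need not be closed, so the surface measure may be infinite on the support of \<open>chi\<close>,
  but it is finite and positive on small balls.
\<close>

section \<open>Slabs in a Euclidean space\<close>

lemma emeasure_lborel_shift:
  fixes S :: "'c::euclidean_space set"
  assumes "S \<in> sets borel"
  shows "emeasure lborel {z. z - v \<in> S} = emeasure lborel S"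
proof -
  have "emeasure lborel S = emeasure (distr lborel borel ((+) (- v))) S"
    by (simp add: lborel_distr_plus)
  also have "\<dots> = emeasure lborel {z. z - v \<in> S}"
    using assms by (subst emeasure_distr) (auto intro!: arg_cong[where f="emeasure lborel"])
  finally show ?thesis ..
qed

lemma lborel_shift_borel:
  fixes S :: "'c::euclidean_space set"
  assumes "S \<in> sets borel"
  shows "{z. z - v \<in> S} \<in> sets borel"
  using measurable_sets_borel[OF _ assms, of "\<lambda>z. z - v"] by (simp add: vimage_def)

definition slab :: "'i set \<Rightarrow> ('i \<Rightarrow> 'c::euclidean_space \<Rightarrow> real) \<Rightarrow> ('i \<Rightarrow> real) \<Rightarrow> ('i \<Rightarrow> real) \<Rightarrow> real \<Rightarrow> 'c set"
  where "slab A l k d R = {z. norm z \<le> R \<and> (\<forall>i\<in>A. \<bar>l i z - k i\<bar> \<le> d i)}"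

lemma slab_borel:
  assumes "finite A" "\<And>i. i \<in> A \<Longrightarrow> linear (l i)"
  shows "slab A l k d R \<in> sets borel"
proof -
  have "closed {z. \<bar>l i z - k i\<bar> \<le> d i}" if "i \<in> A" for i
    using assms(2)[OF that]
    by (intro closed_Collect_le continuous_intros linear_continuous_on)
      (simp_all add: linear_conv_bounded_linear)
  then have "closed ({z. norm z \<le> R} \<inter> (\<Inter>i\<in>A. {z. \<bar>l i z - k i\<bar> \<le> d i}))"
    by (intro closed_Int closed_INT ballI closed_Collect_le continuous_intros) auto
  also have "\<dots> = slab A l k d R"
    by (auto simp: slab_def)
  finally show ?thesis by (rule borel_closed)
qed

text \<open>
  The vectors \<open>e i\<close> are dual to the functionals, so a shift along \<open>e i\<close> changes only \<open>l i\<close>. Shifts of the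
  slab by multiples of \<open>3 * d i\<close> along \<open>e i\<close> are disjoint, at least \<open>1 / d i\<close> of them have length at most
  3 \<open>K\<close>, and together they lie in the slab without the \<open>i\<close>-th constraint. Removing one
  constraint after the other leaves a ball.
\<close>

lemma slab_measure_upper:
  fixes l :: "'i \<Rightarrow> 'c::euclidean_space \<Rightarrow> real" and e :: "'i \<Rightarrow> 'c"
  assumes "finite A" "\<And>i. i \<in> A \<Longrightarrow> linear (l i)"
    and "\<And>i j. i \<in> A \<Longrightarrow> j \<in> A \<Longrightarrow> l i (e j) = (if i = j then 1 else 0)"
    and "\<And>i. i \<in> A \<Longrightarrow> norm (e i) \<le> K"
    and "\<And>i. i \<in> A \<Longrightarrow> 0 < d i" "\<And>i. i \<in> A \<Longrightarrow> d i \<le> 1"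
  shows "emeasure lborel (slab A l k d R)
    \<le> ennreal (\<Prod>i\<in>A. d i) * emeasure lborel (cball (0::'c) (R + 3 * K * card A))"
  using assms
proof (induction A arbitrary: R rule: finite_induct)
  case empty
  show ?case by (simp add: slab_def cball_def dist_norm)
next
  case (insert a A)
  define N where "N = nat \<lceil>1 / d a\<rceil>"
  have da: "0 < d a" "d a \<le> 1" using insert.prems by auto
  have K: "norm (e a) \<le> K" using insert.prems by auto
  have N1: "1 \<le> d a * real N"
  proof -
    have "1 / d a \<le> real N" unfolding N_def by (rule real_nat_ceiling_ge)
    then show ?thesis using da by (simp add: field_simps)
  qed
  have N2: "d a * real n \<le> 1" if "n < N" for n
  proof -
    have "real n < 1 / d a" using that unfolding N_def by linarith
    then show ?thesis using da by (simp add: field_simps)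
  qed
  let ?S = "slab (insert a A) l k d R"
  let ?T = "\<lambda>n. {z. z - (3 * d a * real n) *\<^sub>R e a \<in> ?S}"
  have lin: "\<And>i. i \<in> insert a A \<Longrightarrow> linear (l i)" using insert.prems by blast
  have S: "?S \<in> sets borel" using insert by (intro slab_borel) auto
  have la: "l i (z - c *\<^sub>R e a) = l i z - (if i = a then c else 0)" if "i \<in> insert a A" for i z c
    using lin[OF that] insert.prems(2)[OF that, of a]
    by (simp add: linear_diff linear_cmul)
  have T: "?T n \<in> sets borel" for n
    using S by (rule lborel_shift_borel)
  have disj: "disjoint_family_on ?T {..<N}"
  proof (unfold disjoint_family_on_def, intro ballI impI)
    fix m n :: nat assume "m \<noteq> n"
    show "?T m \<inter> ?T n = {}"
    proof (rule ccontr)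
      assume "?T m \<inter> ?T n \<noteq> {}"
      then obtain z where "z \<in> ?T m" "z \<in> ?T n" by auto
      then have "\<bar>l a z - 3 * d a * real m - k a\<bar> \<le> d a" "\<bar>l a z - 3 * d a * real n - k a\<bar> \<le> d a"
        by (auto simp: slab_def la)
      then have "\<bar>3 * d a * (real m - real n)\<bar> \<le> 2 * d a" by (simp add: algebra_simps)
      then have "3 * \<bar>real m - real n\<bar> \<le> 2" using da by (simp add: abs_mult)
      moreover have "3 * 1 \<le> 3 * \<bar>real m - real n\<bar>"
        using \<open>m \<noteq> n\<close> by (cases m n rule: linorder_cases) auto
      ultimately have "3 * 1 \<le> (2::real)" by (rule order.trans[rotated])
      then show False by simp
    qed
  qed
  have sub: "(\<Union>n<N. ?T n) \<subseteq> slab A l k d (R + 3 * K)"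
  proof safe
    fix n z assume n: "n < N" and z: "z - (3 * d a * real n) *\<^sub>R e a \<in> ?S"
    have "norm z \<le> norm (z - (3 * d a * real n) *\<^sub>R e a) + norm ((3 * d a * real n) *\<^sub>R e a)"
      using norm_triangle_ineq[of "z - (3 * d a * real n) *\<^sub>R e a" "(3 * d a * real n) *\<^sub>R e a"] by simp
    also have "\<dots> \<le> R + 3 * K"
    proof (rule add_mono)
      show "norm ((3 * d a * real n) *\<^sub>R e a) \<le> 3 * K"
        using N2[OF n] da K mult_mono[of "3 * d a * real n" 3 "norm (e a)" K] by simp
    qed (use z in \<open>simp add: slab_def\<close>)
    moreover have "\<bar>l i z - k i\<bar> \<le> d i" if "i \<in> A" for i
    proof -
      have "i \<noteq> a" using that insert.hyps by blast
      moreover have "\<bar>l i (z - (3 * d a * real n) *\<^sub>R e a) - k i\<bar> \<le> d i"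
        using z that by (simp add: slab_def)
      ultimately show ?thesis using that by (simp add: la)
    qed
    ultimately show "z \<in> slab A l k d (R + 3 * K)"
      by (simp add: slab_def)
  qed
  have "ennreal (real N) * emeasure lborel ?S = (\<Sum>n<N. emeasure lborel (?T n))"
    using emeasure_lborel_shift[OF S] by (simp add: ennreal_of_nat_eq_real_of_nat)
  also have "\<dots> = emeasure lborel (\<Union>n<N. ?T n)"
    using T disj by (intro sum_emeasure) auto
  also have "\<dots> \<le> emeasure lborel (slab A l k d (R + 3 * K))"
    using insert sub by (intro emeasure_mono) (auto intro!: slab_borel)
  also have "\<dots> \<le> ennreal (\<Prod>i\<in>A. d i) * emeasure lborel (cball (0::'c) (R + 3 * K + 3 * K * card A))"
    using insert by (intro insert.IH) auto
  finally have *: "ennreal (real N) * emeasure lborel ?S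
    \<le> ennreal (\<Prod>i\<in>A. d i) * emeasure lborel (cball (0::'c) (R + 3 * K + 3 * K * card A))" .
  have "emeasure lborel ?S \<le> ennreal (d a * real N) * emeasure lborel ?S"
    using N1 by (metis ennreal_1 ennreal_leI mult.left_neutral mult_right_mono zero_le)
  also have "\<dots> = ennreal (d a) * (ennreal (real N) * emeasure lborel ?S)"
    using da by (simp add: ennreal_mult mult.assoc)
  also have "\<dots> \<le> ennreal (d a) * (ennreal (\<Prod>i\<in>A. d i) * emeasure lborel (cball (0::'c) (R + 3 * K + 3 * K * card A)))"
    by (intro mult_left_mono *) auto
  also have "\<dots> = ennreal (\<Prod>i\<in>insert a A. d i) * emeasure lborel (cball (0::'c) (R + 3 * K * card (insert a A)))"
    using insert da by (simp add: ennreal_mult prod_nonneg less_imp_le mult.assoc algebra_simps)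
  finally show ?case .
qed

lemma round_towards_zero: "\<exists>n::int. \<bar>x - of_int n\<bar> \<le> 1 \<and> \<bar>of_int n\<bar> \<le> \<bar>x :: real\<bar>"
proof (cases "x \<ge> 0")
  case True
  then have "0 \<le> \<lfloor>x\<rfloor>" by simp
  then show ?thesis using True by (intro exI[of _ "\<lfloor>x\<rfloor>"]) linarith
next
  case False
  then have "\<lceil>x\<rceil> \<le> 0" by (simp add: ceiling_le_iff)
  then show ?thesis using False by (intro exI[of _ "\<lceil>x\<rceil>"]) linarith
qed

text \<open>
  Converse of the packing bound: \<open>O(1 / d)\<close> shifts along \<open>e i\<close> of the slab with the \<open>i\<close>-th constraint cover
  the slab without it, in a ball whose radius is smaller by a constant factor.
\<close>

lemma slab_measure_lower:
  fixes l :: "'i \<Rightarrow> 'c::euclidean_space \<Rightarrow> real" and e :: "'i \<Rightarrow> 'c"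
  assumes "finite A" "\<And>i. i \<in> A \<Longrightarrow> linear (l i)"
    and "\<And>i j. i \<in> A \<Longrightarrow> j \<in> A \<Longrightarrow> l i (e j) = (if i = j then 1 else 0)"
    and "0 < R"
  shows "\<exists>c>0. \<forall>d. 0 < d \<longrightarrow> d \<le> 1 \<longrightarrow>
     ennreal (c * d ^ card A) \<le> emeasure lborel (slab A l (\<lambda>_. 0) (\<lambda>_. d) R)"
  using assms
proof (induction A arbitrary: R rule: finite_induct)
  case empty
  have "emeasure lborel (ball (0::'c) R) \<le> emeasure lborel (slab {} l (\<lambda>_. 0) (\<lambda>_. d) R)" for d
    using slab_borel[of "{}" l "\<lambda>_. 0" "\<lambda>_. d" R] by (intro emeasure_mono) (auto simp: slab_def)
  moreover have "emeasure lborel (ball (0::'c) R) = ennreal (measure lborel (ball (0::'c) R))"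
    using emeasure_lborel_ball_finite[of "0::'c" R] by (intro emeasure_eq_ennreal_measure) (simp add: less_top)
  moreover have "0 < measure lborel (ball (0::'c) R)"
    using content_ball_pos[OF empty.prems(3)] by simp
  ultimately show ?case by (auto intro!: exI[of _ "measure lborel (ball (0::'c) R)"])
next
  case (insert a A)
  have lin: "\<And>i. i \<in> insert a A \<Longrightarrow> linear (l i)" using insert.prems by blast
  have la: "l i (z - c *\<^sub>R e a) = l i z - (if i = a then c else 0)" if "i \<in> insert a A" for i z c
    using lin[OF that] insert.prems(2)[OF that, of a]
    by (simp add: linear_diff linear_cmul)
  obtain B where B: "B > 0" "\<And>z. \<bar>l a z\<bar> \<le> B * norm z"
    using lin[of a] linear_bounded_pos[of "l a"] by auto
  \<comment> \<open>The covering shifts have length at most \<open>B * \<rho> * norm (e a)\<close>, so the shifted points stay within \<open>R\<close>.\<close>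
  define \<rho> where "\<rho> = R / (1 + B * (norm (e a) + 1))"
  have den: "1 + B * (norm (e a) + 1) > 0" using B by (simp add: add_pos_nonneg)
  have \<rho>: "0 < \<rho>" using insert.prems(3) den by (simp add: \<rho>_def)
  have \<rho>R: "\<rho> + B * \<rho> * norm (e a) \<le> R"
  proof -
    have "\<rho> * (1 + B * (norm (e a) + 1)) = R" using den by (simp add: \<rho>_def)
    moreover have "\<rho> * (1 + B * (norm (e a) + 1)) = \<rho> + B * \<rho> * norm (e a) + B * \<rho>"
      by (simp add: algebra_simps)
    ultimately show ?thesis using B \<rho> by (smt (verit) mult_pos_pos)
  qed
  obtain c where c: "c > 0" "\<And>d. 0 < d \<Longrightarrow> d \<le> 1 \<Longrightarrow>
     ennreal (c * d ^ card A) \<le> emeasure lborel (slab A l (\<lambda>_. 0) (\<lambda>_. d) \<rho>)"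
    using insert.IH[OF _ _ \<rho>] insert.prems by (metis insertCI)
  define M where "M = 2 * B * \<rho> + 3"
  have M: "M > 0" using B \<rho> by (simp add: M_def add_pos_pos)
  have main: "ennreal (c / M * d ^ card (insert a A)) \<le> emeasure lborel (slab (insert a A) l (\<lambda>_. 0) (\<lambda>_. d) R)"
    if d: "0 < d" "d \<le> 1" for d
  proof -
    let ?S = "slab (insert a A) l (\<lambda>_. 0) (\<lambda>_. d) R"
    let ?T = "\<lambda>n::int. {z. z - (d * real_of_int n) *\<^sub>R e a \<in> ?S}"
    define q where "q = \<lfloor>B * \<rho> / d\<rfloor>"
    have q: "0 \<le> q" using B \<rho> d by (simp add: q_def)
    have S: "?S \<in> sets borel" using insert by (intro slab_borel) auto
    have T: "?T n \<in> sets borel" for n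
      using S by (rule lborel_shift_borel)
    have sub: "slab A l (\<lambda>_. 0) (\<lambda>_. d) \<rho> \<subseteq> (\<Union>n\<in>{-q-1..q+1}. ?T n)"
    proof
      fix z assume z: "z \<in> slab A l (\<lambda>_. 0) (\<lambda>_. d) \<rho>"
      have zn: "norm z \<le> \<rho>" using z by (simp add: slab_def)
      have lz: "\<bar>l a z\<bar> \<le> B * \<rho>" using B(2)[of z] mult_left_mono[OF zn, of B] B(1) by linarith
      obtain n :: int where n: "\<bar>l a z / d - n\<bar> \<le> 1" "\<bar>real_of_int n\<bar> \<le> \<bar>l a z / d\<bar>"
        using round_towards_zero by blast
      have n1: "\<bar>l a z - d * n\<bar> \<le> d"
      proof -
        have "\<bar>l a z - d * n\<bar> = d * \<bar>l a z / d - n\<bar>"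
          using d by (simp add: abs_mult_pos' right_diff_distrib)
        then show ?thesis using n(1) d by (simp add: mult_left_le)
      qed
      have n2: "\<bar>d * n\<bar> \<le> \<bar>l a z\<bar>"
        using n(2) d by (simp add: abs_mult field_simps)
      have nq: "n \<in> {-q-1..q+1}"
      proof -
        have "\<bar>real_of_int n\<bar> \<le> B * \<rho> / d"
          using n2 lz d by (simp add: abs_mult pos_le_divide_eq mult.commute)
        then have "\<bar>n\<bar> \<le> q" unfolding q_def by (metis le_floor_iff of_int_abs)
        then show ?thesis by auto
      qed
      have "norm (z - (d * n) *\<^sub>R e a) \<le> norm z + \<bar>d * n\<bar> * norm (e a)"
        by (metis norm_scaleR norm_triangle_ineq4)
      also have "\<dots> \<le> \<rho> + B * \<rho> * norm (e a)"
        using zn n2 lz by (intro add_mono mult_right_mono) auto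
      finally have "norm (z - (d * n) *\<^sub>R e a) \<le> R" using \<rho>R by linarith
      moreover have "\<bar>l i z\<bar> \<le> d" if "i \<in> A" for i
        using z that by (simp add: slab_def)
      ultimately have "z \<in> ?T n"
        using n1 by (auto simp: slab_def la)
      then show "z \<in> (\<Union>n\<in>{-q-1..q+1}. ?T n)" using nq by blast
    qed
    have cnt: "real_of_int (2 * q + 3) \<le> M / d"
    proof -
      have "real_of_int q \<le> B * \<rho> / d" by (simp add: q_def)
      moreover have "3 \<le> 3 / d" using d by (simp add: field_simps)
      ultimately show ?thesis by (simp add: M_def add_divide_distrib)
    qed
    have "ennreal (c * d ^ card A) \<le> emeasure lborel (slab A l (\<lambda>_. 0) (\<lambda>_. d) \<rho>)"
      using c d by simp
    also have "\<dots> \<le> emeasure lborel (\<Union>n\<in>{-q-1..q+1}. ?T n)"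
      using T by (intro emeasure_mono sub) auto
    also have "\<dots> \<le> (\<Sum>n\<in>{-q-1..q+1}. emeasure lborel (?T n))"
      using T by (intro emeasure_subadditive_finite) auto
    also have "\<dots> = ennreal (real_of_int (2 * q + 3)) * emeasure lborel ?S"
      using q by (simp add: emeasure_lborel_shift[OF S] ennreal_of_nat_eq_real_of_nat add.commute)
    also have "\<dots> \<le> ennreal (M / d) * emeasure lborel ?S"
      using cnt by (intro mult_right_mono ennreal_leI) auto
    finally have "ennreal (d / M) * ennreal (c * d ^ card A) \<le> ennreal (d / M) * (ennreal (M / d) * emeasure lborel ?S)"
      by (intro mult_left_mono) auto
    also have "\<dots> = emeasure lborel ?S"
      using d M by (simp add: mult.assoc[symmetric] ennreal_mult[symmetric])
    also have "ennreal (d / M) * ennreal (c * d ^ card A) = ennreal (c / M * d ^ card (insert a A))"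
      using d M c insert.hyps by (simp add: ennreal_mult[symmetric])
    finally show ?thesis .
  qed
  then show ?case using c(1) M by (intro exI[of _ "c / M"]) auto
qed

text \<open>
  Given dual vectors for all functionals but \<open>l a\<close>, the independence hypothesis yields a vector on which
  \<open>l a\<close> differs from its interpolation \<open>\<Sum>i. l a (e i) * l i\<close>. Corrected by the \<open>e i\<close>, it becomes
  the dual vector of \<open>l a\<close>, and the others are then corrected by it.
\<close>

lemma dual_vectors_exist:
  fixes l :: "'i \<Rightarrow> 'c::real_vector \<Rightarrow> real"
  assumes "finite A" "\<And>i. i \<in> A \<Longrightarrow> linear (l i)"
    and "\<And>c. (\<And>z. (\<Sum>i\<in>A. c i * l i z) = 0) \<Longrightarrow> \<forall>i\<in>A. c i = 0"
  shows "\<exists>e. \<forall>i\<in>A. \<forall>j\<in>A. l i (e j) = (if i = j then 1 else 0)"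
  using assms
proof (induction A rule: finite_induct)
  case empty
  then show ?case by simp
next
  case (insert a A)
  have lin: "\<And>i. i \<in> insert a A \<Longrightarrow> linear (l i)" using insert.prems by blast
  have "\<exists>e. \<forall>i\<in>A. \<forall>j\<in>A. l i (e j) = (if i = j then 1 else 0)"
  proof (rule insert.IH)
    fix c assume c: "\<And>z. (\<Sum>i\<in>A. c i * l i z) = 0"
    define c' where "c' = c(a := 0)"
    have "(\<Sum>i\<in>insert a A. c' i * l i z) = (\<Sum>i\<in>A. c i * l i z)" for z
      using insert.hyps by (simp add: c'_def) (intro sum.cong, auto)
    then have "\<forall>i\<in>insert a A. c' i = 0" using c by (intro insert.prems) auto
    then show "\<forall>i\<in>A. c i = 0" using insert.hyps by (auto simp: c'_def split: if_splits)
  qed (use lin in auto)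
  then obtain e where e: "\<And>i j. i \<in> A \<Longrightarrow> j \<in> A \<Longrightarrow> l i (e j) = (if i = j then 1 else 0)"
    by blast
  define c where "c i = (if i = a then 1 else - l a (e i))" for i
  have "\<exists>z. (\<Sum>i\<in>insert a A. c i * l i z) \<noteq> 0"
    using insert.prems(2)[of c] by (auto simp: c_def)
  then obtain z where z: "(\<Sum>i\<in>insert a A. c i * l i z) \<noteq> 0" by blast
  have "(\<Sum>i\<in>A. c i * l i z) = - (\<Sum>i\<in>A. l a (e i) * l i z)"
    unfolding sum_negf[symmetric] using insert.hyps by (intro sum.cong) (auto simp: c_def)
  then have \<beta>: "l a z - (\<Sum>i\<in>A. l a (e i) * l i z) \<noteq> 0" (is "?\<beta> \<noteq> 0")
    using z insert.hyps by (simp add: c_def)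
  define z' where "z' = (1 / ?\<beta>) *\<^sub>R (z - (\<Sum>i\<in>A. l i z *\<^sub>R e i))"
  have lz': "l j z' = (l j z - (\<Sum>i\<in>A. l i z * l j (e i))) / ?\<beta>" if "j \<in> insert a A" for j
    using lin[OF that] by (simp add: z'_def linear_cmul linear_diff linear_sum sum_divide_distrib[symmetric] diff_divide_distrib[symmetric])
  have z'A: "l j z' = 0" if "j \<in> A" for j
  proof -
    have "(\<Sum>i\<in>A. l i z * l j (e i)) = (\<Sum>i\<in>A. if j = i then l i z else 0)"
      using that e by (intro sum.cong) auto
    also have "\<dots> = l j z" using that insert.hyps by simp
    finally show ?thesis using lz'[of j] that by simp
  qed
  have z'a: "l a z' = 1"
    using lz'[of a] \<beta> by (simp add: mult.commute)
  define e' where "e' j = (if j = a then z' else e j - l a (e j) *\<^sub>R z')" for j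
  have "l i (e' j) = (if i = j then 1 else 0)" if "i \<in> insert a A" "j \<in> insert a A" for i j
    using that lin[OF that(1)] z'A z'a e insert.hyps
    by (auto simp: e'_def linear_diff linear_cmul)
  then show ?case by blast
qed

section \<open>Surface measure near a point\<close>

lemma continuous_on_det:
  fixes A :: "'a::topological_space \<Rightarrow> real^'n^'n"
  assumes "\<And>i j. continuous_on S (\<lambda>x. A x $ i $ j)"
  shows "continuous_on S (\<lambda>x. det (A x))"
  unfolding det_def by (intro continuous_on_sum continuous_on_mult continuous_on_prod continuous_on_const assms)

text \<open>
  The matrices on the segment from the identity to \<open>G\<close> are positive definite, hence invertible, so the
  determinant keeps its sign along the segment.
\<close>

lemma positive_definite_det_pos:
  fixes G :: "real^'n^'n"
  assumes "\<And>x. x \<noteq> 0 \<Longrightarrow> x \<bullet> (G *v x) > 0"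
  shows "det G > 0"
proof (rule ccontr)
  assume neg: "\<not> det G > 0"
  define M where "M s = (1 - s) *\<^sub>R mat 1 + s *\<^sub>R G" for s :: real
  have nz: "det (M s) \<noteq> 0" if s: "0 \<le> s" "s \<le> 1" for s
  proof -
    have "x = 0" if "M s *v x = 0" for x
    proof (rule ccontr)
      assume x: "x \<noteq> 0"
      have "x \<bullet> (M s *v x) = (1 - s) * (x \<bullet> x) + s * (x \<bullet> (G *v x))"
        by (simp add: M_def matrix_vector_mult_add_rdistrib inner_right_distrib
            scaleR_matrix_vector_assoc[symmetric])
      moreover have "(1 - s) * (x \<bullet> x) + s * (x \<bullet> (G *v x)) > 0"
      proof (cases "s = 0")
        case False
        then have "s * (x \<bullet> (G *v x)) > 0" using s assms[OF x] by simp
        then show ?thesis using s by (simp add: add_nonneg_pos)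
      qed (use x in simp)
      ultimately show False using that by simp
    qed
    then have "invertible (M s)"
      by (metis invertible_left_inverse matrix_left_invertible_ker)
    then show ?thesis by (simp add: invertible_det_nz)
  qed
  have "continuous_on {0..1} (\<lambda>s. det (M s))"
    unfolding M_def by (intro continuous_on_det) (auto simp: mat_def intro!: continuous_intros)
  then have "\<exists>s. 0 \<le> s \<and> s \<le> 1 \<and> det (M s) = 0"
    using neg by (intro IVT2') (auto simp: M_def)
  then show False using nz by blast
qed

lemma gram_density_pos:
  fixes \<phi> :: "real^'n \<Rightarrow> 'a::euclidean_space"
  assumes "\<phi> differentiable (at x)" "inj (frechet_derivative \<phi> (at x))"
  shows "gram_density \<phi> x > 0"
proof -
  let ?D = "frechet_derivative \<phi> (at x)"
  let ?G = "\<chi> i j. ?D (axis i 1) \<bullet> ?D (axis j 1) :: real^'n^'n"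
  have lin: "linear ?D" using assms(1) by (rule linear_frechet_derivative)
  have D: "?D v = (\<Sum>j\<in>UNIV. (v $ j) *\<^sub>R ?D (axis j 1))" for v
  proof -
    have "?D v = ?D (\<Sum>j\<in>UNIV. (v $ j) *\<^sub>R axis j 1)"
      using basis_expansion[of v] by (simp add: scalar_mult_eq_scaleR)
    then show ?thesis using lin by (simp add: linear_sum linear_cmul)
  qed
  have "v \<bullet> (?G *v v) = ?D v \<bullet> ?D v" for v
  proof -
    have "v \<bullet> (?G *v v) = (\<Sum>i\<in>UNIV. v $ i * (\<Sum>j\<in>UNIV. (?D (axis i 1) \<bullet> ?D (axis j 1)) * v $ j))"
      by (simp add: inner_vec_def matrix_vector_mult_def)
    also have "\<dots> = (\<Sum>i\<in>UNIV. v $ i * (?D (axis i 1) \<bullet> ?D v))"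
      by (subst (3) D) (simp add: inner_sum_right mult.commute)
    also have "\<dots> = ?D v \<bullet> ?D v"
      by (subst (3) D) (simp add: inner_sum_left)
    finally show ?thesis .
  qed
  moreover have "?D v \<noteq> 0" if "v \<noteq> 0" for v
    using assms(2) lin that by (metis injD linear_0)
  ultimately have "det ?G > 0"
    by (intro positive_definite_det_pos) simp
  then show ?thesis by (simp add: gram_density_def)
qed

lemma gram_density_continuous_on:
  assumes "Ck_on 1 W \<phi>"
  shows "continuous_on W (gram_density \<phi>)"
proof -
  have *: "continuous_on W (\<lambda>x. frechet_derivative \<phi> (at x) v)" for v
    using assms by simp
  show ?thesis
    unfolding gram_density_def
    by (intro continuous_on_det continuous_on_real_sqrt) (simp add: continuous_on_inner *)
qed

lemma Ck_on_1_imp_continuous_on: "Ck_on 1 W \<phi> \<Longrightarrow> continuous_on W \<phi>"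
  by (simp add: continuous_at_imp_continuous_on differentiable_imp_continuous_within)

lemma surface_measure_ball_sets:
  assumes "surface_measure k S \<sigma>" "B \<in> sets borel"
  shows "S \<inter> B \<in> sets \<sigma>"
  using assms by (auto simp: surface_measure_def sets_restrict_space)

lemma surface_measure_chart:
  fixes \<phi> :: "real^'k \<Rightarrow> 'a::euclidean_space"
  assumes "surface_measure TYPE('k) S \<sigma>" "local_param S W \<phi>" "B \<in> sets borel" "B \<subseteq> W"
  shows "emeasure \<sigma> (\<phi> ` B) = (\<integral>\<^sup>+x\<in>B. ennreal (gram_density \<phi> x) \<partial>lborel)"
  using assms unfolding surface_measure_def by blast

text \<open>
  In a chart the measure has the Gram density, which is continuous and positive.
\<close>

lemma surface_measure_ball_pos:
  fixes S :: "'a::euclidean_space set"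
  assumes S: "C1_submanifold TYPE('k::finite) S" "surface_measure TYPE('k) S \<sigma>"
    and p: "p \<in> S" and r: "r > 0"
  shows "emeasure \<sigma> (S \<inter> ball p r) > 0"
proof -
  obtain W :: "(real^'k) set" and \<phi> x0 where lp: "local_param S W \<phi>" and x0: "x0 \<in> W" "p = \<phi> x0"
    using S(1) p unfolding C1_submanifold_def by blast
  have W: "open W" "Ck_on 1 W \<phi>" "\<phi> ` W \<subseteq> S"
    using lp openin_imp_subset[of euclidean S "\<phi> ` W"] by (simp_all add: local_param_def)
  have g0: "gram_density \<phi> x0 > 0"
    using lp x0 by (intro gram_density_pos) (auto simp: local_param_def)
  have "isCont (gram_density \<phi>) x0" "isCont \<phi> x0"
    using gram_density_continuous_on[OF W(2)] Ck_on_1_imp_continuous_on[OF W(2)] W(1) x0(1)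
    by (simp_all add: continuous_on_eq_continuous_at)
  then have t: "(gram_density \<phi> \<longlongrightarrow> gram_density \<phi> x0) (nhds x0)" "(\<phi> \<longlongrightarrow> \<phi> x0) (nhds x0)"
    by (simp_all add: isCont_def tendsto_at_iff_tendsto_nhds)
  have "eventually (\<lambda>x. gram_density \<phi> x > gram_density \<phi> x0 / 2) (nhds x0)"
    using g0 by (intro order_tendstoD(1)[OF t(1)]) simp
  moreover have "eventually (\<lambda>x. \<phi> x \<in> ball p r) (nhds x0)"
    using r x0 by (intro topological_tendstoD[OF t(2)]) auto
  moreover have "eventually (\<lambda>x. x \<in> W) (nhds x0)"
    using W x0 by (simp add: eventually_nhds_in_open)
  ultimately have "eventually (\<lambda>x. x \<in> W \<and> \<phi> x \<in> ball p r \<and> gram_density \<phi> x > gram_density \<phi> x0 / 2) (nhds x0)"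
    by eventually_elim auto
  then obtain s where s: "s > 0" "\<And>x. x \<in> ball x0 s \<Longrightarrow>
      x \<in> W \<and> \<phi> x \<in> ball p r \<and> gram_density \<phi> x > gram_density \<phi> x0 / 2"
    unfolding eventually_nhds_metric by (auto simp: dist_commute)
  have "0 < ennreal (gram_density \<phi> x0 / 2) * emeasure lborel (ball x0 s)"
    using g0 content_ball_pos[OF s(1), of x0] emeasure_lborel_ball_finite[of x0 s]
    by (simp add: ennreal_zero_less_mult_iff emeasure_eq_ennreal_measure less_top)
  also have "\<dots> = (\<integral>\<^sup>+x\<in>ball x0 s. ennreal (gram_density \<phi> x0 / 2) \<partial>lborel)"
    by (simp add: nn_integral_cmult_indicator)
  also have "\<dots> \<le> (\<integral>\<^sup>+x\<in>ball x0 s. ennreal (gram_density \<phi> x) \<partial>lborel)"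
    using s(2) by (intro nn_integral_mono) (auto simp: indicator_def less_imp_le intro!: ennreal_leI)
  also have "\<dots> = emeasure \<sigma> (\<phi> ` ball x0 s)"
    using surface_measure_chart[OF S(2) lp, of "ball x0 s"] s(2) by (simp add: subset_eq)
  also have "\<dots> \<le> emeasure \<sigma> (S \<inter> ball p r)"
    using s(2) W by (intro emeasure_mono surface_measure_ball_sets[OF S(2)]) auto
  finally show ?thesis .
qed

text \<open>
  The image of a small ball in a chart is relatively open in \<open>S\<close>, so it contains all of \<open>S\<close> near \<open>p\<close>, and its
  measure is an integral of a bounded density. No other sheet of \<open>S\<close> can accumulate at \<open>p\<close>.
\<close>

lemma surface_measure_locally_finite:
  fixes S :: "'a::euclidean_space set"
  assumes S: "C1_submanifold TYPE('k::finite) S" "surface_measure TYPE('k) S \<sigma>"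
    and p: "p \<in> S"
  shows "\<exists>r>0. emeasure \<sigma> (S \<inter> ball p r) < \<infinity>"
proof -
  obtain W :: "(real^'k) set" and \<phi> x0 where lp: "local_param S W \<phi>" and x0: "x0 \<in> W" "p = \<phi> x0"
    using S(1) p unfolding C1_submanifold_def by blast
  then obtain \<psi> where W: "open W" "Ck_on 1 W \<phi>" "openin (top_of_set S) (\<phi> ` W)"
    and \<psi>: "homeomorphism W (\<phi> ` W) \<phi> \<psi>"
    by (auto simp: local_param_def)
  obtain s where s: "s > 0" "cball x0 s \<subseteq> W"
    using W x0 by (auto simp: open_contains_cball)
  then have bW: "ball x0 s \<subseteq> W" by auto
  have "openin (top_of_set (\<phi> ` W)) (\<phi> ` ball x0 s)"
    using bW W by (intro homeomorphism_imp_open_map[OF \<psi>]) (simp add: openin_open_eq)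
  then have "openin (top_of_set S) (\<phi> ` ball x0 s)"
    using W(3) openin_trans by blast
  then obtain U where U: "open U" "\<phi> ` ball x0 s = S \<inter> U"
    by (auto simp: openin_open)
  moreover have "p \<in> \<phi> ` ball x0 s" using x0 s by auto
  ultimately obtain r where r: "r > 0" "ball p r \<subseteq> U"
    by (auto simp: open_contains_ball)
  have "compact (gram_density \<phi> ` cball x0 s)"
    using continuous_on_subset[OF gram_density_continuous_on[OF W(2)] s(2)]
    by (intro compact_continuous_image) auto
  then have "bounded (gram_density \<phi> ` cball x0 s)" by (rule compact_imp_bounded)
  then obtain M where "\<forall>y\<in>gram_density \<phi> ` cball x0 s. norm y \<le> M"
    unfolding bounded_iff by blast
  then have M: "gram_density \<phi> x \<le> M" if "x \<in> ball x0 s" for x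
    using that by (force simp: abs_le_iff)
  have "emeasure \<sigma> (S \<inter> ball p r) \<le> emeasure \<sigma> (\<phi> ` ball x0 s)"
    using r U surface_measure_ball_sets[OF S(2), of U] by (intro emeasure_mono) auto
  also have "\<dots> = (\<integral>\<^sup>+x\<in>ball x0 s. ennreal (gram_density \<phi> x) \<partial>lborel)"
    using surface_measure_chart[OF S(2) lp, of "ball x0 s"] bW by simp
  also have "\<dots> \<le> (\<integral>\<^sup>+x\<in>ball x0 s. ennreal M \<partial>lborel)"
    using M by (intro nn_integral_mono) (simp add: indicator_def ennreal_leI)
  also have "\<dots> = ennreal M * emeasure lborel (ball x0 s)"
    by (simp add: nn_integral_cmult_indicator)
  also have "\<dots> < \<infinity>"
    using emeasure_lborel_ball_finite[of x0 s] by (simp add: ennreal_mult_less_top)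
  finally show ?thesis using r by blast
qed

text \<open>
  Otherwise \<open>l\<close> would be constant along every curve in \<open>S\<close> through \<open>p\<close>, and its derivative \<open>l v\<close> would vanish for
  every tangent vector \<open>v\<close>.
\<close>

lemma functional_nonzero_near_point:
  fixes S :: "'a::euclidean_space set" and l :: "'a \<Rightarrow>\<^sub>L real"
  assumes "l \<notin> annihilator (tangent_space S p)" "r > 0"
  shows "\<exists>w\<in>S \<inter> ball p r. l w \<noteq> 0"
proof (rule ccontr)
  assume "\<not> ?thesis"
  then have l0: "\<And>w. w \<in> S \<Longrightarrow> w \<in> ball p r \<Longrightarrow> l w = 0" by blast
  obtain v where v: "v \<in> tangent_space S p" "l v \<noteq> 0"
    using assms(1) by (auto simp: annihilator_def)
  then obtain e \<gamma> where e: "e > 0" and \<gamma>: "\<gamma> C1_differentiable_on {-e<..<e}"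
    "\<gamma> ` {-e<..<e} \<subseteq> S" "\<gamma> 0 = p" "(\<gamma> has_vector_derivative v) (at 0)"
    using assms(1) unfolding annihilator_def tangent_space_def by blast
  let ?U = "{-e<..<e} \<inter> \<gamma> -` ball p r"
  have op: "open ?U"
    using \<gamma>(1) by (intro continuous_open_preimage C1_differentiable_imp_continuous_on) auto
  have 0: "0 \<in> ?U" using e \<gamma>(3) assms(2) by simp
  have d: "((\<lambda>s. l (\<gamma> s)) has_vector_derivative l v) (at 0)"
    using \<gamma>(4) by (rule bounded_linear.has_vector_derivative[OF blinfun.bounded_linear_right])
  have z: "l (\<gamma> s) = 0" if "s \<in> ?U" for s
    using that \<gamma>(2) by (intro l0) auto
  have "((\<lambda>s. 0::real) has_vector_derivative l v) (at 0)"
    by (rule has_vector_derivative_transform_within_open[OF d op 0 z])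
  then have "l v = 0"
    by (rule vector_derivative_unique_at[OF _ has_vector_derivative_const])
  then show False using v by simp
qed

section \<open>A finite family of lines that is thin over an interval\<close>

text \<open>
  The value \<open>q = N\<close> is admitted, with digit \<open>N - 1\<close> and remainder 1: the greedy expansion below works with closed
  intervals of remainders.
\<close>

lemma digit_exists:
  fixes q :: real
  assumes "0 \<le> q" "q \<le> real N" "0 < N"
  shows "\<exists>m<N. 0 \<le> q - real m \<and> q - real m \<le> 1"
proof (cases "q = real N")
  case True
  then show ?thesis using assms by (intro exI[of _ "N - 1"]) auto
next
  case False
  define m where "m = nat \<lfloor>q\<rfloor>"
  have "real m \<le> q" "q < real m + 1" using assms by (simp_all add: m_def)
  then have "m < N" using False assms by linarith
  then show ?thesis using \<open>real m \<le> q\<close> \<open>q < real m + 1\<close> by (intro exI[of _ m]) auto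
qed

text \<open>
  The greedy choice of digits reaches every height because the weights increase: the remainder
  after \<open>n\<close> digits, at most \<open>k * w n / N ^ n\<close>, never exceeds what the next digit and its remainder can absorb.
\<close>

lemma greedy_digit_expansion:
  fixes w :: "nat \<Rightarrow> real"
  assumes w: "\<And>i. 0 < w i" "\<And>i. w i \<le> w (Suc i)" and N: "0 < N" and k: "0 < k"
    and u: "0 \<le> u" "u \<le> k * w 0"
  shows "\<exists>a. (\<forall>i<n. a i < N) \<and>
     0 \<le> u - k * (\<Sum>i<n. real (a i) * w i / real N ^ Suc i) \<and>
     u - k * (\<Sum>i<n. real (a i) * w i / real N ^ Suc i) \<le> k * w n / real N ^ n"
proof (induction n)
  case 0
  then show ?case using u by simp
next
  case (Suc n)
  then obtain a where a: "\<And>i. i < n \<Longrightarrow> a i < N"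
    and r: "0 \<le> u - k * (\<Sum>i<n. real (a i) * w i / real N ^ Suc i)" (is "0 \<le> ?r")
     "u - k * (\<Sum>i<n. real (a i) * w i / real N ^ Suc i) \<le> k * w n / real N ^ n"
    by blast
  define D where "D = k * w n / real N ^ Suc n"
  have D: "D > 0" using w k N by (simp add: D_def)
  have DN: "k * w n / real N ^ n = D * real N" using N by (simp add: D_def)
  obtain m where m: "m < N" "0 \<le> ?r / D - real m" "?r / D - real m \<le> 1"
    using digit_exists[of "?r / D" N] r D N DN by (auto simp: field_simps)
  have sum: "(\<Sum>i<n. real ((a(n := m)) i) * w i / real N ^ Suc i) = (\<Sum>i<n. real (a i) * w i / real N ^ Suc i)"
    by (intro sum.cong) auto
  have rem: "u - k * (\<Sum>i<Suc n. real ((a(n := m)) i) * w i / real N ^ Suc i) = D * (?r / D - real m)"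
  proof -
    have "D * (x / D - real m) = x - D * real m" for x using D by (simp add: field_simps)
    note this[of ?r]
    also have "D * real m = k * (real m * w n / real N ^ Suc n)" by (simp add: D_def)
    finally show ?thesis
      unfolding sum.lessThan_Suc sum by (simp add: distrib_left del: power_Suc)
  qed
  have "D * (?r / D - real m) \<le> D" using D m(3) by (simp add: mult_left_le)
  also have "D \<le> k * w (Suc n) / real N ^ Suc n"
    using w(2)[of n] k N unfolding D_def by (intro divide_right_mono mult_left_mono) auto
  finally show ?case
    using rem D m a by (intro exI[of _ "a(n := m)"]) (auto simp: less_Suc_eq)
qed

lemma digit_tail_bound:
  fixes a :: "nat \<Rightarrow> nat"
  assumes N: "0 < N" and a: "\<And>i. i \<in> {m..<n} \<Longrightarrow> a i < N" and mn: "m \<le> n"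
  shows "(\<Sum>i=m..<n. real (a i) / real N ^ Suc i) \<le> 1 / real N ^ m"
proof -
  have "(\<Sum>i=m..<n. real (a i) / real N ^ Suc i) \<le> (\<Sum>i=m..<n. 1 / real N ^ i - 1 / real N ^ Suc i)"
  proof (intro sum_mono)
    fix i assume "i \<in> {m..<n}"
    then have "real (a i) \<le> real N - 1" using a[of i] by simp
    then have "real (a i) / real N ^ Suc i \<le> (real N - 1) / real N ^ Suc i"
      by (intro divide_right_mono) auto
    also have "\<dots> = 1 / real N ^ i - 1 / real N ^ Suc i"
      using N by (simp add: diff_divide_distrib)
    finally show "real (a i) / real N ^ Suc i \<le> 1 / real N ^ i - 1 / real N ^ Suc i" .
  qed
  also have "\<dots> = 1 / real N ^ m - 1 / real N ^ n"
    using sum_Suc_diff'[OF mn, of "\<lambda>i. - (1 / real N ^ i)"] by simp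
  also have "\<dots> \<le> 1 / real N ^ m" by simp
  finally show ?thesis .
qed

text \<open>
  A line is given by its slope and its height at 0. The lines of the family \<open>P\<close> have digits \<open>a i < N\<close>, slope
  \<open>k * (\<Sum>i<N. a i / N ^ Suc i)\<close>, and height \<open>k * (\<Sum>i<N. a i * (x - c i) / N ^ Suc i)\<close> at \<open>x\<close>, where the centres \<open>c i\<close>
  descend from \<open>L\<close> in steps of \<open>2 * L / N\<close>.

  If \<open>\<bar>y\<bar> \<le> L\<close>, then \<open>y\<close> is within \<open>2 * L / N\<close> of some \<open>c m\<close>. At such \<open>y\<close> the digits from the \<open>m\<close>-th on change the height
  by \<open>O(1 / N ^ Suc m)\<close> only, since the \<open>m\<close>-th digit is multiplied by the small number \<open>y - c m\<close>. Hence the family is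
  contained in \<open>N ^ m\<close> parallelograms of width \<open>O(1 / N)\<close> and height \<open>O(1 / N ^ Suc m)\<close>, for each \<open>m < N\<close>, whose
  areas add up to \<open>O(1 / N)\<close>. The index set \<open>J\<close> consists of the pairs of \<open>m\<close> and the first \<open>m\<close> digits.

  To the right of \<open>L + w\<close> the weights \<open>x - c i\<close> are positive and increase with \<open>i\<close>, so the greedy expansion
  reaches every height in a fixed interval, up to \<open>\<delta>\<close>.
\<close>

lemma thin_line_family:
  fixes L k w M \<eta> :: real
  assumes L: "0 < L" and k: "0 < k" and w: "0 < w" and M: "0 < M" and \<eta>: "0 < \<eta>"
  shows "\<exists>(P :: (real \<times> real) set) \<delta> (J :: (nat \<times> (nat \<Rightarrow> nat)) set) c d1 \<tau> \<gamma> d2.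
     finite P \<and> 0 < \<delta> \<and> finite J \<and>
     (\<forall>s\<in>P. 0 \<le> fst s \<and> fst s \<le> k) \<and>
     (\<forall>x u. L + w \<le> x \<longrightarrow> x \<le> M \<longrightarrow> 0 \<le> u \<longrightarrow> u \<le> k * w \<longrightarrow>
        (\<exists>s\<in>P. \<bar>u - (fst s * x + snd s)\<bar> \<le> \<delta>)) \<and>
     (\<forall>j\<in>J. 0 < d1 j \<and> d1 j \<le> 1 \<and> 0 < d2 j \<and> d2 j \<le> 1 \<and> 0 \<le> \<tau> j \<and> \<tau> j \<le> k) \<and>
     (\<forall>y v. \<bar>y\<bar> \<le> L \<longrightarrow> (\<exists>s\<in>P. \<bar>v - (fst s * y + snd s)\<bar> \<le> 2 * \<delta>) \<longrightarrow>
        (\<exists>j\<in>J. \<bar>y - c j\<bar> \<le> d1 j \<and> \<bar>v - (\<tau> j * y + \<gamma> j)\<bar> \<le> d2 j)) \<and>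
     (\<Sum>j\<in>J. d1 j * d2 j) \<le> \<eta>"
proof -
  \<comment> \<open>\<open>2 * (M + L)\<close> comes from the thickness \<open>2 * \<delta>\<close>, and \<open>2 * L\<close> each from the digit \<open>m\<close> and from the later digits.\<close>
  define C where "C = k * (2 * (M + L) + 4 * L)"
  have C: "C > 0" using k L M by (simp add: C_def)
  define N where "N = nat \<lceil>2 * L * C / \<eta> + 2 * L + C\<rceil> + 1"
  have N0: "N > 0" by (simp add: N_def)
  have N: "2 * L * C / \<eta> \<le> real N" "2 * L \<le> real N" "C \<le> real N"
  proof -
    have "2 * L * C / \<eta> + 2 * L + C \<le> real N"
      unfolding N_def using real_nat_ceiling_ge[of "2 * L * C / \<eta> + 2 * L + C"] by linarith
    moreover have "0 \<le> 2 * L * C / \<eta>" using L C \<eta> by simp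
    ultimately show "2 * L * C / \<eta> \<le> real N" "2 * L \<le> real N" "C \<le> real N"
      using L C by linarith+
  qed
  define c where "c i = L - 2 * L * real i / real N" for i :: nat
  define D where "D n = {..<n} \<rightarrow>\<^sub>E {..<N}" for n :: nat
  define T where "T n a = k * (\<Sum>i<n. real (a i) / real N ^ Suc i)" for n and a :: "nat \<Rightarrow> nat"
  define G where "G n a = - (k * (\<Sum>i<n. real (a i) * c i / real N ^ Suc i))" for n and a :: "nat \<Rightarrow> nat"
  have TG: "T n a * y + G n a = k * (\<Sum>i<n. real (a i) * (y - c i) / real N ^ Suc i)" for n a y
  proof -
    have "(\<Sum>i<n. real (a i) * (y - c i) / real N ^ Suc i)
      = (\<Sum>i<n. real (a i) / real N ^ Suc i) * y - (\<Sum>i<n. real (a i) * c i / real N ^ Suc i)"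
      unfolding sum_distrib_right sum_subtractf[symmetric]
      by (intro sum.cong) (simp_all add: right_diff_distrib diff_divide_distrib)
    then show ?thesis
      by (simp add: T_def G_def right_diff_distrib del: power_Suc)
  qed
  have T: "0 \<le> T n a \<and> T n a \<le> k" if "a \<in> D n" for n a
  proof -
    have "(\<Sum>i=0..<n. real (a i) / real N ^ Suc i) \<le> 1 / real N ^ 0"
      using that N0 by (intro digit_tail_bound) (auto simp: D_def)
    then show ?thesis
      using k by (auto simp: T_def lessThan_atLeast0 intro!: mult_nonneg_nonneg sum_nonneg mult_left_le)
  qed
  define P where "P = (\<lambda>a. (T N a, G N a)) ` D N"
  \<comment> \<open>The remainder left by \<open>N\<close> greedy digits, as \<open>x - c N \<le> M + L\<close>.\<close>
  define \<delta> where "\<delta> = k * (M + L) / real N ^ N"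
  define J where "J = Sigma {..<N} D"
  define d1 where "d1 j = 2 * L / real N" for j :: "nat \<times> (nat \<Rightarrow> nat)"
  define d2 where "d2 j = C / real N ^ Suc (fst j)" for j :: "nat \<times> (nat \<Rightarrow> nat)"
  define \<tau> where "\<tau> j = T (fst j) (snd j)" for j :: "nat \<times> (nat \<Rightarrow> nat)"
  define \<gamma> where "\<gamma> j = G (fst j) (snd j)" for j :: "nat \<times> (nat \<Rightarrow> nat)"
  have finD: "finite (D n)" for n unfolding D_def by (intro finite_PiE) auto
  have f1: "finite P" unfolding P_def using finD by simp
  have f2: "0 < \<delta>" using k L M N0 by (simp add: \<delta>_def)
  have f3: "finite J" unfolding J_def using finD by simp
  have f4: "\<forall>s\<in>P. 0 \<le> fst s \<and> fst s \<le> k" using T by (auto simp: P_def)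
  have f5: "\<exists>s\<in>P. \<bar>u - (fst s * x + snd s)\<bar> \<le> \<delta>"
    if x: "L + w \<le> x" "x \<le> M" and u: "0 \<le> u" "u \<le> k * w" for x u
  proof -
    have c0: "c 0 = L" by (simp add: c_def)
    have cmono: "c (Suc i) \<le> c i" for i
      using L N0 by (simp add: c_def divide_right_mono)
    have cL: "c i \<le> L" for i using L N0 by (simp add: c_def)
    have cN: "c N = - L" using N0 by (simp add: c_def)
    have "\<exists>a. (\<forall>i<N. a i < N) \<and> 0 \<le> u - k * (\<Sum>i<N. real (a i) * (x - c i) / real N ^ Suc i) \<and>
     u - k * (\<Sum>i<N. real (a i) * (x - c i) / real N ^ Suc i) \<le> k * (x - c N) / real N ^ N"
    proof (rule greedy_digit_expansion)
      show "0 < x - c i" for i using cL[of i] x w by linarith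
      show "x - c i \<le> x - c (Suc i)" for i using cmono[of i] by simp
      have "k * w \<le> k * (x - c 0)" using k x c0 by (intro mult_left_mono) auto
      then show "u \<le> k * (x - c 0)" using u by linarith
    qed (use N0 k u in auto)
    then obtain a where a: "\<And>i. i < N \<Longrightarrow> a i < N"
      "0 \<le> u - k * (\<Sum>i<N. real (a i) * (x - c i) / real N ^ Suc i)"
      "u - k * (\<Sum>i<N. real (a i) * (x - c i) / real N ^ Suc i) \<le> k * (x - c N) / real N ^ N"
      by blast
    define a' where "a' = restrict a {..<N}"
    have a': "a' \<in> D N" using a(1) by (auto simp: a'_def D_def)
    have "T N a' * x + G N a' = k * (\<Sum>i<N. real (a i) * (x - c i) / real N ^ Suc i)"
      unfolding TG by (intro arg_cong[where f="(*) k"] sum.cong) (auto simp: a'_def)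
    moreover have "k * (x - c N) / real N ^ N \<le> \<delta>"
      unfolding \<delta>_def cN using k x by (intro divide_right_mono mult_left_mono) auto
    ultimately have "\<bar>u - (T N a' * x + G N a')\<bar> \<le> \<delta>" using a(2,3) by linarith
    then show ?thesis using a' by (auto simp: P_def)
  qed
  have f6: "\<forall>j\<in>J. 0 < d1 j \<and> d1 j \<le> 1 \<and> 0 < d2 j \<and> d2 j \<le> 1 \<and> 0 \<le> \<tau> j \<and> \<tau> j \<le> k"
  proof
    fix j assume j: "j \<in> J"
    then have "snd j \<in> D (fst j)" by (auto simp: J_def)
    then have "0 \<le> \<tau> j" "\<tau> j \<le> k" using T unfolding \<tau>_def by auto
    moreover have "C \<le> real N ^ Suc (fst j)"
    proof -
      have "real N ^ 1 \<le> real N ^ Suc (fst j)" using N0 by (intro power_increasing) auto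
      then show ?thesis using N(3) unfolding power_one_right by (rule order.trans[rotated])
    qed
    ultimately show "0 < d1 j \<and> d1 j \<le> 1 \<and> 0 < d2 j \<and> d2 j \<le> 1 \<and> 0 \<le> \<tau> j \<and> \<tau> j \<le> k"
      using L C N N0 by (simp add: d1_def d2_def)
  qed
  have f7: "\<exists>j\<in>J. \<bar>y - c (fst j)\<bar> \<le> d1 j \<and> \<bar>v - (\<tau> j * y + \<gamma> j)\<bar> \<le> d2 j"
    if y: "\<bar>y\<bar> \<le> L" and ex: "\<exists>s\<in>P. \<bar>v - (fst s * y + snd s)\<bar> \<le> 2 * \<delta>" for y v
  proof -
    obtain a where a: "a \<in> D N" "\<bar>v - (T N a * y + G N a)\<bar> \<le> 2 * \<delta>"
      using ex by (auto simp: P_def)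
    have aN: "a i < N" if "i < N" for i using a(1) that by (auto simp: D_def)
    define q where "q = (L - y) * real N / (2 * L)"
    have "0 \<le> q" using y L by (simp add: q_def abs_le_iff)
    moreover have "q \<le> real N"
    proof -
      have "(L - y) * real N \<le> (2 * L) * real N" using y by (intro mult_right_mono) auto
      then show ?thesis using L by (simp add: q_def pos_divide_le_eq mult.commute)
    qed
    ultimately obtain m where m: "m < N" "0 \<le> q - real m" "q - real m \<le> 1"
      using digit_exists N0 by blast
    have ycm: "y - c m = - (2 * L / real N * (q - real m))"
      using L N0 by (simp add: q_def c_def field_simps)
    have yc: "\<bar>y - c m\<bar> \<le> 2 * L / real N"
    proof -
      have "2 * L / real N * (q - real m) \<le> 2 * L / real N * 1"
        using m L by (intro mult_left_mono) auto
      moreover have "0 \<le> 2 * L / real N * (q - real m)" using m L by simp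
      ultimately show ?thesis unfolding ycm by linarith
    qed
    have yci: "\<bar>y - c i\<bar> \<le> 2 * L" if "i < N" for i
    proof -
      have "0 \<le> 2 * L * real i / real N" "2 * L * real i / real N \<le> 2 * L"
        using L N0 that by (simp_all add: field_simps)
      then show ?thesis using y unfolding c_def by linarith
    qed
    define a' where "a' = restrict a {..<m}"
    have a': "a' \<in> D m" unfolding a'_def D_def using aN m(1) by (intro PiE_I) (simp_all add: restrict_def)
    have pre: "T m a' * y + G m a' = k * (\<Sum>i<m. real (a i) * (y - c i) / real N ^ Suc i)"
      unfolding TG by (intro arg_cong[where f="(*) k"] sum.cong) (auto simp: a'_def)
    have split: "(\<Sum>i<N. real (a i) * (y - c i) / real N ^ Suc i)
       = (\<Sum>i<m. real (a i) * (y - c i) / real N ^ Suc i) + real (a m) * (y - c m) / real N ^ Suc m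
         + (\<Sum>i=Suc m..<N. real (a i) * (y - c i) / real N ^ Suc i)"
    proof -
      have "(\<Sum>i<N. real (a i) * (y - c i) / real N ^ Suc i)
        = (\<Sum>i<m. real (a i) * (y - c i) / real N ^ Suc i) + (\<Sum>i=m..<N. real (a i) * (y - c i) / real N ^ Suc i)"
        using m(1) sum.atLeastLessThan_concat[of 0 m N "\<lambda>i. real (a i) * (y - c i) / real N ^ Suc i"]
        by (simp add: lessThan_atLeast0)
      then show ?thesis using m(1) by (simp add: sum.atLeast_Suc_lessThan)
    qed
    have b1: "\<bar>real (a m) * (y - c m) / real N ^ Suc m\<bar> \<le> 2 * L / real N ^ Suc m"
    proof -
      have "\<bar>real (a m) * (y - c m)\<bar> \<le> real N * (2 * L / real N)"
        unfolding abs_mult using yc aN[OF m(1)] by (intro mult_mono) auto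
      also have "\<dots> = 2 * L" using N0 by simp
      finally have "\<bar>real (a m) * (y - c m)\<bar> \<le> 2 * L" .
      then show ?thesis by (simp add: divide_right_mono)
    qed
    have b2: "\<bar>\<Sum>i=Suc m..<N. real (a i) * (y - c i) / real N ^ Suc i\<bar> \<le> 2 * L / real N ^ Suc m"
    proof -
      have "\<bar>\<Sum>i=Suc m..<N. real (a i) * (y - c i) / real N ^ Suc i\<bar>
        \<le> (\<Sum>i=Suc m..<N. \<bar>real (a i) * (y - c i) / real N ^ Suc i\<bar>)" by (rule sum_abs)
      also have "\<dots> \<le> (\<Sum>i=Suc m..<N. 2 * L * (real (a i) / real N ^ Suc i))"
      proof (intro sum_mono)
        fix i assume "i \<in> {Suc m..<N}"
        then have "\<bar>y - c i\<bar> * (real (a i) / real N ^ Suc i) \<le> 2 * L * (real (a i) / real N ^ Suc i)"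
          using yci by (intro mult_right_mono) auto
        then show "\<bar>real (a i) * (y - c i) / real N ^ Suc i\<bar> \<le> 2 * L * (real (a i) / real N ^ Suc i)"
          by (simp add: abs_mult mult.commute)
      qed
      also have "\<dots> \<le> 2 * L * (1 / real N ^ Suc m)"
        unfolding sum_distrib_left[symmetric] using L N0 aN m(1)
        by (intro mult_left_mono digit_tail_bound) auto
      finally show ?thesis by simp
    qed
    have "v - (T m a' * y + G m a') = (v - (T N a * y + G N a))
        + k * (real (a m) * (y - c m) / real N ^ Suc m + (\<Sum>i=Suc m..<N. real (a i) * (y - c i) / real N ^ Suc i))"
      unfolding pre TG[of N a] split by (simp add: algebra_simps)
    also have "\<bar>\<dots>\<bar> \<le> 2 * \<delta> + k * (2 * L / real N ^ Suc m + 2 * L / real N ^ Suc m)"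
    proof -
      have "\<bar>k * (real (a m) * (y - c m) / real N ^ Suc m + (\<Sum>i=Suc m..<N. real (a i) * (y - c i) / real N ^ Suc i))\<bar>
        \<le> k * (2 * L / real N ^ Suc m + 2 * L / real N ^ Suc m)"
        unfolding abs_mult using k by (intro mult_mono order.trans[OF abs_triangle_ineq] add_mono b1 b2) auto
      then show ?thesis using a(2) by linarith
    qed
    also have "\<dots> \<le> 2 * (k * (M + L) / real N ^ Suc m) + k * (2 * L / real N ^ Suc m + 2 * L / real N ^ Suc m)"
    proof -
      have "real N ^ Suc m \<le> real N ^ N" using m(1) N0 by (intro power_increasing) auto
      then have "\<delta> \<le> k * (M + L) / real N ^ Suc m"
        unfolding \<delta>_def using k L M N0 by (intro divide_left_mono) auto
      then show ?thesis by simp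
    qed
    also have "\<dots> = C / real N ^ Suc m"
      by (simp add: C_def add_divide_distrib distrib_left algebra_simps)
    finally have "\<bar>v - (T m a' * y + G m a')\<bar> \<le> C / real N ^ Suc m" .
    then show ?thesis
      using yc a' m(1) by (intro bexI[of _ "(m, a')"]) (auto simp: d1_def d2_def \<tau>_def \<gamma>_def J_def)
  qed
  have f8: "(\<Sum>j\<in>J. d1 j * d2 j) \<le> \<eta>"
  proof -
    have "(\<Sum>j\<in>J. d1 j * d2 j) = (\<Sum>m<N. \<Sum>a\<in>D m. (2 * L / real N) * (C / real N ^ Suc m))"
      unfolding J_def d1_def d2_def by (subst sum.Sigma) (auto simp: finD split_beta)
    also have "\<dots> = (\<Sum>m<N. 2 * L * C / (real N * real N))"
    proof (intro sum.cong refl)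
      fix m
      have "card (D m) = N ^ m" by (simp add: D_def card_PiE)
      then show "(\<Sum>a\<in>D m. (2 * L / real N) * (C / real N ^ Suc m)) = 2 * L * C / (real N * real N)"
        using N0 by simp
    qed
    also have "\<dots> = 2 * L * C / real N" using N0 by simp
    also have "\<dots> \<le> \<eta>" using N(1) N0 \<eta> by (simp add: field_simps)
    finally show ?thesis .
  qed
  have f5': "\<forall>x u. L + w \<le> x \<longrightarrow> x \<le> M \<longrightarrow> 0 \<le> u \<longrightarrow> u \<le> k * w \<longrightarrow>
      (\<exists>s\<in>P. \<bar>u - (fst s * x + snd s)\<bar> \<le> \<delta>)"
    using f5 by blast
  have f7': "\<forall>y v. \<bar>y\<bar> \<le> L \<longrightarrow> (\<exists>s\<in>P. \<bar>v - (fst s * y + snd s)\<bar> \<le> 2 * \<delta>) \<longrightarrow>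
      (\<exists>j\<in>J. \<bar>y - c (fst j)\<bar> \<le> d1 j \<and> \<bar>v - (\<tau> j * y + \<gamma> j)\<bar> \<le> d2 j)"
    using f7 by blast
  show ?thesis
    by (rule exI[of _ P], rule exI[of _ \<delta>], rule exI[of _ J], rule exI[of _ "\<lambda>j. c (fst j)"],
        rule exI[of _ d1], rule exI[of _ \<tau>], rule exI[of _ \<gamma>], rule exI[of _ d2],
        rule conjI[OF f1 conjI[OF f2 conjI[OF f3 conjI[OF f4 conjI[OF f5' conjI[OF f6 conjI[OF f7' f8]]]]]]])
qed

section \<open>Testing the maximal inequality\<close>

lemma ennreal_powr_measurable [measurable]:
  assumes [measurable]: "h \<in> borel_measurable M"
  shows "(\<lambda>x. ennreal_powr (h x) q) \<in> borel_measurable M"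
  unfolding ennreal_powr_def by measurable

lemma ennreal_powr_ennreal: "0 \<le> x \<Longrightarrow> ennreal_powr (ennreal x) q = ennreal (x powr q)"
  by (simp add: ennreal_powr_def)

lemma ennreal_powr_mono:
  assumes "x \<le> y" "0 \<le> q"
  shows "ennreal_powr x q \<le> ennreal_powr y q"
proof (cases "y = \<infinity>")
  case False
  then have "x \<noteq> \<infinity>" using assms(1) by (auto simp: top_unique)
  moreover have "enn2real x \<le> enn2real y"
    using assms(1) False by (intro enn2real_mono) (auto simp: less_top)
  ultimately show ?thesis
    using False assms(2) by (auto simp: ennreal_powr_def intro!: ennreal_leI powr_mono2)
qed (simp add: ennreal_powr_def)

text \<open>
  If \<open>h > B\<close> then \<open>h = h powr (1 - q) * h powr q \<le> B powr (1 - q) * h powr q\<close>. Integrated over a set of finite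
  measure, this replaces Hoelder's inequality.
\<close>

lemma ennreal_young:
  assumes B: "0 < B" and q: "1 \<le> q"
  shows "h \<le> ennreal B + ennreal (B powr (1 - q)) * ennreal_powr h q"
proof (cases h)
  case (real x)
  have "x \<le> B + B powr (1 - q) * x powr q"
  proof (cases "x \<le> B")
    case True
    then show ?thesis by (simp add: add_increasing2)
  next
    case False
    then have x: "0 < x" using B by simp
    have "x = x powr (1 - q) * x powr q" using x by (simp add: powr_add[symmetric])
    also have "\<dots> \<le> B powr (1 - q) * x powr q"
      using False B q by (intro mult_right_mono powr_mono2') auto
    finally show ?thesis using B by simp
  qed
  then show ?thesis
    using real B by (simp add: ennreal_powr_ennreal ennreal_mult[symmetric] ennreal_plus[symmetric] ennreal_leI del: ennreal_plus)
next
  case top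
  then show ?thesis using B by (simp add: ennreal_powr_def ennreal_mult_top)
qed

text \<open>
  A lower bound for the mean of the maximal function over \<open>G\<close> contradicts boundedness once the norm of
  the test function is small in comparison. The minorant \<open>h\<close> is there because the maximal function,
  a supremum over uncountably many times, is not known to be measurable.
\<close>

lemma maximal_op_bounded_test:
  assumes bdd: "maximal_op_bounded br \<Lambda> \<sigma> chi I (ennreal q)" and q: "1 \<le> q"
    and G: "G \<in> sets lborel" "emeasure lborel G < \<infinity>"
  shows "\<exists>C\<ge>0. \<forall>F A m h. continuous_on UNIV F \<longrightarrow> compactly_supported F \<longrightarrow> (\<forall>z. 0 \<le> F z) \<longrightarrow>
    0 \<le> A \<longrightarrow> 0 \<le> m \<longrightarrow> (\<integral>\<^sup>+z. ennreal (F z powr q) \<partial>lborel) \<le> ennreal A \<longrightarrow>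
    h \<in> borel_measurable lborel \<longrightarrow>
    (\<forall>x\<in>G. h x \<le> maximal_op br \<Lambda> \<sigma> chi I (\<lambda>z. complex_of_real (F z)) x) \<longrightarrow>
    ennreal m \<le> (\<integral>\<^sup>+x\<in>G. h x \<partial>lborel) \<longrightarrow> m powr q \<le> C * A"
proof -
  obtain C where C: "0 \<le> C" "\<And>f. continuous_on UNIV f \<Longrightarrow> compactly_supported f \<Longrightarrow>
      Lp_norm (ennreal q) lborel (maximal_op br \<Lambda> \<sigma> chi I f)
        \<le> ennreal C * Lp_norm (ennreal q) lborel (\<lambda>x. ennreal (norm (f x)))"
    using bdd unfolding maximal_op_bounded_def by blast
  define g where "g = measure lborel G"
  have g: "0 \<le> g" "emeasure lborel G = ennreal g"
    using G by (auto simp: g_def emeasure_eq_ennreal_measure less_top)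
  \<comment> \<open>This is the constant which the choice \<open>B = m / (2 * (g + 1))\<close> in Young's inequality produces: it makes the
    term \<open>B * g\<close> at most \<open>m / 2\<close>. The summand 1 covers the case of a null set \<open>G\<close>.\<close>
  define K where "K = (2 * (g + 1)) powr (q - 1) * 2 * C powr q"
  have "m powr q \<le> K * A"
    if F: "continuous_on UNIV F" "compactly_supported F" "\<And>z. 0 \<le> F z"
      and A: "0 \<le> A" and m: "0 \<le> m" and FA: "(\<integral>\<^sup>+z. ennreal (F z powr q) \<partial>lborel) \<le> ennreal A"
      and h: "h \<in> borel_measurable lborel"
      and hM: "\<And>x. x \<in> G \<Longrightarrow> h x \<le> maximal_op br \<Lambda> \<sigma> chi I (\<lambda>z. complex_of_real (F z)) x"
      and mh: "ennreal m \<le> (\<integral>\<^sup>+x\<in>G. h x \<partial>lborel)" for F A m h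
  proof (cases "m = 0")
    case True
    then show ?thesis using A C by (simp add: K_def)
  next
    case False
    then have m: "0 < m" using m by simp
    let ?f = "\<lambda>z. complex_of_real (F z)"
    let ?M = "maximal_op br \<Lambda> \<sigma> chi I ?f"
    let ?S = "\<integral>\<^sup>+x. ennreal_powr (?M x) q \<partial>lborel"
    have "continuous_on UNIV ?f" using F(1) by (intro continuous_intros)
    moreover have "compactly_supported ?f" using F(2) by (simp add: compactly_supported_def)
    ultimately have "ennreal_powr ?S (1 / q)
       \<le> ennreal C * ennreal_powr (\<integral>\<^sup>+x. ennreal_powr (ennreal (norm (?f x))) q \<partial>lborel) (1 / q)"
      using C(2)[of ?f] q by (simp add: Lp_norm_def)
    also have "(\<integral>\<^sup>+x. ennreal_powr (ennreal (norm (?f x))) q \<partial>lborel) = (\<integral>\<^sup>+z. ennreal (F z powr q) \<partial>lborel)"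
      using F(3) by (simp add: ennreal_powr_ennreal)
    also have "ennreal C * ennreal_powr \<dots> (1 / q) \<le> ennreal C * ennreal_powr (ennreal A) (1 / q)"
      using q by (intro mult_left_mono ennreal_powr_mono FA) auto
    also have "\<dots> = ennreal (C * A powr (1 / q))"
      using A C(1) by (simp add: ennreal_powr_ennreal ennreal_mult)
    finally have S1: "ennreal_powr ?S (1 / q) \<le> ennreal (C * A powr (1 / q))" .
    then have Sfin: "?S \<noteq> \<infinity>" by (auto simp: ennreal_powr_def top_unique)
    then obtain s where s: "0 \<le> s" "?S = ennreal s" by (cases ?S) auto
    have "s powr (1 / q) \<le> C * A powr (1 / q)"
      using S1 s A C(1) by (simp add: ennreal_powr_ennreal)
    then have "(s powr (1 / q)) powr q \<le> (C * A powr (1 / q)) powr q"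
      using q by (intro powr_mono2) auto
    then have sA: "s \<le> C powr q * A"
      using s A C(1) q by (simp add: powr_powr powr_mult)
    define B where "B = m / (2 * (g + 1))"
    have B: "0 < B" using m g by (simp add: B_def)
    have "ennreal m \<le> (\<integral>\<^sup>+x\<in>G. h x \<partial>lborel)" by (rule mh)
    also have "\<dots> \<le> (\<integral>\<^sup>+x. ennreal B * indicator G x + ennreal (B powr (1 - q)) * (ennreal_powr (h x) q * indicator G x) \<partial>lborel)"
      by (intro nn_integral_mono) (use ennreal_young[OF B q] in \<open>auto simp: indicator_def\<close>)
    also have "\<dots> = ennreal B * ennreal g + ennreal (B powr (1 - q)) * (\<integral>\<^sup>+x. ennreal_powr (h x) q * indicator G x \<partial>lborel)"
      using G h g by (subst nn_integral_add) (auto simp: nn_integral_cmult nn_integral_cmult_indicator)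
    also have "\<dots> \<le> ennreal B * ennreal g + ennreal (B powr (1 - q)) * ?S"
      using hM q by (intro add_left_mono mult_left_mono nn_integral_mono) (auto simp: indicator_def intro!: ennreal_powr_mono)
    also have "\<dots> = ennreal (B * g + B powr (1 - q) * s)"
      using B g s by (simp add: ennreal_mult)
    finally have "m \<le> B * g + B powr (1 - q) * s"
      using B g s m by (subst (asm) ennreal_le_iff) auto
    moreover have "B * g \<le> m / 2"
      using m g by (simp add: B_def field_simps)
    ultimately have "m / 2 \<le> B powr (1 - q) * s" by linarith
    also have "\<dots> \<le> B powr (1 - q) * (C powr q * A)"
      using sA by (intro mult_left_mono) auto
    finally have "m / 2 * B powr (q - 1) \<le> B powr (1 - q) * (C powr q * A) * B powr (q - 1)"
      by (intro mult_right_mono) auto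
    also have "\<dots> = C powr q * A"
      using B powr_add[of B "1 - q" "q - 1"] by simp
    also have "m / 2 * B powr (q - 1) = m powr q / 2 / (2 * (g + 1)) powr (q - 1)"
      using m g powr_add[of m 1 "q - 1"] by (simp add: B_def powr_divide)
    finally have "m powr q / ((2 * (g + 1)) powr (q - 1) * 2) \<le> C powr q * A"
      by (simp add: mult.commute)
    then show ?thesis
      using g by (simp add: K_def pos_divide_le_eq mult_ac)
  qed
  then show ?thesis
    using g by (intro exI[of _ K]) (auto simp: K_def)
qed

text \<open>
  On a set \<open>A\<close> of finite surface measure the integrand is bounded, hence integrable. Without such a set the
  Bochner integral could be 0 for lack of integrability.
\<close>

lemma conv_mu_nn_integral:
  fixes F :: "'a::euclidean_space \<times> 'b::euclidean_space \<Rightarrow> real" and \<Lambda> :: "'a \<Rightarrow>\<^sub>L 'b"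
  assumes br: "two_step_bracket br"
    and \<sigma>: "sets \<sigma> = sets (restrict_space borel S)" "space \<sigma> = S"
    and A: "A \<in> sets \<sigma>" "emeasure \<sigma> A < \<infinity>"
    and chi: "continuous_on UNIV chi" "\<And>w. 0 \<le> chi w" "\<And>w. chi w \<le> K"
    and F: "continuous_on UNIV F" "\<And>z. 0 \<le> F z" "\<And>z. F z \<le> M"
    and loc: "\<And>w. w \<in> S \<Longrightarrow> w \<notin> A \<Longrightarrow>
       F (X - t *\<^sub>R w, U - (t/2) *\<^sub>R layer_bracket br X w - t\<^sup>2 *\<^sub>R \<Lambda> w) = 0"
  shows "ennreal (norm (conv_mu br \<Lambda> \<sigma> chi t (\<lambda>z. complex_of_real (F z)) (X, U)))
    = (\<integral>\<^sup>+w\<in>A. ennreal (chi w * F (X - t *\<^sub>R w, U - (t/2) *\<^sub>R layer_bracket br X w - t\<^sup>2 *\<^sub>R \<Lambda> w)) \<partial>\<sigma>)"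
proof -
  let ?g = "\<lambda>w. chi w * F (X - t *\<^sub>R w, U - (t/2) *\<^sub>R layer_bracket br X w - t\<^sup>2 *\<^sub>R \<Lambda> w)"
  have "bounded_linear (layer_bracket br X)"
    using layer_bracket_bilinear[OF br] by (simp add: bilinear_def linear_conv_bounded_linear)
  then have cont: "continuous_on UNIV (layer_bracket br X)"
    by (simp add: linear_continuous_on)
  have "continuous_on UNIV ?g"
    by (intro continuous_intros chi(1) continuous_on_compose2[OF F(1)] cont) auto
  then have "?g \<in> borel_measurable borel" by (rule borel_measurable_continuous_onI)
  then have meas: "?g \<in> borel_measurable \<sigma>"
    using measurable_restrict_space1 measurable_cong_sets[OF \<sigma>(1) refl] by blast
  have g0: "0 \<le> ?g w" for w using chi F by simp
  have gb: "?g w \<le> K * M" for w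
    using chi F order.trans[OF chi(2) chi(3)] by (intro mult_mono) auto
  have "integrable \<sigma> ?g"
  proof (rule integrableI_bounded_set[OF A(1) meas A(2)])
    show "AE w in \<sigma>. w \<in> A \<longrightarrow> norm (?g w) \<le> K * M"
      using g0 gb by (simp add: abs_of_nonneg)
    show "AE w in \<sigma>. w \<notin> A \<longrightarrow> ?g w = 0"
      using loc \<sigma>(2) by (intro AE_I2) simp
  qed
  then have "(\<integral>\<^sup>+w. ennreal (?g w) \<partial>\<sigma>) = ennreal (\<integral>w. ?g w \<partial>\<sigma>)"
    using g0 by (intro nn_integral_eq_integral) auto
  moreover have "conv_mu br \<Lambda> \<sigma> chi t (\<lambda>z. complex_of_real (F z)) (X, U) = complex_of_real (\<integral>w. ?g w \<partial>\<sigma>)"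
    unfolding conv_mu_explicit[OF br] integral_complex_of_real[symmetric]
    by (intro Bochner_Integration.integral_cong) (simp_all add: scaleR_conv_of_real)
  moreover have "0 \<le> (\<integral>w. ?g w \<partial>\<sigma>)" using g0 by (intro integral_nonneg_AE) auto
  moreover have "(\<integral>\<^sup>+w. ennreal (?g w) \<partial>\<sigma>) = (\<integral>\<^sup>+w\<in>A. ennreal (?g w) \<partial>\<sigma>)"
    using loc \<sigma>(2) by (intro nn_integral_cong) (auto simp: indicator_def)
  ultimately show ?thesis by simp
qed

lemma maximal_op_lower:
  "t \<in> I \<Longrightarrow> ennreal (norm (conv_mu br \<Lambda> \<sigma> chi t f x)) \<le> maximal_op br \<Lambda> \<sigma> chi I f x"
  unfolding maximal_op_def by (rule SUP_upper)

section \<open>Coordinates on the space of functionals\<close>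

lemma V_space_subspace:
  assumes br: "two_step_bracket br"
  shows "subspace (V_space br \<Lambda> \<theta>)"
proof (rule subspaceI)
  note bil = layer_bracket_bilinear[OF br]
  have J: "J_map br \<theta> (X + Y) = J_map br \<theta> X + J_map br \<theta> Y"
    "J_map br \<theta> (c *\<^sub>R X) = c *\<^sub>R J_map br \<theta> X" for X Y c
    by (rule blinfun_eqI, simp add: J_map_apply[OF br] bilinear_ladd[OF bil] bilinear_lmul[OF bil]
        plus_blinfun.rep_eq scaleR_blinfun.rep_eq blinfun.add_right blinfun.scaleR_right distrib_left)+
  show "0 \<in> V_space br \<Lambda> \<theta>"
    using J(2)[of 0 0] by (auto simp: V_space_def intro!: exI[of _ "J_map br \<theta> 0"] exI[of _ 0])
  show "x + y \<in> V_space br \<Lambda> \<theta>" if xy: "x \<in> V_space br \<Lambda> \<theta>" "y \<in> V_space br \<Lambda> \<theta>" for x y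
  proof -
    obtain X c Y d where "x = J_map br \<theta> X + c *\<^sub>R (\<theta> o\<^sub>L \<Lambda>)" "y = J_map br \<theta> Y + d *\<^sub>R (\<theta> o\<^sub>L \<Lambda>)"
      using xy by (auto simp: V_space_def)
    then have "x + y = J_map br \<theta> (X + Y) + (c + d) *\<^sub>R (\<theta> o\<^sub>L \<Lambda>)"
      by (simp add: J scaleR_add_left)
    then show ?thesis by (auto simp: V_space_def)
  qed
  show "s *\<^sub>R x \<in> V_space br \<Lambda> \<theta>" if x: "x \<in> V_space br \<Lambda> \<theta>" for s x
  proof -
    obtain X c where "x = J_map br \<theta> X + c *\<^sub>R (\<theta> o\<^sub>L \<Lambda>)"
      using x by (auto simp: V_space_def)
    then have "s *\<^sub>R x = J_map br \<theta> (s *\<^sub>R X) + (s * c) *\<^sub>R (\<theta> o\<^sub>L \<Lambda>)"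
      by (simp add: J scaleR_add_right)
    then show ?thesis by (auto simp: V_space_def)
  qed
qed

lemma V_space_member:
  "J_map br \<theta> X + c *\<^sub>R (\<theta> o\<^sub>L \<Lambda>) \<in> V_space br \<Lambda> \<theta>"
  by (auto simp: V_space_def)

text \<open>
  A basis \<open>B\<close> of \<open>V\<close> together with dual vectors, which make the coordinates of \<open>v\<close> explicit.
\<close>

lemma functional_coordinates:
  fixes V :: "('a::real_normed_vector \<Rightarrow>\<^sub>L real) set"
  assumes V: "subspace V" "dim V = r" "0 < r"
  shows "\<exists>B E. finite B \<and> card B = r \<and>
     (\<forall>l\<in>B. \<forall>m\<in>B. blinfun_apply l (E m) = (if l = m then 1 else 0)) \<and>
     (\<forall>v\<in>V. \<forall>z. blinfun_apply v z = (\<Sum>l\<in>B. blinfun_apply v (E l) * blinfun_apply l z))"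
proof -
  obtain B where B: "B \<subseteq> V" "independent B" "V \<subseteq> span B" "card B = dim V"
    using real_vector.basis_exists[of V] by metis
  have fin: "finite B" using B V by (metis card.infinite less_irrefl)
  have apply_sum: "blinfun_apply (\<Sum>l\<in>B. c l *\<^sub>R l) z = (\<Sum>l\<in>B. c l * blinfun_apply l z)" for c z
    by (simp add: blinfun.sum_left scaleR_blinfun.rep_eq)
  have "\<exists>E. \<forall>l\<in>B. \<forall>m\<in>B. blinfun_apply l (E m) = (if l = m then 1 else 0)"
  proof (rule dual_vectors_exist[OF fin])
    show "linear (blinfun_apply l)" for l :: "'a \<Rightarrow>\<^sub>L real"
      by (intro bounded_linear.linear blinfun.bounded_linear_right)
    fix c assume "\<And>z. (\<Sum>l\<in>B. c l * blinfun_apply l z) = 0"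
    then have "(\<Sum>l\<in>B. c l *\<^sub>R l) = 0"
      by (intro blinfun_eqI) (simp add: apply_sum)
    then show "\<forall>l\<in>B. c l = 0"
      using independentD[OF B(2) fin subset_refl] by blast
  qed
  then obtain E where E: "\<And>l m. l \<in> B \<Longrightarrow> m \<in> B \<Longrightarrow> blinfun_apply l (E m) = (if l = m then 1 else 0)"
    by blast
  have "blinfun_apply v z = (\<Sum>l\<in>B. blinfun_apply v (E l) * blinfun_apply l z)" if "v \<in> V" for v z
  proof -
    have "v \<in> range (\<lambda>c. \<Sum>l\<in>B. c l *\<^sub>R l)"
      using that B(3) span_finite[OF fin] by blast
    then obtain c where c: "v = (\<Sum>l\<in>B. c l *\<^sub>R l)" by blast
    have "blinfun_apply v (E m) = c m" if "m \<in> B" for m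
    proof -
      have "blinfun_apply v (E m) = (\<Sum>l\<in>B. if l = m then c l else 0)"
        unfolding c apply_sum using that E by (intro sum.cong) auto
      then show ?thesis using that fin by simp
    qed
    then show ?thesis unfolding c apply_sum by (intro sum.cong) (auto simp: c[symmetric] apply_sum)
  qed
  then show ?thesis using fin B V E by blast
qed

section \<open>Transport along the group\<close>

text \<open>
  The term \<open>J_map br \<theta> X X\<close> vanishes by antisymmetry, so \<open>- t * J_map br \<theta> X w\<close> is the value of \<open>J_map br \<theta> X\<close> at
  \<open>X - t w\<close>; similarly for \<open>\<theta> \<circ> \<Lambda>\<close>, up to the term \<open>t * \<theta> (\<Lambda> X)\<close>.
\<close>

lemma second_layer_identity:
  fixes \<theta> :: "'b::euclidean_space \<Rightarrow>\<^sub>L real" and \<Lambda> :: "'a::euclidean_space \<Rightarrow>\<^sub>L 'b"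
  assumes br: "two_step_bracket br"
  shows "\<theta> (U - (t/2) *\<^sub>R layer_bracket br X w - t\<^sup>2 *\<^sub>R \<Lambda> w)
    = \<theta> U - t * \<theta> (\<Lambda> X) + (J_map br \<theta> X + t *\<^sub>R (\<theta> o\<^sub>L \<Lambda>)) (X - t *\<^sub>R w)"
proof -
  note bil = layer_bracket_bilinear[OF br]
  show ?thesis
    by (simp add: plus_blinfun.rep_eq scaleR_blinfun.rep_eq blinfun.diff_right blinfun.scaleR_right
        blinfun.add_right blinfun.minus_right
        J_map_apply[OF br] bilinear_rsub[OF bil] bilinear_rmul[OF bil] layer_bracket_self[OF br]
        algebra_simps power2_eq_square)
qed

lemma second_layer_bound:
  fixes br :: "'a::euclidean_space \<times> 'b::euclidean_space \<Rightarrow> 'a \<times> 'b \<Rightarrow> 'a \<times> 'b" and \<Lambda> :: "'a \<Rightarrow>\<^sub>L 'b"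
  assumes br: "two_step_bracket br"
  shows "\<exists>R>0. \<forall>X U w t. norm X \<le> \<rho> \<longrightarrow> norm U \<le> \<rho> \<longrightarrow> norm w \<le> \<rho> \<longrightarrow> 0 \<le> t \<longrightarrow> t \<le> b \<longrightarrow>
     norm (U - (t/2) *\<^sub>R layer_bracket br X w - t\<^sup>2 *\<^sub>R \<Lambda> w) \<le> R"
proof -
  obtain K where K: "0 < K" "\<And>X Y. norm (layer_bracket br X Y) \<le> K * norm X * norm Y"
    using bilinear_bounded_pos[OF layer_bracket_bilinear[OF br]] by blast
  let ?R = "\<bar>\<rho>\<bar> + \<bar>b\<bar> * (K * \<bar>\<rho>\<bar> * \<bar>\<rho>\<bar>) + b\<^sup>2 * (norm \<Lambda> * \<bar>\<rho>\<bar>) + 1"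
  have "norm (U - (t/2) *\<^sub>R layer_bracket br X w - t\<^sup>2 *\<^sub>R \<Lambda> w) \<le> ?R"
    if h: "norm X \<le> \<rho>" "norm U \<le> \<rho>" "norm w \<le> \<rho>" "0 \<le> t" "t \<le> b" for X U w t
  proof -
    have "norm (layer_bracket br X w) \<le> K * \<bar>\<rho>\<bar> * \<bar>\<rho>\<bar>"
      using h K(1) by (intro order.trans[OF K(2)] mult_mono) (auto intro: order.trans[OF norm_ge_zero])
    then have 1: "norm ((t/2) *\<^sub>R layer_bracket br X w) \<le> \<bar>b\<bar> * (K * \<bar>\<rho>\<bar> * \<bar>\<rho>\<bar>)"
      unfolding norm_scaleR using h by (intro mult_mono) auto
    have "norm (\<Lambda> w) \<le> norm \<Lambda> * \<bar>\<rho>\<bar>"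
      using h(3) by (intro order.trans[OF norm_blinfun] mult_left_mono) auto
    then have 2: "norm (t\<^sup>2 *\<^sub>R \<Lambda> w) \<le> b\<^sup>2 * (norm \<Lambda> * \<bar>\<rho>\<bar>)"
      unfolding norm_scaleR using h by (intro mult_mono) (auto intro: power_mono)
    show ?thesis
      using h(2) 1 2 norm_triangle_ineq4[of "U - (t/2) *\<^sub>R layer_bracket br X w" "t\<^sup>2 *\<^sub>R \<Lambda> w"]
        norm_triangle_ineq4[of U "(t/2) *\<^sub>R layer_bracket br X w"] by linarith
  qed
  moreover have "0 < ?R" using K by (intro add_nonneg_pos add_nonneg_nonneg mult_nonneg_nonneg) auto
  ultimately show ?thesis by (intro exI[of _ ?R]) blast
qed

section \<open>Cutoff functions and localization\<close>

definition bump :: "real \<Rightarrow> real" where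
  "bump s = max 0 (min 1 (2 - s))"

lemma bump_simps: "0 \<le> bump s" "bump s \<le> 1" "s \<le> 1 \<Longrightarrow> bump s = 1" "2 \<le> s \<Longrightarrow> bump s = 0"
  by (auto simp: bump_def)

lemma continuous_on_bump [continuous_intros]:
  "continuous_on S f \<Longrightarrow> continuous_on S (\<lambda>x. bump (f x))"
  unfolding bump_def by (intro continuous_intros)

definition cutoff :: "real \<Rightarrow> real \<Rightarrow> 'a::real_normed_vector \<times> 'b::real_normed_vector \<Rightarrow> real" where
  "cutoff \<epsilon> R z = bump (norm (fst z) / (2 * \<epsilon>)) * bump (norm (snd z) / R)"

lemma cutoff_range: "0 \<le> cutoff \<epsilon> R z" "cutoff \<epsilon> R z \<le> 1"
  by (auto simp: cutoff_def bump_simps intro!: mult_le_one)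

lemma cutoff_one: "0 < \<epsilon> \<Longrightarrow> 0 < R \<Longrightarrow> norm Y \<le> 2 * \<epsilon> \<Longrightarrow> norm W \<le> R \<Longrightarrow> cutoff \<epsilon> R (Y, W) = 1"
  by (simp add: cutoff_def bump_simps)

lemma cutoff_support:
  assumes "cutoff \<epsilon> R z \<noteq> 0" "0 < \<epsilon>" "0 < R"
  shows "norm (fst z) < 4 * \<epsilon>" "norm z \<le> 4 * \<epsilon> + 2 * R"
proof -
  have "norm (fst z) / (2 * \<epsilon>) < 2" "norm (snd z) / R < 2"
    using assms(1) bump_simps(4) unfolding cutoff_def by (metis mult_zero_left mult_zero_right linorder_not_le)+
  then have *: "norm (fst z) < 4 * \<epsilon>" "norm (snd z) < 2 * R"
    using assms by (simp_all add: field_simps)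
  show "norm (fst z) < 4 * \<epsilon>" by (rule *)
  show "norm z \<le> 4 * \<epsilon> + 2 * R"
    using * norm_Pair_le[of "fst z" "snd z"] by simp
qed

lemma continuous_on_cutoff: "0 < \<epsilon> \<Longrightarrow> 0 < R \<Longrightarrow> continuous_on S (cutoff \<epsilon> R)"
  unfolding cutoff_def by (intro continuous_intros) auto

lemma compactly_supported_cutoff:
  fixes g :: "'a::euclidean_space \<times> 'b::euclidean_space \<Rightarrow> real"
  assumes "0 < \<epsilon>" "0 < R"
  shows "compactly_supported (\<lambda>z. cutoff \<epsilon> R z * g z)"
proof -
  have "{z. cutoff \<epsilon> R z * g z \<noteq> 0} \<subseteq> cball 0 (4 * \<epsilon> + 2 * R)"
    using cutoff_support(2)[OF _ assms] by (auto simp del: split_paired_All simp: mem_cball_0)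
  then have "bounded {z. cutoff \<epsilon> R z * g z \<noteq> 0}"
    using bounded_cball bounded_subset by blast
  then show ?thesis
    by (simp add: compactly_supported_def compact_closure)
qed

text \<open>
  If \<open>X\<close> is close to \<open>t w1\<close>, then \<open>X - t w\<close> is small exactly when \<open>w\<close> is close to \<open>w1\<close>. A cutoff in the first layer
  therefore localizes the surface point.
\<close>

lemma localization:
  fixes X w1 w :: "'a::real_normed_vector"
  assumes a: "0 < a" "a \<le> t" "t \<le> b" and \<epsilon>: "0 < \<epsilon>" and X: "norm (X - t *\<^sub>R w1) \<le> \<epsilon>"
  shows "norm (X - t *\<^sub>R w) < 4 * \<epsilon> \<Longrightarrow> w \<in> ball w1 (6 * \<epsilon> / a)"
    and "w \<in> ball w1 (\<epsilon> / b) \<Longrightarrow> norm (X - t *\<^sub>R w) \<le> 2 * \<epsilon>"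
proof -
  have eq: "t *\<^sub>R (w - w1) = (X - t *\<^sub>R w1) - (X - t *\<^sub>R w)" by (simp add: algebra_simps)
  have n: "t * norm (w - w1) = norm (t *\<^sub>R (w - w1))" using a by simp
  show "w \<in> ball w1 (6 * \<epsilon> / a)" if "norm (X - t *\<^sub>R w) < 4 * \<epsilon>"
  proof -
    have "t * norm (w - w1) < 6 * \<epsilon>"
      using n norm_triangle_ineq4[of "X - t *\<^sub>R w1" "X - t *\<^sub>R w"] that X \<epsilon> unfolding eq by linarith
    moreover have "a * norm (w - w1) \<le> t * norm (w - w1)" using a by (intro mult_right_mono) auto
    ultimately have "norm (w - w1) < 6 * \<epsilon> / a" using a by (simp add: field_simps)
    then show ?thesis by (simp add: dist_norm norm_minus_commute)
  qed
  show "norm (X - t *\<^sub>R w) \<le> 2 * \<epsilon>" if "w \<in> ball w1 (\<epsilon> / b)"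
  proof -
    have "norm (w - w1) \<le> \<epsilon> / b" using that by (simp add: dist_norm norm_minus_commute)
    then have "t * norm (w - w1) \<le> b * (\<epsilon> / b)" using a by (intro mult_mono) auto
    then have "norm (t *\<^sub>R (w - w1)) \<le> \<epsilon>" unfolding n[symmetric] using a by simp
    moreover have eq2: "X - t *\<^sub>R w = (X - t *\<^sub>R w1) - t *\<^sub>R (w - w1)" by (simp add: algebra_simps)
    have "norm (X - t *\<^sub>R w) \<le> norm (X - t *\<^sub>R w1) + norm (t *\<^sub>R (w - w1))"
      unfolding eq2 by (rule norm_triangle_ineq4)
    ultimately show ?thesis using X by linarith
  qed
qed

section \<open>The choice of time\<close>

lemma dist_Pair_le: "dist (x, y) (x', y') \<le> dist x x' + dist y y'"
  by (simp add: dist_Pair_Pair sqrt_sum_squares_le_sum)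

lemma isCont_eventually_ball:
  fixes f :: "'x::metric_space \<Rightarrow> 'y::topological_space"
  assumes "isCont f x" "open T" "f x \<in> T"
  shows "eventually (\<lambda>z. f z \<in> T) (nhds x)"
  using assms topological_tendstoD[of f "f x" "nhds x" T]
  by (simp add: isCont_def tendsto_at_iff_tendsto_nhds)

lemma J_map_zero: "two_step_bracket br \<Longrightarrow> J_map br \<theta> 0 = 0"
  by (rule blinfun_eqI)
    (simp add: J_map_apply bilinear_lzero[OF layer_bracket_bilinear] blinfun.zero_left)

text \<open>
  The point \<open>(X, U)\<close> is given the time \<open>t = \<theta> U / \<theta> (\<Lambda> X)\<close>. For fixed \<open>w\<close> and \<open>U\<close> the right first component is \<open>X = \<tau> w\<close>
  with \<open>\<tau>\<^sup>2 * \<theta> (\<Lambda> w) = \<theta> U\<close>, for then \<open>t = \<tau>\<close> and \<open>X - t w = 0\<close>. If instead \<open>X = \<tau> w + v\<close> and the basis functionals are at most \<open>\<delta>\<close> at \<open>v\<close>,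
  then \<open>t - \<tau>\<close>, the basis functionals at \<open>X - t w\<close> and, by the identity above, the second layer are all \<open>O(\<delta>)\<close>.
\<close>

lemma transport_geometry:
  fixes br :: "'a::euclidean_space \<times> 'b::euclidean_space \<Rightarrow> 'a \<times> 'b \<Rightarrow> 'a \<times> 'b"
    and \<Lambda> :: "'a \<Rightarrow>\<^sub>L 'b" and \<theta> :: "'b \<Rightarrow>\<^sub>L real" and B :: "('a \<Rightarrow>\<^sub>L real) set"
  assumes br: "two_step_bracket br" and ab: "0 < a" "a < b" and s: "\<theta> (\<Lambda> w1) \<noteq> 0"
    and B: "finite B"
    and coordinates: "\<forall>v\<in>V_space br \<Lambda> \<theta>. \<forall>z. blinfun_apply v z = (\<Sum>l\<in>B. blinfun_apply v (E l) * blinfun_apply l z)"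
    and \<epsilon>: "0 < \<epsilon>"
  shows "\<exists>X1 U1 d \<rho> C0. 0 < d \<and> 0 < \<rho> \<and> \<rho> \<le> d \<and> 1 \<le> C0 \<and>
    (\<forall>X\<in>ball X1 d. \<forall>U\<in>ball U1 d. a \<le> \<theta> U / \<theta> (\<Lambda> X) \<and> \<theta> U / \<theta> (\<Lambda> X) \<le> b \<and>
       norm (X - (\<theta> U / \<theta> (\<Lambda> X)) *\<^sub>R w1) \<le> \<epsilon>) \<and>
    (\<forall>w\<in>ball w1 \<rho>. \<forall>U\<in>ball U1 \<rho>. \<exists>\<tau>. \<forall>v \<delta>. norm v \<le> \<rho> \<longrightarrow> 0 \<le> \<delta> \<longrightarrow> (\<forall>l\<in>B. \<bar>blinfun_apply l v\<bar> \<le> \<delta>) \<longrightarrow>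
       (\<forall>X t. X = \<tau> *\<^sub>R w + v \<longrightarrow> t = \<theta> U / \<theta> (\<Lambda> X) \<longrightarrow> X \<in> ball X1 d \<and>
         (\<Sum>l\<in>B. \<bar>blinfun_apply l (X - t *\<^sub>R w)\<bar>)
           + \<bar>\<theta> (U - (t/2) *\<^sub>R layer_bracket br X w - t\<^sup>2 *\<^sub>R \<Lambda> w)\<bar> \<le> C0 * \<delta>))"
proof -
  note coord = coordinates[rule_format]
  define lam where "lam = \<theta> o\<^sub>L \<Lambda>"
  have lam: "\<theta> (\<Lambda> X) = lam X" for X by (simp add: lam_def)
  define t0 where "t0 = (a + b) / 2"
  have t0: "0 < t0" "a < t0" "t0 < b" using ab by (auto simp: t0_def)
  define X1 where "X1 = t0 *\<^sub>R w1"
  define U1 where "U1 = t0\<^sup>2 *\<^sub>R \<Lambda> w1"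
  have s: "lam w1 \<noteq> 0" using s by (simp add: lam)
  have lX1: "lam X1 = t0 * lam w1" by (simp add: X1_def blinfun.scaleR_right)
  have tU1: "\<theta> U1 = t0\<^sup>2 * lam w1" by (simp add: U1_def blinfun.scaleR_right lam)
  define T where "T z = \<theta> (snd z) / lam (fst z)" for z :: "'a \<times> 'b"
  have lX1': "lam X1 \<noteq> 0" using lX1 t0 s by simp
  have T1: "T (X1, U1) = t0" using t0 s by (simp add: T_def lX1 tU1 power2_eq_square)
  have contT: "isCont T (X1, U1)"
    unfolding T_def using lX1' by (intro continuous_intros) auto
  have "eventually (\<lambda>z. T z \<in> {a<..<b}) (nhds (X1, U1))"
    using contT T1 t0 by (intro isCont_eventually_ball) auto
  moreover have "eventually (\<lambda>z. norm (fst z - T z *\<^sub>R w1) \<in> {..<\<epsilon>}) (nhds (X1, U1))"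
    using T1 \<epsilon> by (intro isCont_eventually_ball continuous_intros contT) (auto simp: X1_def)
  moreover have "eventually (\<lambda>z. \<bar>lam (fst z)\<bar> \<in> {\<bar>lam X1\<bar> / 2<..}) (nhds (X1, U1))"
    using lX1' by (intro isCont_eventually_ball continuous_intros) auto
  ultimately have "eventually (\<lambda>z. T z \<in> {a<..<b} \<and> norm (fst z - T z *\<^sub>R w1) \<in> {..<\<epsilon>} \<and>
      \<bar>lam (fst z)\<bar> \<in> {\<bar>lam X1\<bar> / 2<..}) (nhds (X1, U1))"
    by eventually_elim blast
  then obtain e where e: "0 < e" "\<And>z. dist z (X1, U1) < e \<Longrightarrow> T z \<in> {a<..<b} \<and>
      norm (fst z - T z *\<^sub>R w1) \<in> {..<\<epsilon>} \<and> \<bar>lam (fst z)\<bar> \<in> {\<bar>lam X1\<bar> / 2<..}"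
    unfolding eventually_nhds_metric by blast
  define d where "d = e / 2"
  have d: "0 < d" using e by (simp add: d_def)
  have g: "a \<le> \<theta> U / lam X" "\<theta> U / lam X \<le> b" "norm (X - (\<theta> U / lam X) *\<^sub>R w1) \<le> \<epsilon>"
    "\<bar>lam X1\<bar> / 2 < \<bar>lam X\<bar>" if "X \<in> ball X1 d" "U \<in> ball U1 d" for X U
  proof -
    have "dist (X, U) (X1, U1) < e"
      using that dist_Pair_le[of X U X1 U1] by (simp add: d_def dist_commute)
    from e(2)[OF this] show "a \<le> \<theta> U / lam X" "\<theta> U / lam X \<le> b"
      "norm (X - (\<theta> U / lam X) *\<^sub>R w1) \<le> \<epsilon>" "\<bar>lam X1\<bar> / 2 < \<bar>lam X\<bar>"
      by (auto simp: T_def)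
  qed
  define \<tau> where "\<tau> w U = sqrt (\<theta> U / lam w)" for w U
  have \<tau>1: "\<tau> w1 U1 = t0" using s t0 by (simp add: \<tau>_def tU1)
  let ?q = "(w1, U1, 0::'a)"
  have cq: "isCont (\<lambda>z. \<theta> (fst (snd z)) / lam (fst z)) ?q"
    using s by (intro continuous_intros) auto
  have c\<tau>: "isCont (\<lambda>z. \<tau> (fst z) (fst (snd z))) ?q"
    unfolding \<tau>_def by (rule continuous_real_sqrt[OF cq])
  have "eventually (\<lambda>z. \<theta> (fst (snd z)) / lam (fst z) \<in> {0<..}) (nhds ?q)"
    using cq s t0 by (intro isCont_eventually_ball) (auto simp: tU1)
  moreover have "eventually (\<lambda>z. \<tau> (fst z) (fst (snd z)) \<in> {..<2 * t0}) (nhds ?q)"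
    using c\<tau> \<tau>1 t0 by (intro isCont_eventually_ball) auto
  moreover have "eventually (\<lambda>z. \<tau> (fst z) (fst (snd z)) *\<^sub>R fst z + snd (snd z) \<in> ball X1 d) (nhds ?q)"
    using \<tau>1 d by (intro isCont_eventually_ball continuous_intros c\<tau>) (auto simp: X1_def)
  ultimately have "eventually (\<lambda>z. \<theta> (fst (snd z)) / lam (fst z) \<in> {0<..} \<and>
      \<tau> (fst z) (fst (snd z)) \<in> {..<2 * t0} \<and> \<tau> (fst z) (fst (snd z)) *\<^sub>R fst z + snd (snd z) \<in> ball X1 d) (nhds ?q)"
    by eventually_elim blast
  then obtain e' where e': "0 < e'" "\<And>z. dist z ?q < e' \<Longrightarrow> \<theta> (fst (snd z)) / lam (fst z) \<in> {0<..} \<and>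
      \<tau> (fst z) (fst (snd z)) \<in> {..<2 * t0} \<and> \<tau> (fst z) (fst (snd z)) *\<^sub>R fst z + snd (snd z) \<in> ball X1 d"
    unfolding eventually_nhds_metric by blast
  define \<rho> where "\<rho> = min (e' / 4) (min d 1)"
  have \<rho>: "0 < \<rho>" "\<rho> \<le> d" "\<rho> \<le> 1" "4 * \<rho> \<le> e'" using e' d by (auto simp: \<rho>_def)
  have g': "0 < \<theta> U / lam w" "\<tau> w U < 2 * t0" "\<tau> w U *\<^sub>R w + v \<in> ball X1 d"
    if "w \<in> ball w1 \<rho>" "U \<in> ball U1 \<rho>" "norm v \<le> \<rho>" for w U v
  proof -
    have "dist (w, U, v) ?q \<le> dist w w1 + (dist U U1 + dist v 0)"
      using dist_Pair_le[of w "(U, v)" w1 "(U1, 0)"] dist_Pair_le[of U v U1 0] by linarith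
    also have "\<dots> < e'" using that \<rho> by (simp add: dist_commute)
    finally show "0 < \<theta> U / lam w" "\<tau> w U < 2 * t0" "\<tau> w U *\<^sub>R w + v \<in> ball X1 d"
      using e'(2)[of "(w, U, v)"] by auto
  qed
  obtain K where K: "0 < K" "\<And>X Y. norm (layer_bracket br X Y) \<le> K * norm X * norm Y"
    using bilinear_bounded_pos[OF layer_bracket_bilinear[OF br]] by blast
  \<comment> \<open>Up to the factor \<open>\<delta>\<close>, \<open>c0\<close> bounds \<open>lam v\<close> and \<open>c1\<close> the sum of the basis functionals at \<open>X - t w\<close>; \<open>c2\<close> bounds the
    coordinates of \<open>J_map br \<theta> X + t *\<^sub>R lam\<close>.\<close>
  define c0 where "c0 = (\<Sum>l\<in>B. \<bar>lam (E l)\<bar>)"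
  define c1 where "c1 = (\<Sum>l\<in>B. 4 * c0 / \<bar>lam w1\<bar> * (norm l * (norm w1 + 1)) + 1)"
  define c2 where "c2 = (\<Sum>l\<in>B. norm \<theta> * (K * (norm X1 + d) * norm (E l)) + b * \<bar>lam (E l)\<bar>)"
  have c0: "0 \<le> c0" by (simp add: c0_def sum_nonneg)
  have c2: "0 \<le> c2" using K d ab by (auto simp: c2_def intro!: sum_nonneg add_nonneg_nonneg mult_nonneg_nonneg)
  have lamV: "lam \<in> V_space br \<Lambda> \<theta>"
    using V_space_member[of br \<theta> 0 1 \<Lambda>] by (simp add: J_map_zero[OF br] lam_def)
  have main: "(\<Sum>l\<in>B. \<bar>blinfun_apply l (X - t *\<^sub>R w)\<bar>)
       + \<bar>\<theta> (U - (t/2) *\<^sub>R layer_bracket br X w - t\<^sup>2 *\<^sub>R \<Lambda> w)\<bar> \<le> max 1 (c1 + c2 * c1) * \<delta>"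
    if w: "w \<in> ball w1 \<rho>" and U: "U \<in> ball U1 \<rho>" and v: "norm v \<le> \<rho>" and \<delta>: "0 \<le> \<delta>"
      and lv: "\<And>l. l \<in> B \<Longrightarrow> \<bar>blinfun_apply l v\<bar> \<le> \<delta>" and X: "X = \<tau> w U *\<^sub>R w + v" and t: "t = \<theta> U / lam X"
    for w U v \<delta> X t
  proof -
    note gg = g'[OF w U v]
    have XB: "X \<in> ball X1 d" using gg(3) X by simp
    have UB: "U \<in> ball U1 d" using U \<rho> by auto
    note G = g[OF XB UB, folded t]
    have lamX: "\<bar>lam X\<bar> > t0 * \<bar>lam w1\<bar> / 2" using G(4) t0 by (simp add: lX1 abs_mult)
    have lamX0: "lam X \<noteq> 0" 
    proof -
      have "0 \<le> t0 * \<bar>lam w1\<bar> / 2" using t0 by simp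
      then show ?thesis using lamX by linarith
    qed
    have \<tau>0: "0 < \<tau> w U" using gg(1) by (simp add: \<tau>_def)
    have \<tau>2: "(\<tau> w U)\<^sup>2 * lam w = \<theta> U"
      using gg(1) by (auto simp: \<tau>_def)
    have lv0: "\<bar>lam v\<bar> \<le> c0 * \<delta>"
    proof -
      have "\<bar>lam v\<bar> \<le> (\<Sum>l\<in>B. \<bar>lam (E l) * blinfun_apply l v\<bar>)"
        unfolding coord[OF lamV, of v] by (rule sum_abs)
      also have "\<dots> \<le> (\<Sum>l\<in>B. \<bar>lam (E l)\<bar> * \<delta>)"
        unfolding abs_mult using lv by (intro sum_mono mult_left_mono) auto
      finally show ?thesis by (simp add: c0_def sum_distrib_right)
    qed
    have Xv: "lam X = \<tau> w U * lam w + lam v"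
      by (simp add: X blinfun.add_right blinfun.scaleR_right)
    have "(\<tau> w U - t) * lam X = \<tau> w U * lam X - \<theta> U"
      using lamX0 by (simp add: t left_diff_distrib)
    also have "\<dots> = \<tau> w U * lam v"
      unfolding Xv \<tau>2[symmetric] by (simp add: distrib_left power2_eq_square)
    finally have "(\<tau> w U - t) * lam X = \<tau> w U * lam v" .
    then have "\<bar>\<tau> w U - t\<bar> * \<bar>lam X\<bar> = \<tau> w U * \<bar>lam v\<bar>"
      using \<tau>0 by (metis abs_mult abs_of_pos)
    also have "\<dots> \<le> 2 * t0 * (c0 * \<delta>)"
      using gg(2) lv0 \<tau>0 t0 by (intro mult_mono) auto
    finally have "\<bar>\<tau> w U - t\<bar> * (t0 * \<bar>lam w1\<bar> / 2) \<le> 2 * t0 * (c0 * \<delta>)"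
      using lamX by (meson abs_ge_zero less_imp_le mult_left_mono order.trans)
    then have \<tau>t: "\<bar>\<tau> w U - t\<bar> \<le> 4 * c0 * \<delta> / \<bar>lam w1\<bar>"
      using t0 s by (simp add: field_simps)
    have wn: "norm w \<le> norm w1 + 1"
      using w \<rho> norm_triangle_ineq2[of w w1] by (simp add: dist_norm norm_minus_commute)
    let ?n = "\<Sum>l\<in>B. \<bar>blinfun_apply l (X - t *\<^sub>R w)\<bar>"
    have n: "?n \<le> c1 * \<delta>"
      unfolding c1_def sum_distrib_right
    proof (intro sum_mono)
      fix l assume l: "l \<in> B"
      have "blinfun_apply l (X - t *\<^sub>R w) = (\<tau> w U - t) * blinfun_apply l w + blinfun_apply l v"
        by (simp add: X blinfun.add_right blinfun.diff_right blinfun.scaleR_right algebra_simps)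
      also have "\<bar>\<dots>\<bar> \<le> \<bar>\<tau> w U - t\<bar> * \<bar>blinfun_apply l w\<bar> + \<bar>blinfun_apply l v\<bar>"
        by (metis abs_mult abs_triangle_ineq)
      also have "\<dots> \<le> 4 * c0 * \<delta> / \<bar>lam w1\<bar> * (norm l * (norm w1 + 1)) + \<delta>"
      proof (intro add_mono mult_mono lv l \<tau>t)
        have "\<bar>blinfun_apply l w\<bar> \<le> norm l * norm w" using norm_blinfun[of l w] by simp
        also have "\<dots> \<le> norm l * (norm w1 + 1)" using wn by (intro mult_left_mono) auto
        finally show "\<bar>blinfun_apply l w\<bar> \<le> norm l * (norm w1 + 1)" .
      qed (use c0 \<delta> in auto)
      also have "\<dots> = (4 * c0 / \<bar>lam w1\<bar> * (norm l * (norm w1 + 1)) + 1) * \<delta>"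
        by (simp add: algebra_simps)
      finally show "\<bar>blinfun_apply l (X - t *\<^sub>R w)\<bar> \<le> (4 * c0 / \<bar>lam w1\<bar> * (norm l * (norm w1 + 1)) + 1) * \<delta>" .
    qed
    have "\<theta> (U - (t/2) *\<^sub>R layer_bracket br X w - t\<^sup>2 *\<^sub>R \<Lambda> w)
        = (J_map br \<theta> X + t *\<^sub>R (\<theta> o\<^sub>L \<Lambda>)) (X - t *\<^sub>R w)"
      unfolding second_layer_identity[OF br] using lamX0 by (simp add: t lam)
    also have "\<dots> = (\<Sum>l\<in>B. (J_map br \<theta> X + t *\<^sub>R lam) (E l) * blinfun_apply l (X - t *\<^sub>R w))"
      unfolding lam_def by (rule coord[OF V_space_member])
    also have "\<bar>\<dots>\<bar> \<le> (\<Sum>l\<in>B. \<bar>(J_map br \<theta> X + t *\<^sub>R lam) (E l) * blinfun_apply l (X - t *\<^sub>R w)\<bar>)"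
      by (rule sum_abs)
    also have "\<dots> \<le> (\<Sum>l\<in>B. c2 * \<bar>blinfun_apply l (X - t *\<^sub>R w)\<bar>)"
      unfolding abs_mult
    proof (intro sum_mono mult_right_mono)
      fix l assume l: "l \<in> B"
      have Xn: "norm X \<le> norm X1 + d"
        using XB norm_triangle_ineq2[of X X1] by (simp add: dist_norm norm_minus_commute)
      have 1: "\<bar>J_map br \<theta> X (E l)\<bar> \<le> norm \<theta> * (K * (norm X1 + d) * norm (E l))"
      proof -
        have "\<bar>J_map br \<theta> X (E l)\<bar> \<le> \<bar>\<theta> (layer_bracket br X (E l))\<bar>"
          by (simp add: J_map_apply[OF br])
        also have "\<dots> \<le> norm \<theta> * norm (layer_bracket br X (E l))"
          using norm_blinfun[of \<theta>] by simp
        also have "\<dots> \<le> norm \<theta> * (K * (norm X1 + d) * norm (E l))"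
          using Xn K(1) by (intro mult_left_mono order.trans[OF K(2)] mult_right_mono) auto
        finally show ?thesis .
      qed
      have "\<bar>t * lam (E l)\<bar> = t * \<bar>lam (E l)\<bar>" using G(1) ab by (simp add: abs_mult)
      also have "\<dots> \<le> b * \<bar>lam (E l)\<bar>" using G(2) by (intro mult_right_mono) auto
      finally have "\<bar>(J_map br \<theta> X + t *\<^sub>R lam) (E l)\<bar>
          \<le> norm \<theta> * (K * (norm X1 + d) * norm (E l)) + b * \<bar>lam (E l)\<bar>"
        using 1 by (simp add: plus_blinfun.rep_eq scaleR_blinfun.rep_eq)
      also have "\<dots> \<le> c2"
        unfolding c2_def using l B K d ab
        by (intro member_le_sum[of l B "\<lambda>l. norm \<theta> * (K * (norm X1 + d) * norm (E l)) + b * \<bar>lam (E l)\<bar>"]) auto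
      finally show "\<bar>(J_map br \<theta> X + t *\<^sub>R lam) (E l)\<bar> \<le> c2" .
    qed auto
    also have "\<dots> = c2 * ?n" by (simp add: sum_distrib_left)
    also have "\<dots> \<le> c2 * (c1 * \<delta>)" using n c2 by (intro mult_left_mono)
    finally have "?n + \<bar>\<theta> (U - (t/2) *\<^sub>R layer_bracket br X w - t\<^sup>2 *\<^sub>R \<Lambda> w)\<bar> \<le> (c1 + c2 * c1) * \<delta>"
      using n by (simp add: algebra_simps)
    also have "\<dots> \<le> max 1 (c1 + c2 * c1) * \<delta>" using \<delta> by (intro mult_right_mono) auto
    finally show ?thesis .
  qed
  have f1: "\<forall>X\<in>ball X1 d. \<forall>U\<in>ball U1 d. a \<le> \<theta> U / \<theta> (\<Lambda> X) \<and> \<theta> U / \<theta> (\<Lambda> X) \<le> b \<and>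
       norm (X - (\<theta> U / \<theta> (\<Lambda> X)) *\<^sub>R w1) \<le> \<epsilon>"
    using g unfolding lam by blast
  have f2: "\<forall>w\<in>ball w1 \<rho>. \<forall>U\<in>ball U1 \<rho>. \<exists>\<tau>. \<forall>v \<delta>. norm v \<le> \<rho> \<longrightarrow> 0 \<le> \<delta> \<longrightarrow> (\<forall>l\<in>B. \<bar>blinfun_apply l v\<bar> \<le> \<delta>) \<longrightarrow>
       (\<forall>X t. X = \<tau> *\<^sub>R w + v \<longrightarrow> t = \<theta> U / \<theta> (\<Lambda> X) \<longrightarrow> X \<in> ball X1 d \<and>
         (\<Sum>l\<in>B. \<bar>blinfun_apply l (X - t *\<^sub>R w)\<bar>)
           + \<bar>\<theta> (U - (t/2) *\<^sub>R layer_bracket br X w - t\<^sup>2 *\<^sub>R \<Lambda> w)\<bar> \<le> max 1 (c1 + c2 * c1) * \<delta>)"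
  proof (intro ballI)
    fix w U assume w: "w \<in> ball w1 \<rho>" and U: "U \<in> ball U1 \<rho>"
    show "\<exists>\<tau>. \<forall>v \<delta>. norm v \<le> \<rho> \<longrightarrow> 0 \<le> \<delta> \<longrightarrow> (\<forall>l\<in>B. \<bar>blinfun_apply l v\<bar> \<le> \<delta>) \<longrightarrow>
       (\<forall>X t. X = \<tau> *\<^sub>R w + v \<longrightarrow> t = \<theta> U / \<theta> (\<Lambda> X) \<longrightarrow> X \<in> ball X1 d \<and>
         (\<Sum>l\<in>B. \<bar>blinfun_apply l (X - t *\<^sub>R w)\<bar>)
           + \<bar>\<theta> (U - (t/2) *\<^sub>R layer_bracket br X w - t\<^sup>2 *\<^sub>R \<Lambda> w)\<bar> \<le> max 1 (c1 + c2 * c1) * \<delta>)"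
    proof (rule exI[of _ "\<tau> w U"], intro allI impI conjI)
      fix v \<delta> X t
      assume h: "norm v \<le> \<rho>" "0 \<le> \<delta>" "\<forall>l\<in>B. \<bar>blinfun_apply l v\<bar> \<le> \<delta>" "X = \<tau> w U *\<^sub>R w + v" "t = \<theta> U / \<theta> (\<Lambda> X)"
      show "X \<in> ball X1 d" using g'(3)[OF w U h(1)] h(4) by simp
      show "(\<Sum>l\<in>B. \<bar>blinfun_apply l (X - t *\<^sub>R w)\<bar>)
           + \<bar>\<theta> (U - (t/2) *\<^sub>R layer_bracket br X w - t\<^sup>2 *\<^sub>R \<Lambda> w)\<bar> \<le> max 1 (c1 + c2 * c1) * \<delta>"
        using h(3) by (intro main[OF w U h(1,2) _ h(4) h(5)[unfolded lam]]) blast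
    qed
  qed
  show ?thesis
    by (rule exI[of _ X1], rule exI[of _ U1], rule exI[of _ d], rule exI[of _ \<rho>],
        rule exI[of _ "max 1 (c1 + c2 * c1)"],
        rule conjI[OF d conjI[OF \<rho>(1) conjI[OF \<rho>(2) conjI[OF max.cobounded1 conjI[OF f1 f2]]]]])
qed

section \<open>The multiscale test function\<close>

definition scale_sum :: "nat \<Rightarrow> nat \<Rightarrow> real \<Rightarrow> real" where
  "scale_sum r K s = (\<Sum>k=1..K. 2 ^ (k * r) * bump (2 ^ k * s))"

lemma scale_sum_nonneg: "0 \<le> scale_sum r K s"
  unfolding scale_sum_def by (intro sum_nonneg mult_nonneg_nonneg) (auto simp: bump_simps)

lemma scale_sum_le: "scale_sum r K s \<le> (\<Sum>k=1..K. 2 ^ (k * r))"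
  unfolding scale_sum_def by (intro sum_mono mult_left_le) (auto simp: bump_simps)

lemma continuous_on_scale_sum: "continuous_on S f \<Longrightarrow> continuous_on S (\<lambda>x. scale_sum r K (f x))"
  unfolding scale_sum_def by (intro continuous_intros)

text \<open>
  A sum of distinct powers of 2 is at most twice its largest term.
\<close>

lemma geometric_powr_sum_le:
  assumes S: "finite S" and r: "1 \<le> r" and q: "1 \<le> q"
  shows "(\<Sum>k\<in>S. (2::real) ^ (k * r)) powr q \<le> 2 powr q * (\<Sum>k\<in>S. (2 ^ (k * r)) powr q)"
proof (cases "S = {}")
  case False
  define m where "m = Max S"
  have m: "m \<in> S" "S \<subseteq> {..m}" using S False by (auto simp: m_def)
  have geo: "(\<Sum>k\<le>n. x ^ k) \<le> 2 * x ^ n" if "2 \<le> x" for x :: real and n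
  proof (induction n)
    case (Suc n)
    have "2 * x ^ n \<le> x * x ^ n" using that by (intro mult_right_mono) auto
    then show ?case using Suc by simp
  qed simp
  have "2 ^ 1 \<le> (2::real) ^ r" using r by (intro power_increasing) auto
  then have x: "2 \<le> (2::real) ^ r" by simp
  have "(\<Sum>k\<in>S. (2::real) ^ (k * r)) \<le> (\<Sum>k\<le>m. 2 ^ (k * r))"
    using m by (intro sum_mono2) auto
  also have "\<dots> = (\<Sum>k\<le>m. (2 ^ r) ^ k)" by (simp add: power_mult[symmetric] mult.commute)
  also have "\<dots> \<le> 2 * 2 ^ (m * r)"
    using geo[OF x, of m] by (simp add: power_mult[symmetric] mult.commute)
  finally have "(\<Sum>k\<in>S. (2::real) ^ (k * r)) powr q \<le> (2 * 2 ^ (m * r)) powr q"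
    using q by (intro powr_mono2 sum_nonneg) auto
  also have "\<dots> = 2 powr q * (2 ^ (m * r)) powr q" by (simp add: powr_mult)
  also have "\<dots> \<le> 2 powr q * (\<Sum>k\<in>S. (2 ^ (k * r)) powr q)"
    using m S by (intro mult_left_mono member_le_sum) auto
  finally show ?thesis .
qed simp

lemma scale_sum_powr_le:
  assumes r: "1 \<le> r" and q: "1 \<le> q"
  shows "scale_sum r K s powr q \<le> 2 powr q * (\<Sum>k=1..K. (2 ^ (k * r)) powr q * indicator {..2 * (1/2) ^ k} s)"
proof -
  let ?S = "{k \<in> {1..K}. s \<le> 2 * (1/2) ^ k}"
  have "scale_sum r K s \<le> (\<Sum>k=1..K. if s \<le> 2 * (1/2) ^ k then 2 ^ (k * r) else 0)"
    unfolding scale_sum_def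
  proof (intro sum_mono)
    fix k
    have "2 \<le> 2 ^ k * s" if "\<not> s \<le> 2 * (1/2) ^ k"
    proof -
      have "2 ^ k * (2 * (1/2) ^ k) \<le> 2 ^ k * s" using that by (intro mult_left_mono) auto
      moreover have "2 ^ k * (2 * (1/2) ^ k) = (2::real)" by (simp add: power_divide)
      ultimately show ?thesis by linarith
    qed
    then show "2 ^ (k * r) * bump (2 ^ k * s) \<le> (if s \<le> 2 * (1/2) ^ k then 2 ^ (k * r) else 0)"
      by (auto simp: bump_simps mult_left_le)
  qed
  also have "\<dots> = (\<Sum>k\<in>?S. 2 ^ (k * r))"
    by (rule sum.inter_filter[symmetric]) simp
  finally have "scale_sum r K s powr q \<le> (\<Sum>k\<in>?S. 2 ^ (k * r)) powr q"
    using q by (intro powr_mono2 scale_sum_nonneg) auto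
  also have "\<dots> \<le> 2 powr q * (\<Sum>k\<in>?S. (2 ^ (k * r)) powr q)"
    using r q by (intro geometric_powr_sum_le) auto
  also have "(\<Sum>k\<in>?S. ((2::real) ^ (k * r)) powr q) = (\<Sum>k=1..K. (2 ^ (k * r)) powr q * indicator {..2 * (1/2) ^ k} s)"
    by (intro sum.mono_neutral_cong_left) auto
  finally show ?thesis .
qed

text \<open>
  Every term is \<open>2 ^ Suc r * 2 powr (k * (q * r - r - 1))\<close>, with a nonpositive exponent. For \<open>q = 1\<close> the exponent is \<open>- k\<close>
  and the sum stays bounded in \<open>K\<close>.
\<close>

lemma scale_exponent_sum_le:
  assumes q: "1 \<le> q" "q * real r \<le> real r + 1"
  shows "(\<Sum>k=1..K. (2 ^ (k * r)) powr q * (2 * (1/2) ^ k) ^ Suc r)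
    \<le> 2 ^ Suc r * (if q = 1 then 1 else real K)"
proof -
  have eq: "(2 ^ (k * r)) powr q * (2 * (1/2) ^ k) ^ Suc r
      = 2 ^ Suc r * 2 powr (real k * (q * real r - (real r + 1)))" for k
  proof -
    have "((2::real) ^ (k * r)) powr q = 2 powr (real k * (q * real r))"
      by (simp add: powr_realpow[symmetric] powr_powr mult_ac)
    moreover have "((1/2) ^ k) ^ Suc r = 2 powr (- (real k * (real r + 1)))"
    proof -
      have "((1/2) ^ k) ^ Suc r = inverse ((2::real) ^ (k * Suc r))"
        by (simp only: power_mult[symmetric] power_one_over inverse_eq_divide)
      also have "\<dots> = inverse (2 powr (real (k * Suc r)))" by (simp only: powr_realpow zero_less_numeral)
      also have "\<dots> = 2 powr (- (real k * (real r + 1)))"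
        by (simp only: powr_minus[symmetric] of_nat_mult of_nat_Suc add.commute)
      finally show ?thesis .
    qed
    ultimately show ?thesis
      by (simp only: power_mult_distrib right_diff_distrib powr_diff powr_minus_divide mult_ac times_divide_eq_right mult_1_right)
  qed
  show ?thesis
  proof (cases "q = 1")
    case True
    have "(\<Sum>k=1..K. (1/2::real) ^ k) \<le> 1"
    proof -
      have "(\<Sum>k=1..K. (1/2::real) ^ k) = 1 - (1/2) ^ K" by (induction K) auto
      then show ?thesis by simp
    qed
    moreover have "2 powr (real k * (q * real r - (real r + 1))) = (1/2) ^ k" for k
      using True by (simp add: powr_minus powr_realpow power_one_over inverse_eq_divide)
    ultimately show ?thesis
      unfolding eq sum_distrib_left[symmetric] using True by simp
  next
    case False
    have "(\<Sum>k=1..K. 2 powr (real k * (q * real r - (real r + 1)))) \<le> (\<Sum>k=1..K. 1)"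
    proof (intro sum_mono)
      fix k
      have "real k * (q * real r - (real r + 1)) \<le> 0"
        using q by (intro mult_nonneg_nonpos) auto
      then show "2 powr (real k * (q * real r - (real r + 1))) \<le> 1"
        using powr_mono[of "real k * (q * real r - (real r + 1))" 0 2] by simp
    qed
    then show ?thesis
      unfolding eq sum_distrib_left[symmetric] using False by simp
  qed
qed

text \<open>
  At scale \<open>k\<close> the test function lives on a slab given by the \<open>r\<close> functionals in \<open>B\<close> and by \<open>\<theta>\<close>, of measure
  \<open>O(2 powr (- k * (r + 1)))\<close>. In the index type of the slab, \<open>None\<close> stands for \<open>\<theta>\<close>.
\<close>

lemma test_function_norm:
  fixes B :: "('a::euclidean_space \<Rightarrow>\<^sub>L real) set" and \<theta> :: "'b::euclidean_space \<Rightarrow>\<^sub>L real"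
  assumes B: "finite B" "card B = r" and r: "1 \<le> r"
    and E: "\<And>l m. l \<in> B \<Longrightarrow> m \<in> B \<Longrightarrow> blinfun_apply l (E m) = (if l = m then 1 else 0)"
    and U0: "\<theta> U0 = 1" and q: "1 \<le> q" "q * real r \<le> real r + 1"
    and \<epsilon>: "0 < \<epsilon>" and R: "0 < R"
  shows "\<exists>M\<ge>0. \<forall>K. (\<integral>\<^sup>+z. ennreal ((cutoff \<epsilon> R z *
      scale_sum r K ((\<Sum>l\<in>B. \<bar>blinfun_apply l (fst z)\<bar>) + \<bar>\<theta> (snd z)\<bar>)) powr q) \<partial>lborel)
    \<le> ennreal (M * (if q = 1 then 1 else real K))"
proof -
  define A where "A = insert None (Some ` B)"
  define L where "L i z = (case i of None \<Rightarrow> \<theta> (snd z) | Some l \<Rightarrow> blinfun_apply l (fst z))"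
    for i :: "('a \<Rightarrow>\<^sub>L real) option" and z :: "'a \<times> 'b"
  define e where "e i = (case i of None \<Rightarrow> (0, U0) | Some l \<Rightarrow> (E l, 0))"
    for i :: "('a \<Rightarrow>\<^sub>L real) option"
  define R' where "R' = 4 * \<epsilon> + 2 * R"
  define T where "T k = slab A L (\<lambda>_. 0) (\<lambda>_. 2 * (1/2) ^ k) R'" for k :: nat
  have A: "finite A" "card A = Suc r"
    using B by (auto simp: A_def card_insert_if card_image)
  have lin: "linear (L i)" if "i \<in> A" for i
    by (cases i) (auto simp: L_def linear_iff blinfun.add_right blinfun.scaleR_right)
  have dual: "L i (e j) = (if i = j then 1 else 0)" if "i \<in> A" "j \<in> A" for i j
    using that E U0 by (auto simp: A_def L_def e_def blinfun.zero_right split: option.splits)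
  define Ke where "Ke = (\<Sum>i\<in>A. norm (e i))"
  have Ke: "norm (e i) \<le> Ke" if "i \<in> A" for i
    unfolding Ke_def using that A by (intro member_le_sum) auto
  define b where "b = measure lborel (cball (0 :: 'a \<times> 'b) (R' + 3 * Ke * card A))"
  have b: "0 \<le> b" "emeasure lborel (cball (0 :: 'a \<times> 'b) (R' + 3 * Ke * card A)) = ennreal b"
    using emeasure_lborel_cball_finite[of "0 :: 'a \<times> 'b" "R' + 3 * Ke * card A"]
    by (auto simp: b_def intro!: emeasure_eq_ennreal_measure)
  have T: "emeasure lborel (T k) \<le> ennreal ((2 * (1/2) ^ k) ^ Suc r * b)" if "1 \<le> k" for k
  proof -
    have "(1/2) ^ k \<le> (1/2::real) ^ 1" using that by (intro power_decreasing) auto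
    then have "emeasure lborel (T k)
      \<le> ennreal (\<Prod>i\<in>A. 2 * (1/2) ^ k) * emeasure lborel (cball (0 :: 'a \<times> 'b) (R' + 3 * Ke * card A))"
      unfolding T_def by (intro slab_measure_upper[where e=e] A lin dual Ke) auto
    then show ?thesis using b(1) unfolding b(2) by (simp add: A(2) ennreal_mult)
  qed
  have Tm: "T k \<in> sets borel" for k unfolding T_def using A lin by (intro slab_borel)
  have "(\<integral>\<^sup>+z. ennreal ((cutoff \<epsilon> R z *
      scale_sum r K ((\<Sum>l\<in>B. \<bar>blinfun_apply l (fst z)\<bar>) + \<bar>\<theta> (snd z)\<bar>)) powr q) \<partial>lborel)
    \<le> ennreal (2 powr q * b * 2 ^ Suc r * (if q = 1 then 1 else real K))" for K
  proof -
    let ?n = "\<lambda>z. (\<Sum>l\<in>B. \<bar>blinfun_apply l (fst z)\<bar>) + \<bar>\<theta> (snd z)\<bar>"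
    have pt: "ennreal ((cutoff \<epsilon> R z * scale_sum r K (?n z)) powr q)
      \<le> (\<Sum>k=1..K. ennreal (2 powr q * (2 ^ (k * r)) powr q) * indicator (T k) z)" for z
    proof (cases "cutoff \<epsilon> R z = 0")
      case False
      have zT: "indicator {..2 * (1/2) ^ k} (?n z) \<le> (indicator (T k) z :: real)" for k
      proof (cases "?n z \<le> 2 * (1/2) ^ k")
        case True
        have "\<bar>L i z\<bar> \<le> ?n z" if "i \<in> A" for i
        proof (cases i)
          case None
          then show ?thesis by (simp add: L_def sum_nonneg)
        next
          case (Some l)
          then have "\<bar>blinfun_apply l (fst z)\<bar> \<le> (\<Sum>l\<in>B. \<bar>blinfun_apply l (fst z)\<bar>)"
            using that B by (intro member_le_sum) (auto simp: A_def)
          then show ?thesis using Some by (simp add: L_def)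
        qed
        then have "z \<in> T k"
          using True cutoff_support(2)[OF False \<epsilon> R] by (force simp: T_def slab_def R'_def)
        then show ?thesis by (simp add: indicator_def)
      qed (simp add: indicator_def)
      have "(cutoff \<epsilon> R z * scale_sum r K (?n z)) powr q \<le> scale_sum r K (?n z) powr q"
        using q cutoff_range[of \<epsilon> R z] scale_sum_nonneg
        by (intro powr_mono2 mult_left_le_one_le mult_nonneg_nonneg) auto
      also have "\<dots> \<le> 2 powr q * (\<Sum>k=1..K. (2 ^ (k * r)) powr q * indicator {..2 * (1/2) ^ k} (?n z))"
        using r q by (intro scale_sum_powr_le) auto
      also have "\<dots> \<le> 2 powr q * (\<Sum>k=1..K. (2 ^ (k * r)) powr q * indicator (T k) z)"
        using zT by (intro mult_left_mono sum_mono) auto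
      also have "\<dots> = (\<Sum>k=1..K. 2 powr q * (2 ^ (k * r)) powr q * indicator (T k) z)"
        by (simp only: sum_distrib_left mult.assoc)
      finally have "ennreal ((cutoff \<epsilon> R z * scale_sum r K (?n z)) powr q)
        \<le> ennreal (\<Sum>k=1..K. 2 powr q * (2 ^ (k * r)) powr q * indicator (T k) z)"
        by (rule ennreal_leI)
      also have "\<dots> = (\<Sum>k=1..K. ennreal (2 powr q * (2 ^ (k * r)) powr q) * indicator (T k) z)"
        by (subst sum_ennreal[symmetric]) (auto simp: ennreal_mult ennreal_indicator)
      finally show ?thesis .
    qed simp
    have "(\<integral>\<^sup>+z. ennreal ((cutoff \<epsilon> R z * scale_sum r K (?n z)) powr q) \<partial>lborel)
      \<le> (\<integral>\<^sup>+z. (\<Sum>k=1..K. ennreal (2 powr q * (2 ^ (k * r)) powr q) * indicator (T k) z) \<partial>lborel)"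
      by (intro nn_integral_mono pt)
    also have "\<dots> = (\<Sum>k=1..K. ennreal (2 powr q * (2 ^ (k * r)) powr q) * emeasure lborel (T k))"
      using Tm by (subst nn_integral_sum) (auto simp: nn_integral_cmult_indicator)
    also have "\<dots> \<le> (\<Sum>k=1..K. ennreal (2 powr q * (2 ^ (k * r)) powr q) * ennreal ((2 * (1/2) ^ k) ^ Suc r * b))"
      using T by (intro sum_mono mult_left_mono) auto
    also have "\<dots> = ennreal (2 powr q * b * (\<Sum>k=1..K. (2 ^ (k * r)) powr q * (2 * (1/2) ^ k) ^ Suc r))"
      using b(1) by (simp add: ennreal_mult[symmetric] sum_distrib_left mult_ac del: power_Suc)
    also have "\<dots> \<le> ennreal (2 powr q * b * (2 ^ Suc r * (if q = 1 then 1 else real K)))"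
      using b(1) scale_exponent_sum_le[OF q] by (intro ennreal_leI mult_left_mono) auto
    finally show ?thesis by (simp only: mult.assoc)
  qed
  then show ?thesis using b(1) by (intro exI[of _ "2 powr q * b * 2 ^ Suc r"]) auto
qed

text \<open>
  The left-hand side grows like \<open>K powr q\<close>, faster than the right-hand side, both for \<open>q = 1\<close> and for \<open>q > 1\<close>.
\<close>

lemma powr_growth_contradiction:
  assumes q: "1 \<le> q" and c: "0 < c"
    and bound: "\<And>K. (real K * c) powr q \<le> D * (if q = 1 then 1 else real K)"
  shows False
proof (cases "q = 1")
  case True
  obtain K :: nat where "D / c < real K" using reals_Archimedean2 by blast
  then show False using bound[of K] c True by (simp add: field_simps)
next
  case False
  define D' where "D' = \<bar>D\<bar> / c powr q + 1"
  have D': "1 \<le> D'" by (simp add: D'_def)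
  obtain K :: nat where K: "D' powr (1 / (q - 1)) < real K" using reals_Archimedean2 by blast
  have K0: "0 < real K" using K by (meson le_less_trans powr_ge_zero)
  have "(D' powr (1 / (q - 1))) powr (q - 1) \<le> real K powr (q - 1)"
    using K q by (intro powr_mono2) auto
  then have *: "D' \<le> real K powr (q - 1)"
    using False D' by (simp add: powr_powr)
  have "real K powr q = real K powr (1 + (q - 1))" by (simp only: add_diff_cancel_left' add_diff_eq)
  also have "\<dots> = real K * real K powr (q - 1)" unfolding powr_add using K0 by simp
  finally have Kq: "real K powr q = real K * real K powr (q - 1)" .
  have "(real K * c) powr q \<le> D * real K" using bound[of K] unfolding if_not_P[OF False] .
  also have "\<dots> \<le> \<bar>D\<bar> * real K" by (intro mult_right_mono abs_ge_self) simp
  finally have "real K * (real K powr (q - 1) * c powr q) \<le> real K * \<bar>D\<bar>"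
    unfolding powr_mult Kq mult.assoc mult.commute[of "real K" "\<bar>D\<bar>"] .
  then have "real K powr (q - 1) * c powr q \<le> \<bar>D\<bar>" using K0 by (rule mult_left_le_imp_le)
  then have "real K powr (q - 1) \<le> \<bar>D\<bar> / c powr q" using c by (simp add: pos_le_divide_eq)
  then show False using * by (simp add: D'_def)
qed

section \<open>Failure of the maximal inequality up to the critical exponent\<close>

text \<open>
  The bump at scale \<open>k\<close> equals 1 on a translate of a slab of width \<open>1 / (C0 * 2 ^ k)\<close>, whose measure is at least
  a constant times \<open>2 ^ -(k * r)\<close>. With the weight \<open>2 ^ (k * r)\<close> every scale contributes the same amount.
\<close>

lemma transported_slab_integral:
  fixes B :: "('a::euclidean_space \<Rightarrow>\<^sub>L real) set" and g s :: "'a \<Rightarrow> real"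
  assumes B: "finite B" and C0: "1 \<le> C0" and c: "0 \<le> c"
    and slab: "\<And>d. 0 < d \<Longrightarrow> d \<le> 1 \<Longrightarrow>
       ennreal (c * d ^ r) \<le> emeasure lborel (slab B blinfun_apply (\<lambda>_. 0) (\<lambda>_. d) \<rho>)"
    and g: "\<And>X. 0 \<le> g X" "\<And>v. norm v \<le> \<rho> \<Longrightarrow> scale_sum r K (s (y + v)) \<le> g (y + v)"
    and s: "\<And>v \<delta>. norm v \<le> \<rho> \<Longrightarrow> 0 \<le> \<delta> \<Longrightarrow> (\<And>l. l \<in> B \<Longrightarrow> \<bar>blinfun_apply l v\<bar> \<le> \<delta>) \<Longrightarrow> s (y + v) \<le> C0 * \<delta>"
  shows "ennreal (real K * (c / C0 ^ r)) \<le> (\<integral>\<^sup>+X. ennreal (g X) \<partial>lborel)"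
proof -
  define T where "T k = slab B blinfun_apply (\<lambda>_. 0) (\<lambda>_. (1/2) ^ k / C0) \<rho>" for k :: nat
  define S where "S k = {X. X - y \<in> T k}" for k
  have T: "T k \<in> sets borel" for k
    unfolding T_def using B by (intro slab_borel bounded_linear.linear blinfun.bounded_linear_right)
  have S: "S k \<in> sets borel" for k
    unfolding S_def by (rule lborel_shift_borel[OF T])
  have Sk: "ennreal (c * ((1/2) ^ k / C0) ^ r) \<le> emeasure lborel (S k)" for k
    unfolding S_def emeasure_lborel_shift[OF T] unfolding T_def
  proof (rule slab)
    have "(1/2::real) ^ k \<le> 1" by (intro power_le_one) auto
    then show "(1/2) ^ k / C0 \<le> 1" using C0 by (simp add: divide_le_eq)
  qed (use C0 in simp)
  have pt: "(\<Sum>k=1..K. ennreal (2 ^ (k * r)) * indicator (S k) X) \<le> ennreal (g X)" for X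
  proof (cases "norm (X - y) \<le> \<rho>")
    case True
    have "(\<Sum>k=1..K. 2 ^ (k * r) * indicator (S k) X) \<le> scale_sum r K (s X)"
      unfolding scale_sum_def
    proof (intro sum_mono mult_left_mono)
      fix k
      have "s X \<le> (1/2) ^ k" if "X \<in> S k"
        using s[of "X - y" "(1/2) ^ k / C0"] that True C0 by (simp add: S_def T_def slab_def)
      then have "2 ^ k * s X \<le> 2 ^ k * (1/2) ^ k" if "X \<in> S k"
        using that by (intro mult_left_mono) auto
      then have "2 ^ k * s X \<le> 1" if "X \<in> S k" using that by (simp add: power_divide)
      then show "indicator (S k) X \<le> bump (2 ^ k * s X)"
        by (auto simp: indicator_def bump_simps)
    qed auto
    also have "\<dots> \<le> g X" using g(2)[of "X - y"] True by simp
    finally have "ennreal (\<Sum>k=1..K. 2 ^ (k * r) * indicator (S k) X) \<le> ennreal (g X)"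
      by (rule ennreal_leI)
    moreover have "ennreal (\<Sum>k=1..K. 2 ^ (k * r) * indicator (S k) X)
        = (\<Sum>k=1..K. ennreal (2 ^ (k * r)) * indicator (S k) X)"
      by (subst sum_ennreal[symmetric]) (auto simp: ennreal_mult ennreal_indicator)
    ultimately show ?thesis by simp
  next
    case False
    then have "X \<notin> S k" for k by (auto simp: S_def T_def slab_def)
    then show ?thesis by simp
  qed
  have "ennreal (real K * (c / C0 ^ r)) = (\<Sum>k=1..K. ennreal (2 ^ (k * r) * (c * ((1/2) ^ k / C0) ^ r)))"
  proof -
    have "2 ^ (k * r) * (c * ((1/2) ^ k / C0) ^ r) = c / C0 ^ r" for k
      by (simp add: power_divide power_mult power_mult_distrib)
    then show ?thesis using c C0 by (simp add: ennreal_mult[symmetric] ennreal_of_nat_eq_real_of_nat)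
  qed
  also have "\<dots> \<le> (\<Sum>k=1..K. ennreal (2 ^ (k * r)) * emeasure lborel (S k))"
    using c C0 Sk by (intro sum_mono) (simp add: ennreal_mult mult_left_mono)
  also have "\<dots> = (\<integral>\<^sup>+X. (\<Sum>k=1..K. ennreal (2 ^ (k * r)) * indicator (S k) X) \<partial>lborel)"
    using S by (subst nn_integral_sum) (auto simp: nn_integral_cmult_indicator)
  also have "\<dots> \<le> (\<integral>\<^sup>+X. ennreal (g X) \<partial>lborel)"
    by (intro nn_integral_mono pt)
  finally show ?thesis .
qed

lemma local_surface_patch:
  fixes S :: "'a::euclidean_space set" and chi :: "'a \<Rightarrow> real"
  assumes S: "C1_submanifold TYPE('k::finite) S" "surface_measure TYPE('k) S \<sigma>" and w1: "w1 \<in> S"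
    and chi: "continuous_on UNIV chi" "0 < chi w1"
  shows "\<exists>r1>0. emeasure \<sigma> (S \<inter> ball w1 r1) < \<infinity> \<and> (\<forall>w\<in>ball w1 r1. chi w1 / 2 \<le> chi w)"
proof -
  obtain r where r: "0 < r" "emeasure \<sigma> (S \<inter> ball w1 r) < \<infinity>"
    using surface_measure_locally_finite[OF S w1] by blast
  have "isCont chi w1" using chi(1) by (simp add: continuous_on_eq_continuous_at)
  then have "eventually (\<lambda>w. chi w \<in> {chi w1 / 2<..}) (nhds w1)"
    using chi(2) by (intro isCont_eventually_ball) auto
  then obtain e where e: "0 < e" "\<And>w. dist w w1 < e \<Longrightarrow> chi w1 / 2 < chi w"
    unfolding eventually_nhds_metric by auto
  have "emeasure \<sigma> (S \<inter> ball w1 (min r e)) \<le> emeasure \<sigma> (S \<inter> ball w1 r)"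
    by (intro emeasure_mono surface_measure_ball_sets[OF S(2)]) auto
  then have "emeasure \<sigma> (S \<inter> ball w1 (min r e)) < \<infinity>" using r by auto
  moreover have "\<forall>w\<in>ball w1 (min r e). chi w1 / 2 \<le> chi w"
    using e(2) by (auto simp: dist_commute less_imp_le)
  ultimately show ?thesis using r e by (intro exI[of _ "min r e"]) auto
qed

lemma transport_measurable:
  fixes br :: "'a::euclidean_space \<times> 'b::euclidean_space \<Rightarrow> 'a \<times> 'b \<Rightarrow> 'a \<times> 'b"
    and \<Lambda> :: "'a \<Rightarrow>\<^sub>L 'b" and F :: "'a \<times> 'b \<Rightarrow> real" and T :: "'a \<times> 'b \<Rightarrow> real"
  assumes br: "two_step_bracket br" and F: "F \<in> borel_measurable borel" and T: "T \<in> borel_measurable borel"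
  shows "(\<lambda>p. F (fst (fst p) - T (fst p) *\<^sub>R snd p,
      snd (fst p) - (T (fst p) / 2) *\<^sub>R layer_bracket br (fst (fst p)) (snd p) - (T (fst p))\<^sup>2 *\<^sub>R \<Lambda> (snd p)))
    \<in> borel_measurable borel"
proof -
  have bb: "bounded_bilinear (layer_bracket br)"
    using layer_bracket_bilinear[OF br] by (simp add: bilinear_conv_bounded_bilinear)
  have m1: "(\<lambda>p::('a \<times> 'b) \<times> 'a. layer_bracket br (fst (fst p)) (snd p)) \<in> borel_measurable borel"
    by (intro borel_measurable_continuous_onI bounded_bilinear.continuous_on[OF bb] continuous_intros)
  have m2: "(\<lambda>p::('a \<times> 'b) \<times> 'a. \<Lambda> (snd p)) \<in> borel_measurable borel"
    by (intro borel_measurable_continuous_onI continuous_intros)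
  have m3: "(\<lambda>p::('a \<times> 'b) \<times> 'a. T (fst p)) \<in> borel_measurable borel"
    by (rule measurable_compose[OF _ T]) (intro borel_measurable_continuous_onI continuous_intros)
  have m4: "(\<lambda>p::('a \<times> 'b) \<times> 'a. fst (fst p)) \<in> borel_measurable borel"
    "(\<lambda>p::('a \<times> 'b) \<times> 'a. snd (fst p)) \<in> borel_measurable borel"
    "(\<lambda>p::('a \<times> 'b) \<times> 'a. snd p) \<in> borel_measurable borel"
    by (intro borel_measurable_continuous_onI continuous_intros)+
  note [measurable] = m1 m2 m3 m4
  show ?thesis
    by (rule measurable_compose[OF _ F]) measurable
qed


text \<open>
  The multiscale test functions \<open>F K\<close> have mean maximal function of size \<open>K\<close> on \<open>G\<close>, while the \<open>q\<close>-th power of their norm is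
  \<open>O(K)\<close>, and even \<open>O(1)\<close> if \<open>q = 1\<close>.
\<close>

lemma subcritical_maximal_op_unbounded:
  fixes br :: "'a::euclidean_space \<times> 'b::euclidean_space \<Rightarrow> 'a \<times> 'b \<Rightarrow> 'a \<times> 'b"
    and \<Lambda> :: "'a \<Rightarrow>\<^sub>L 'b" and \<theta> :: "'b \<Rightarrow>\<^sub>L real" and S :: "'a set"
  assumes br: "two_step_bracket br"
    and S: "C1_submanifold TYPE('k::finite) S" "surface_measure TYPE('k) S \<sigma>"
    and chi: "continuous_on UNIV chi" "\<And>w. 0 \<le> chi w" "\<And>w. chi w \<le> Kc"
    and ab: "0 < a" "a < b" and w1: "w1 \<in> S" "chi w1 \<noteq> 0" "\<theta> (\<Lambda> w1) \<noteq> 0"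
    and V: "dim (V_space br \<Lambda> \<theta>) = r" "1 \<le> r" and q: "1 \<le> q" "q * real r \<le> real r + 1"
    and bdd: "maximal_op_bounded br \<Lambda> \<sigma> chi {a..b} (ennreal q)"
  shows False
proof -
  have chi1: "0 < chi w1" using w1 chi(2)[of w1] by simp
  obtain r1 where r1: "0 < r1" "emeasure \<sigma> (S \<inter> ball w1 r1) < \<infinity>"
    "\<And>w. w \<in> ball w1 r1 \<Longrightarrow> chi w1 / 2 \<le> chi w"
    using local_surface_patch[OF S w1(1) chi(1) chi1] by blast
  \<comment> \<open>The cutoff at radius \<open>4 * \<epsilon>\<close> then localizes \<open>w\<close> to the ball of radius \<open>6 * \<epsilon> / a = r1\<close> around \<open>w1\<close>.\<close>
  define \<epsilon> where "\<epsilon> = a * r1 / 6"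
  have \<epsilon>: "0 < \<epsilon>" "6 * \<epsilon> / a = r1" using ab r1 by (auto simp: \<epsilon>_def)
  have r0: "0 < r" using V(2) by simp
  obtain B E where B: "finite B" "card B = r"
    and E': "\<forall>l\<in>B. \<forall>m\<in>B. blinfun_apply l (E m) = (if l = m then 1 else 0)"
    and coord': "\<forall>v\<in>V_space br \<Lambda> \<theta>. \<forall>z. blinfun_apply v z = (\<Sum>l\<in>B. blinfun_apply v (E l) * blinfun_apply l z)"
    using functional_coordinates[OF V_space_subspace[OF br] V(1) r0] by (elim exE conjE) (rule that)
  note E = E'[rule_format]
  let ?n = "\<lambda>z::'a \<times> 'b. (\<Sum>l\<in>B. \<bar>blinfun_apply l (fst z)\<bar>) + \<bar>\<theta> (snd z)\<bar>"
  let ?W = "\<lambda>X U t w. U - (t/2) *\<^sub>R layer_bracket br X w - t\<^sup>2 *\<^sub>R \<Lambda> w"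
  define T where "T x = \<theta> (snd x) / \<theta> (\<Lambda> (fst x))" for x :: "'a \<times> 'b"
  obtain X1 U1 d \<rho> C0 where d: "0 < d" and \<rho>: "0 < \<rho>" "\<rho> \<le> d" and C0: "1 \<le> C0"
    and near': "\<forall>X\<in>ball X1 d. \<forall>U\<in>ball U1 d.
       a \<le> T (X, U) \<and> T (X, U) \<le> b \<and> norm (X - T (X, U) *\<^sub>R w1) \<le> \<epsilon>"
    and far: "\<forall>w\<in>ball w1 \<rho>. \<forall>U\<in>ball U1 \<rho>. \<exists>\<tau>. \<forall>v \<delta>. norm v \<le> \<rho> \<longrightarrow> 0 \<le> \<delta> \<longrightarrow> (\<forall>l\<in>B. \<bar>blinfun_apply l v\<bar> \<le> \<delta>) \<longrightarrow>
       (\<forall>X t. X = \<tau> *\<^sub>R w + v \<longrightarrow> t = T (X, U) \<longrightarrow> X \<in> ball X1 d \<and> ?n (X - t *\<^sub>R w, ?W X U t w) \<le> C0 * \<delta>)"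
    using transport_geometry[OF br ab w1(3) B(1) coord' \<epsilon>(1)] unfolding T_def fst_conv snd_conv
    by (elim exE conjE) (rule that[unfolded T_def fst_conv snd_conv])
  note near = near'[rule_format]
  define \<rho>' where "\<rho>' = min \<rho> (min (\<epsilon> / b) r1)"
  have \<rho>': "0 < \<rho>'" "\<rho>' \<le> \<rho>" "\<rho>' \<le> \<epsilon> / b" "\<rho>' \<le> r1"
    using \<rho> \<epsilon> ab r1 by (auto simp: \<rho>'_def)
  define P where "P = norm X1 + norm U1 + norm w1 + d + r1"
  obtain R where R: "0 < R" "\<And>X U w t. norm X \<le> P \<Longrightarrow> norm U \<le> P \<Longrightarrow> norm w \<le> P \<Longrightarrow> 0 \<le> t \<Longrightarrow> t \<le> b \<Longrightarrow> norm (?W X U t w) \<le> R"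
    using second_layer_bound[OF br, of P b \<Lambda>] by blast
  have ball_norm: "norm x \<le> norm y + e" if "x \<in> ball y e" for x y :: "'c::real_normed_vector" and e
    using that norm_triangle_ineq2[of x y] by (simp add: dist_norm norm_minus_commute)
  define F where "F K z = cutoff \<epsilon> R z * scale_sum r K (?n z)" for K z
  have F0: "0 \<le> F K z" for K z unfolding F_def by (intro mult_nonneg_nonneg cutoff_range scale_sum_nonneg)
  have Fle: "F K z \<le> (\<Sum>k=1..K. 2 ^ (k * r))" for K z
    unfolding F_def using cutoff_range[of \<epsilon> R z] scale_sum_le scale_sum_nonneg
    by (meson mult_left_le_one_le order.trans)
  have Fcont: "continuous_on UNIV (F K)" for K
    unfolding F_def by (intro continuous_intros continuous_on_cutoff continuous_on_scale_sum \<epsilon> R)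
  have Fcs: "compactly_supported (F K)" for K
    unfolding F_def by (rule compactly_supported_cutoff[OF \<epsilon>(1) R(1)])
  define G where "G = ball X1 d \<times> ball U1 d"
  have Gopen: "open G" unfolding G_def by (intro open_Times) auto
  have "bounded G" unfolding G_def by (intro bounded_Times) auto
  then have Gfin: "emeasure lborel G < \<infinity>" by (rule emeasure_bounded_finite)
  have Gsets: "G \<in> sets lborel" using Gopen by simp
  define A where "A = S \<inter> ball w1 r1"
  define \<sigma>A where "\<sigma>A = restrict_space \<sigma> A"
  have \<sigma>: "space \<sigma> = S" "sets \<sigma> = sets (restrict_space borel S)"
    using S(2) by (auto simp: surface_measure_def)
  have A: "A \<in> sets \<sigma>" unfolding A_def by (intro surface_measure_ball_sets[OF S(2)]) auto
  have AS: "A \<inter> space \<sigma> \<in> sets \<sigma>" using A by (simp add: sets.Int_space_eq2)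
  have spA: "space \<sigma>A = A" using A \<sigma>(1) sets.sets_into_space[OF A] by (auto simp: \<sigma>A_def space_restrict_space)
  interpret \<sigma>A: finite_measure \<sigma>A
  proof (rule finite_measureI)
    have "emeasure \<sigma>A A = emeasure \<sigma> A"
      unfolding \<sigma>A_def by (rule emeasure_restrict_space[OF AS subset_refl])
    also have "\<dots> \<noteq> \<infinity>" using r1(2) unfolding A_def by (rule less_imp_neq)
    finally show "emeasure \<sigma>A (space \<sigma>A) \<noteq> \<infinity>" unfolding spA .
  qed
  have id\<sigma>A: "(\<lambda>w. w) \<in> measurable \<sigma>A borel"
  proof -
    have eq: "measurable \<sigma> (borel :: 'a measure) = measurable (restrict_space borel S) borel"
      by (rule measurable_cong_sets[OF \<sigma>(2) refl])
    have "(\<lambda>w. w) \<in> measurable \<sigma> borel"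
      unfolding eq by (rule measurable_restrict_space1) simp
    then show ?thesis unfolding \<sigma>A_def by (rule measurable_restrict_space1)
  qed
  interpret LA: pair_sigma_finite lborel \<sigma>A by standard
  define \<Phi> where "\<Phi> K x w = F K (fst x - T x *\<^sub>R w, ?W (fst x) (snd x) (T x) w)" for K x w
  have \<Phi>0: "0 \<le> \<Phi> K x w" for K x w by (simp add: \<Phi>_def F0)
  have Tm: "T \<in> borel_measurable borel"
    unfolding T_def by (intro borel_measurable_divide borel_measurable_continuous_onI continuous_intros)
  have \<Phi>m: "(\<lambda>p. \<Phi> K (fst p) (snd p)) \<in> borel_measurable borel" for K
    unfolding \<Phi>_def by (intro transport_measurable[OF br _ Tm] borel_measurable_continuous_onI Fcont)
  have Gm: "(indicator G :: 'a \<times> 'b \<Rightarrow> real) \<in> borel_measurable borel"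
    using Gopen by (intro borel_measurable_indicator) simp
  have G\<Phi>: "(\<lambda>x. ennreal (indicator G x * \<Phi> K x w)) \<in> borel_measurable borel" for K w
  proof -
    have "(\<lambda>x. (x, w)) \<in> measurable (borel :: ('a \<times> 'b) measure) borel"
      by (intro borel_measurable_continuous_onI continuous_intros)
    from measurable_compose[OF this \<Phi>m[of K]] have "(\<lambda>x. \<Phi> K x w) \<in> borel_measurable borel"
      by (simp only: fst_conv snd_conv)
    then show ?thesis
      by (intro measurable_compose[OF _ measurable_ennreal] borel_measurable_times Gm)
  qed
  define \<Psi> where "\<Psi> K x w = ennreal (indicator G x * (chi w * \<Phi> K x w))" for K x w
  have \<Psi>m: "case_prod (\<Psi> K) \<in> borel_measurable (lborel \<Otimes>\<^sub>M \<sigma>A)" for K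
  proof -
    have chim: "chi \<in> borel_measurable borel" using chi(1) by (rule borel_measurable_continuous_onI)
    have m1: "(\<lambda>p::('a \<times> 'b) \<times> 'a. indicator G (fst p) :: real) \<in> borel_measurable borel"
      by (rule measurable_compose[OF _ Gm]) (intro borel_measurable_continuous_onI continuous_intros)
    have m2: "(\<lambda>p::('a \<times> 'b) \<times> 'a. chi (snd p)) \<in> borel_measurable borel"
      by (rule measurable_compose[OF _ chim]) (intro borel_measurable_continuous_onI continuous_intros)
    have m: "(\<lambda>p. ennreal (indicator G (fst p) * (chi (snd p) * \<Phi> K (fst p) (snd p)))) \<in> borel_measurable borel"
      by (intro measurable_compose[OF _ measurable_ennreal] borel_measurable_times m1 m2 \<Phi>m)
    have "(\<lambda>p. (fst p, snd p)) \<in> measurable (lborel \<Otimes>\<^sub>M \<sigma>A) (borel \<Otimes>\<^sub>M borel)"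
      by (intro measurable_Pair measurable_compose[OF measurable_snd id\<sigma>A]) simp
    then have "(\<lambda>p. p) \<in> measurable (lborel \<Otimes>\<^sub>M \<sigma>A) (borel :: (('a \<times> 'b) \<times> 'a) measure)"
      by (simp add: borel_prod)
    from measurable_compose[OF this m] show ?thesis
      by (simp add: \<Psi>_def case_prod_beta')
  qed
  define h where "h K x = (\<integral>\<^sup>+w. \<Psi> K x w \<partial>\<sigma>A)" for K x
  have hm: "h K \<in> borel_measurable lborel" for K
    unfolding h_def using \<Psi>m by (rule \<sigma>A.borel_measurable_nn_integral)
  have hM: "h K x \<le> maximal_op br \<Lambda> \<sigma> chi {a..b} (\<lambda>z. complex_of_real (F K z)) x" if "x \<in> G" for K x
  proof -
    obtain X U where x: "x = (X, U)" "X \<in> ball X1 d" "U \<in> ball U1 d"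
      using \<open>x \<in> G\<close> by (auto simp: G_def)
    note nr = near[OF x(2,3)]
    have "h K x = (\<integral>\<^sup>+w\<in>A. ennreal (chi w * F K (X - T x *\<^sub>R w, ?W X U (T x) w)) \<partial>\<sigma>)"
      unfolding h_def \<sigma>A_def using A \<open>x \<in> G\<close> x(1)
      by (subst nn_integral_restrict_space) (auto simp: \<Psi>_def \<Phi>_def intro!: sets.Int)
    also have "\<dots> = ennreal (norm (conv_mu br \<Lambda> \<sigma> chi (T x) (\<lambda>z. complex_of_real (F K z)) (X, U)))"
    proof (rule conv_mu_nn_integral[symmetric, OF br \<sigma>(2,1) A _ chi Fcont F0 Fle])
      show "emeasure \<sigma> A < \<infinity>" using r1 by (simp add: A_def)
      fix w assume w: "w \<in> S" "w \<notin> A"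
      show "F K (X - T x *\<^sub>R w, ?W X U (T x) w) = 0"
      proof (rule ccontr)
        assume "F K (X - T x *\<^sub>R w, ?W X U (T x) w) \<noteq> 0"
        then have "cutoff \<epsilon> R (X - T x *\<^sub>R w, ?W X U (T x) w) \<noteq> 0" by (auto simp: F_def)
        from cutoff_support(1)[OF this \<epsilon>(1) R(1)] have "norm (X - T x *\<^sub>R w) < 4 * \<epsilon>" by simp
        then have "w \<in> ball w1 (6 * \<epsilon> / a)"
          using localization(1)[OF ab(1) _ _ \<epsilon>(1), of "T x" b X w1 w] nr x(1) by simp
        then show False using w \<epsilon>(2) by (simp add: A_def)
      qed
    qed
    also have "\<dots> \<le> maximal_op br \<Lambda> \<sigma> chi {a..b} (\<lambda>z. complex_of_real (F K z)) x"
      unfolding x(1) using nr by (intro maximal_op_lower) simp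
    finally show ?thesis .
  qed
  have "\<exists>c>0. \<forall>e. 0 < e \<longrightarrow> e \<le> 1 \<longrightarrow>
       ennreal (c * e ^ card B) \<le> emeasure lborel (slab B blinfun_apply (\<lambda>_. 0) (\<lambda>_. e) \<rho>)"
    by (rule slab_measure_lower[where e=E])
      (intro B(1) \<rho>(1) bounded_linear.linear blinfun.bounded_linear_right E; assumption)+
  then obtain c where c: "0 < c" "\<forall>e. 0 < e \<longrightarrow> e \<le> 1 \<longrightarrow>
       ennreal (c * e ^ r) \<le> emeasure lborel (slab B blinfun_apply (\<lambda>_. 0) (\<lambda>_. e) \<rho>)"
    unfolding B(2) by (elim exE conjE) (rule that)
  define v where "v = measure lborel (ball U1 \<rho>)"
  have v: "0 < v" "emeasure lborel (ball U1 \<rho>) = ennreal v"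
    using content_ball_pos[OF \<rho>(1), of U1] emeasure_lborel_ball_finite[of U1 \<rho>]
    by (auto simp: v_def intro!: emeasure_eq_ennreal_measure)
  \<comment> \<open>The mean over \<open>G\<close> for a fixed surface point. Tonelli reduces the mean of \<open>h K\<close> to these.\<close>
  have fiber: "ennreal (real K * (c / C0 ^ r)) * ennreal v \<le> (\<integral>\<^sup>+x. ennreal (indicator G x * \<Phi> K x w) \<partial>lborel)"
    if w: "w \<in> ball w1 \<rho>'" for K w
  proof -
    have inner: "ennreal (real K * (c / C0 ^ r)) \<le> (\<integral>\<^sup>+X. ennreal (indicator G (X, U) * \<Phi> K (X, U) w) \<partial>lborel)"
      if U: "U \<in> ball U1 \<rho>" for U
    proof -
      have wr: "w \<in> ball w1 \<rho>" using w \<rho>' by auto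
      obtain \<tau> where "\<forall>v \<delta>. norm v \<le> \<rho> \<longrightarrow> 0 \<le> \<delta> \<longrightarrow> (\<forall>l\<in>B. \<bar>blinfun_apply l v\<bar> \<le> \<delta>) \<longrightarrow>
          (\<forall>X t. X = \<tau> *\<^sub>R w + v \<longrightarrow> t = T (X, U) \<longrightarrow> X \<in> ball X1 d \<and> ?n (X - t *\<^sub>R w, ?W X U t w) \<le> C0 * \<delta>)"
        using bspec[OF bspec[OF far wr] U] by (elim exE) (rule that)
      note \<tau> = this[rule_format]
      define s where "s X = ?n (X - T (X, U) *\<^sub>R w, ?W X U (T (X, U)) w)" for X
      \<comment> \<open>For this \<open>U\<close> the bumps live near \<open>X = \<tau> w\<close>.\<close>
      have Ud: "U \<in> ball U1 d" using U \<rho> by auto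
      show ?thesis
      proof (rule transported_slab_integral[where s=s and y="\<tau> *\<^sub>R w", OF B(1) C0 less_imp_le[OF c(1)] c(2)[rule_format]])
        show "0 \<le> indicator G (X, U) * \<Phi> K (X, U) w" for X using \<Phi>0 by simp
        show "s (\<tau> *\<^sub>R w + v) \<le> C0 * \<delta>" if "norm v \<le> \<rho>" "0 \<le> \<delta>" "\<And>l. l \<in> B \<Longrightarrow> \<bar>blinfun_apply l v\<bar> \<le> \<delta>" for v \<delta>
          using \<tau>[OF that refl refl] by (simp add: s_def)
        show "scale_sum r K (s (\<tau> *\<^sub>R w + v)) \<le> indicator G (\<tau> *\<^sub>R w + v, U) * \<Phi> K (\<tau> *\<^sub>R w + v, U) w"
          if v: "norm v \<le> \<rho>" for v
        proof -
          let ?X = "\<tau> *\<^sub>R w + v"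
          have "\<bar>blinfun_apply l v\<bar> \<le> (\<Sum>l\<in>B. \<bar>blinfun_apply l v\<bar>)" if "l \<in> B" for l
            using that B by (intro member_le_sum) auto
          then have XB: "?X \<in> ball X1 d"
            using \<tau>[OF v _ _ refl refl, of "\<Sum>l\<in>B. \<bar>blinfun_apply l v\<bar>"] by (simp add: sum_nonneg)
          note nr = near[OF XB Ud]
          have "norm (?X - T (?X, U) *\<^sub>R w) \<le> 2 * \<epsilon>"
          proof -
            have "w \<in> ball w1 (\<epsilon> / b)" using w \<rho>'(3) by auto
            then show ?thesis
              using localization(2)[OF ab(1) _ _ \<epsilon>(1), of "T (?X, U)" b ?X w1 w] nr by blast
          qed
          moreover have "norm (?W ?X U (T (?X, U)) w) \<le> R"
          proof (rule R(2))
            show "norm ?X \<le> P" unfolding P_def using ball_norm[OF XB] r1(1) norm_ge_zero[of U1] norm_ge_zero[of w1] by linarith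
            show "norm U \<le> P" unfolding P_def using ball_norm[OF Ud] r1(1) norm_ge_zero[of X1] norm_ge_zero[of w1] by linarith
            have "w \<in> ball w1 r1" using w \<rho>' by auto
            then show "norm w \<le> P"
              unfolding P_def using ball_norm[of w w1 r1] d norm_ge_zero[of X1] norm_ge_zero[of U1] by linarith
          qed (use nr ab in auto)
          ultimately have "cutoff \<epsilon> R (?X - T (?X, U) *\<^sub>R w, ?W ?X U (T (?X, U)) w) = 1"
            by (intro cutoff_one \<epsilon>(1) R(1))
          moreover have "(?X, U) \<in> G" using XB Ud by (simp add: G_def)
          ultimately show ?thesis by (simp add: \<Phi>_def F_def s_def)
        qed
      qed
    qed
    have m: "(\<lambda>x. ennreal (indicator G x * \<Phi> K x w)) \<in> borel_measurable (lborel \<Otimes>\<^sub>M lborel)"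
      unfolding lborel_prod using G\<Phi>[of K w] by simp
    have "ennreal (real K * (c / C0 ^ r)) * ennreal v
       = (\<integral>\<^sup>+U\<in>ball U1 \<rho>. ennreal (real K * (c / C0 ^ r)) \<partial>lborel)"
      using v(2) by (simp add: nn_integral_cmult_indicator)
    also have "\<dots> \<le> (\<integral>\<^sup>+U. (\<integral>\<^sup>+X. ennreal (indicator G (X, U) * \<Phi> K (X, U) w) \<partial>lborel) \<partial>lborel)"
      using inner by (intro nn_integral_mono) (simp add: indicator_def)
    also have "\<dots> = (\<integral>\<^sup>+x. ennreal (indicator G x * \<Phi> K x w) \<partial>(lborel \<Otimes>\<^sub>M lborel))"
      by (rule lborel_pair.nn_integral_snd[OF m])
    finally show ?thesis by (simp add: lborel_prod)
  qed
  define \<kappa> where "\<kappa> = measure \<sigma> (S \<inter> ball w1 \<rho>')"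
  have sub: "S \<inter> ball w1 \<rho>' \<subseteq> A" using \<rho>' by (auto simp: A_def)
  have pm: "S \<inter> ball w1 \<rho>' \<in> sets \<sigma>" by (intro surface_measure_ball_sets[OF S(2)]) auto
  have \<kappa>: "0 < \<kappa>" "emeasure \<sigma> (S \<inter> ball w1 \<rho>') = ennreal \<kappa>"
  proof -
    have "emeasure \<sigma> (S \<inter> ball w1 \<rho>') \<le> emeasure \<sigma> A" using sub A by (intro emeasure_mono)
    also have "\<dots> < \<infinity>" using r1(2) by (simp add: A_def)
    finally show 1: "emeasure \<sigma> (S \<inter> ball w1 \<rho>') = ennreal \<kappa>"
      by (auto simp: \<kappa>_def less_top intro!: emeasure_eq_ennreal_measure)
    show "0 < \<kappa>" using surface_measure_ball_pos[OF S w1(1) \<rho>'(1)] unfolding 1 by simp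
  qed
  define m where "m = chi w1 / 2 * (c / C0 ^ r) * v * \<kappa>"
  have m0: "0 < m" using chi1 c C0 v \<kappa> by (simp add: m_def)
  have big: "ennreal (real K * m) \<le> (\<integral>\<^sup>+x\<in>G. h K x \<partial>lborel)" for K
  proof -
    have "ennreal (real K * m) = ennreal (chi w1 / 2) * (ennreal (real K * (c / C0 ^ r)) * ennreal v) * ennreal \<kappa>"
      using chi1 c C0 v \<kappa> by (simp add: m_def ennreal_mult[symmetric] mult_ac)
    also have "\<dots> = (\<integral>\<^sup>+w. ennreal (chi w1 / 2) * (ennreal (real K * (c / C0 ^ r)) * ennreal v) * indicator (S \<inter> ball w1 \<rho>') w \<partial>\<sigma>A)"
    proof -
      have "S \<inter> ball w1 \<rho>' \<in> sets \<sigma>A" "emeasure \<sigma>A (S \<inter> ball w1 \<rho>') = ennreal \<kappa>"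
        unfolding \<sigma>A_def sets_restrict_space_iff[OF AS] emeasure_restrict_space[OF AS sub] \<kappa>(2)
        using pm sub by simp_all
      then show ?thesis by (simp add: nn_integral_cmult_indicator)
    qed
    also have "\<dots> \<le> (\<integral>\<^sup>+w. (\<integral>\<^sup>+x. \<Psi> K x w \<partial>lborel) \<partial>\<sigma>A)"
    proof (intro nn_integral_mono)
      fix w
      show "ennreal (chi w1 / 2) * (ennreal (real K * (c / C0 ^ r)) * ennreal v) * indicator (S \<inter> ball w1 \<rho>') w
        \<le> (\<integral>\<^sup>+x. \<Psi> K x w \<partial>lborel)"
      proof (cases "w \<in> S \<inter> ball w1 \<rho>'")
        case True
        then have w: "w \<in> ball w1 \<rho>'" "w \<in> ball w1 r1" using \<rho>' by auto
        have "ennreal (chi w1 / 2) * (ennreal (real K * (c / C0 ^ r)) * ennreal v)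
          \<le> ennreal (chi w) * (\<integral>\<^sup>+x. ennreal (indicator G x * \<Phi> K x w) \<partial>lborel)"
          using r1(3)[OF w(2)] by (intro mult_mono fiber[OF w(1)] ennreal_leI) auto
        also have "\<dots> = (\<integral>\<^sup>+x. \<Psi> K x w \<partial>lborel)"
        proof -
          have "(\<lambda>x. ennreal (indicator G x * \<Phi> K x w)) \<in> borel_measurable lborel"
            using G\<Phi>[of K w] by simp
          then have "ennreal (chi w) * (\<integral>\<^sup>+x. ennreal (indicator G x * \<Phi> K x w) \<partial>lborel)
             = (\<integral>\<^sup>+x. ennreal (chi w) * ennreal (indicator G x * \<Phi> K x w) \<partial>lborel)"
            by (rule nn_integral_cmult[symmetric])
          also have "\<dots> = (\<integral>\<^sup>+x. \<Psi> K x w \<partial>lborel)"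
            using chi(2) \<Phi>0 by (intro nn_integral_cong) (simp add: \<Psi>_def ennreal_mult[symmetric] mult_ac)
          finally show ?thesis .
        qed
        finally show ?thesis using True by simp
      qed simp
    qed
    also have "\<dots> = (\<integral>\<^sup>+x. h K x \<partial>lborel)"
      unfolding h_def by (rule LA.Fubini'[OF \<Psi>m[of K]])
    also have "\<dots> = (\<integral>\<^sup>+x\<in>G. h K x \<partial>lborel)"
    proof (intro nn_integral_cong)
      fix x
      show "h K x = h K x * indicator G x"
      proof (cases "x \<in> G")
        case False
        then have "\<Psi> K x w = 0" for w by (simp add: \<Psi>_def)
        then show ?thesis by (simp add: h_def)
      qed simp
    qed
    finally show ?thesis .
  qed
  obtain C where C: "0 \<le> C" and test': "\<forall>F A m h. continuous_on UNIV F \<longrightarrow> compactly_supported F \<longrightarrow> (\<forall>z. 0 \<le> F z) \<longrightarrow>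
    0 \<le> A \<longrightarrow> 0 \<le> m \<longrightarrow> (\<integral>\<^sup>+z. ennreal (F z powr q) \<partial>lborel) \<le> ennreal A \<longrightarrow>
    h \<in> borel_measurable lborel \<longrightarrow>
    (\<forall>x\<in>G. h x \<le> maximal_op br \<Lambda> \<sigma> chi {a..b} (\<lambda>z. complex_of_real (F z)) x) \<longrightarrow>
    ennreal m \<le> (\<integral>\<^sup>+x\<in>G. h x \<partial>lborel) \<longrightarrow> m powr q \<le> C * A"
    using maximal_op_bounded_test[OF bdd q(1) Gsets Gfin] by (elim exE conjE) (rule that)
  note test = test'[rule_format]
  have U0: "\<theta> ((1 / \<theta> (\<Lambda> w1)) *\<^sub>R \<Lambda> w1) = 1" using w1(3) by (simp add: blinfun.scaleR_right)
  have "\<exists>M\<ge>0. \<forall>K. (\<integral>\<^sup>+z. ennreal (F K z powr q) \<partial>lborel) \<le> ennreal (M * (if q = 1 then 1 else real K))"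
    unfolding F_def
    by (rule test_function_norm[where E=E, OF B V(2) _ U0 q \<epsilon>(1) R(1)]) (rule E)
  then obtain M where M: "0 \<le> M" "\<forall>K. (\<integral>\<^sup>+z. ennreal (F K z powr q) \<partial>lborel) \<le> ennreal (M * (if q = 1 then 1 else real K))"
    by (elim exE conjE) (rule that)
  have "(real K * m) powr q \<le> (C * M) * (if q = 1 then 1 else real K)" for K
    unfolding mult.assoc by (rule test[OF Fcont Fcs F0 _ _ M(2)[rule_format] hm hM big]) (use M(1) m0 in auto)
  then show False
    by (rule powr_growth_contradiction[OF q(1) m0])
qed

section \<open>The rank one case\<close>

text \<open>
  In coordinates \<open>(lam, \<theta>)\<close> these sets are parallelograms of slope \<open>\<tau>\<close>. Their measure is of the order of \<open>d1 * d2\<close>,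
  uniformly in bounded \<open>\<tau>\<close>, because the dual vector \<open>(E1, \<tau> *\<^sub>R E2)\<close> of \<open>lam\<close> stays bounded.
\<close>

lemma parallelogram_measure:
  fixes lam :: "'a::euclidean_space \<Rightarrow>\<^sub>L real" and \<theta> :: "'b::euclidean_space \<Rightarrow>\<^sub>L real"
  assumes E: "lam E1 = 1" "\<theta> E2 = 1"
  shows "\<exists>M\<ge>0. \<forall>\<tau> c \<gamma> d1 d2. \<bar>\<tau>\<bar> \<le> b \<longrightarrow> 0 < d1 \<longrightarrow> d1 \<le> 1 \<longrightarrow> 0 < d2 \<longrightarrow> d2 \<le> 1 \<longrightarrow>
    emeasure lborel {z::'a \<times> 'b. norm z \<le> R \<and> \<bar>lam (fst z) - c\<bar> \<le> d1 \<and>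
       \<bar>\<theta> (snd z) - \<tau> * lam (fst z) - \<gamma>\<bar> \<le> d2} \<le> ennreal (M * (d1 * d2)) \<and>
    {z::'a \<times> 'b. norm z \<le> R \<and> \<bar>lam (fst z) - c\<bar> \<le> d1 \<and>
       \<bar>\<theta> (snd z) - \<tau> * lam (fst z) - \<gamma>\<bar> \<le> d2} \<in> sets borel"
proof -
  define Ke where "Ke = norm E1 + \<bar>b\<bar> * norm E2 + norm E2"
  define M where "M = measure lborel (cball (0 :: 'a \<times> 'b) (R + 3 * Ke * 2))"
  have M: "0 \<le> M" "emeasure lborel (cball (0 :: 'a \<times> 'b) (R + 3 * Ke * 2)) = ennreal M"
    using emeasure_lborel_cball_finite[of "0 :: 'a \<times> 'b" "R + 3 * Ke * 2"]
    by (auto simp: M_def intro!: emeasure_eq_ennreal_measure)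
  have "emeasure lborel {z::'a \<times> 'b. norm z \<le> R \<and> \<bar>lam (fst z) - c\<bar> \<le> d1 \<and>
       \<bar>\<theta> (snd z) - \<tau> * lam (fst z) - \<gamma>\<bar> \<le> d2} \<le> ennreal (M * (d1 * d2)) \<and>
    {z::'a \<times> 'b. norm z \<le> R \<and> \<bar>lam (fst z) - c\<bar> \<le> d1 \<and>
       \<bar>\<theta> (snd z) - \<tau> * lam (fst z) - \<gamma>\<bar> \<le> d2} \<in> sets borel"
    if \<tau>: "\<bar>\<tau>\<bar> \<le> b" and d: "0 < d1" "d1 \<le> 1" "0 < d2" "d2 \<le> 1" for \<tau> c \<gamma> d1 d2
  proof -
    define l where "l i z = (if i then lam (fst z) else \<theta> (snd z) - \<tau> * lam (fst z))"
      for i and z :: "'a \<times> 'b"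
    define e where "e i = (if i then (E1, \<tau> *\<^sub>R E2) else (0, E2))" for i
    define k where "k i = (if i then c else \<gamma>)" for i
    define \<delta> where "\<delta> i = (if i then d1 else d2)" for i
    let ?S = "slab UNIV l k \<delta> R"
    have lin: "linear (l i)" for i
      by (cases i) (auto simp: l_def linear_iff blinfun.add_right blinfun.scaleR_right algebra_simps)
    have eq: "?S = {z::'a \<times> 'b. norm z \<le> R \<and> \<bar>lam (fst z) - c\<bar> \<le> d1 \<and>
       \<bar>\<theta> (snd z) - \<tau> * lam (fst z) - \<gamma>\<bar> \<le> d2}"
      unfolding slab_def by (auto simp: UNIV_bool l_def k_def \<delta>_def)
    have "emeasure lborel ?S \<le> ennreal (\<Prod>i\<in>UNIV. \<delta> i) * emeasure lborel (cball (0 :: 'a \<times> 'b) (R + 3 * Ke * card (UNIV :: bool set)))"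
    proof (rule slab_measure_upper[where e=e])
      show "l i (e j) = (if i = j then 1 else 0)" for i j
        by (cases i; cases j) (auto simp: l_def e_def E blinfun.zero_right blinfun.scaleR_right)
      have "norm (E1, \<tau> *\<^sub>R E2) \<le> norm E1 + \<bar>b\<bar> * norm E2"
        using \<tau> by (intro order.trans[OF norm_Pair_le] add_left_mono) (auto intro!: mult_right_mono)
      moreover have "norm (0 :: 'a, E2) \<le> norm E2" using norm_Pair_le[of "0::'a" E2] by simp
      moreover have "0 \<le> \<bar>b\<bar> * norm E2" by simp
      ultimately have "norm (e True) \<le> Ke" "norm (e False) \<le> Ke"
        using norm_ge_zero[of E1] norm_ge_zero[of E2] unfolding Ke_def e_def if_True if_False by linarith+
      then show "norm (e i) \<le> Ke" for i by (cases i) simp_all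
      show "0 < \<delta> i" "\<delta> i \<le> 1" for i using d by (auto simp: \<delta>_def)
    qed (auto intro: lin)
    also have "\<dots> = ennreal (M * (d1 * d2))"
      using d M by (simp add: UNIV_bool \<delta>_def ennreal_mult[symmetric] mult_ac)
    finally have "emeasure lborel ?S \<le> ennreal (M * (d1 * d2))" .
    moreover have "?S \<in> sets borel" using lin by (intro slab_borel) auto
    ultimately show ?thesis unfolding eq by (rule conjI)
  qed
  then show ?thesis using M(1) by blast
qed

text \<open>
  On the whole ball \<open>G\<close> the maximal function of the function attached to a thin line family is at least \<open>m\<close>: a point
  of \<open>G\<close> picks the line of the family through it, and the slope of that line determines \<open>t\<close>. The norms of these functions
  tend to 0. The lines have slopes \<open>a + fst s\<close> with \<open>0 \<le> fst s \<le> \<kappa>\<close>, so heights are measured from \<open>a * lam\<close>.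
\<close>

lemma rank_one_maximal_op_unbounded:
  fixes br :: "'a::euclidean_space \<times> 'b::euclidean_space \<Rightarrow> 'a \<times> 'b \<Rightarrow> 'a \<times> 'b"
    and \<Lambda> :: "'a \<Rightarrow>\<^sub>L 'b" and \<theta> :: "'b \<Rightarrow>\<^sub>L real" and S :: "'a set"
  assumes br: "two_step_bracket br"
    and S: "C1_submanifold TYPE('k::finite) S" "surface_measure TYPE('k) S \<sigma>"
    and chi: "continuous_on UNIV chi" "\<And>w. 0 \<le> chi w" "\<And>w. chi w \<le> Kc"
    and ab: "0 < a" "a < b" and w1: "w1 \<in> S" "chi w1 \<noteq> 0" "0 < \<theta> (\<Lambda> w1)"
    and J0: "\<And>X. J_map br \<theta> X = 0" and q: "1 \<le> q"
    and bdd: "maximal_op_bounded br \<Lambda> \<sigma> chi {a..b} (ennreal q)"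
  shows False
proof -
  define lam where "lam = \<theta> o\<^sub>L \<Lambda>"
  have lam: "\<theta> (\<Lambda> X) = lam X" for X by (simp add: lam_def)
  define s1 where "s1 = lam w1"
  have s1: "0 < s1" using w1(3) by (simp add: s1_def lam)
  have nl: "0 < norm lam" using s1 by (auto simp: s1_def)
  have chi1: "0 < chi w1" using w1 chi(2)[of w1] by simp
  obtain r1 where r1: "0 < r1" "emeasure \<sigma> (S \<inter> ball w1 r1) < \<infinity>"
    "\<And>w. w \<in> ball w1 r1 \<Longrightarrow> chi w1 / 2 \<le> chi w"
    using local_surface_patch[OF S w1(1) chi(1) chi1] by blast
  \<comment> \<open>The first bound localizes \<open>w\<close> to the ball of radius \<open>r1\<close> around \<open>w1\<close>, the second makes \<open>lam Y\<close> small compared with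
    \<open>lam X\<close>, which is about \<open>a * s1\<close>.\<close>
  define \<epsilon> where "\<epsilon> = min (a * r1 / 6) (a * s1 / (16 * norm lam))"
  have \<epsilon>: "0 < \<epsilon>" using ab r1 s1 nl by (simp add: \<epsilon>_def)
  have \<epsilon>1: "6 * \<epsilon> / a \<le> r1"
  proof -
    have "6 * \<epsilon> \<le> r1 * a" by (simp add: \<epsilon>_def min_le_iff_disj mult.commute)
    then show ?thesis using ab by (simp add: pos_divide_le_eq)
  qed
  \<comment> \<open>On the support of the cutoff \<open>\<bar>lam Y\<bar> \<le> L\<close>, whereas \<open>lam X \<ge> 2 * L\<close> on \<open>G\<close>: the family is thin in the first range
    and covers in the second.\<close>
  define L where "L = a * s1 / 4"
  have L: "0 < L" using ab s1 by (simp add: L_def)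
  have \<epsilon>2: "norm lam * (4 * \<epsilon>) \<le> L"
  proof -
    have "\<epsilon> \<le> a * s1 / (16 * norm lam)" by (simp add: \<epsilon>_def)
    then have "\<epsilon> * (16 * norm lam) \<le> a * s1" using nl by (simp add: pos_le_divide_eq)
    then show ?thesis by (simp add: L_def mult_ac)
  qed
  \<comment> \<open>All times in \<open>{a..a + \<kappa>}\<close> must keep \<open>t w1\<close> close to \<open>a w1\<close>.\<close>
  define \<kappa> where "\<kappa> = min (b - a) (\<epsilon> / (2 * (norm w1 + 1)))"
  have \<kappa>: "0 < \<kappa>" "\<kappa> \<le> b - a" using ab \<epsilon> by (auto simp: \<kappa>_def add_nonneg_pos)
  have \<kappa>w: "\<kappa> * norm w1 \<le> \<epsilon> / 2"
  proof -
    have "\<kappa> \<le> \<epsilon> / (2 * (norm w1 + 1))" by (simp add: \<kappa>_def)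
    then have "\<kappa> * (2 * (norm w1 + 1)) \<le> \<epsilon>" by (simp add: pos_le_divide_eq add_nonneg_pos)
    then have "2 * (\<kappa> * norm w1) + 2 * \<kappa> \<le> \<epsilon>" by (simp add: algebra_simps)
    then show ?thesis using \<kappa>(1) by linarith
  qed
  define X1 where "X1 = a *\<^sub>R w1"
  \<comment> \<open>The centre of \<open>G\<close> has its height \<open>\<theta> U1 - a * lam X1\<close> in the middle of the interval \<open>{0..\<kappa> * L}\<close> of heights which
    the lines reach.\<close>
  define U1 where "U1 = (a\<^sup>2 + \<kappa> * L / (2 * s1)) *\<^sub>R \<Lambda> w1"
  have lX1: "lam X1 = a * s1" by (simp add: X1_def s1_def blinfun.scaleR_right)
  have tU1: "\<theta> U1 - a * lam X1 = \<kappa> * L / 2"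
    using s1 by (simp add: U1_def lX1 blinfun.scaleR_right lam s1_def[symmetric] distrib_right power2_eq_square)
  have "eventually (\<lambda>z. lam (fst z) \<in> {a * s1 / 2<..<2 * (a * s1)}) (nhds (X1, U1))"
    using lX1 ab s1 by (intro isCont_eventually_ball continuous_intros) auto
  moreover have "eventually (\<lambda>z. \<theta> (snd z) - a * lam (fst z) \<in> {0<..<\<kappa> * L}) (nhds (X1, U1))"
    using tU1 mult_pos_pos[OF \<kappa>(1) L] by (intro isCont_eventually_ball continuous_intros) auto
  moreover have "eventually (\<lambda>z. norm (fst z - a *\<^sub>R w1) \<in> {..<\<epsilon> / 2}) (nhds (X1, U1))"
    using \<epsilon> by (intro isCont_eventually_ball continuous_intros) (auto simp: X1_def)
  ultimately have "eventually (\<lambda>z. lam (fst z) \<in> {a * s1 / 2<..<2 * (a * s1)} \<and>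
      \<theta> (snd z) - a * lam (fst z) \<in> {0<..<\<kappa> * L} \<and> norm (fst z - a *\<^sub>R w1) \<in> {..<\<epsilon> / 2}) (nhds (X1, U1))"
    by eventually_elim blast
  then obtain d where d: "0 < d" "\<And>z. dist z (X1, U1) < d \<Longrightarrow> lam (fst z) \<in> {a * s1 / 2<..<2 * (a * s1)} \<and>
      \<theta> (snd z) - a * lam (fst z) \<in> {0<..<\<kappa> * L} \<and> norm (fst z - a *\<^sub>R w1) \<in> {..<\<epsilon> / 2}"
    unfolding eventually_nhds_metric by blast
  define G where "G = ball (X1, U1) d"
  have Gsets: "G \<in> sets lborel" by (simp add: G_def)
  have Gfin: "emeasure lborel G < \<infinity>" unfolding G_def by (rule emeasure_bounded_finite) simp
  define vG where "vG = measure lborel G"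
  have vG: "0 < vG" "emeasure lborel G = ennreal vG"
    using content_ball_pos[OF d(1), of "(X1, U1)"] Gfin
    by (auto simp: vG_def G_def less_top intro!: emeasure_eq_ennreal_measure)
  have GD: "a * s1 / 2 \<le> lam X" "lam X \<le> 2 * (a * s1)" "0 \<le> \<theta> U - a * lam X" "\<theta> U - a * lam X \<le> \<kappa> * L"
    "norm (X - a *\<^sub>R w1) \<le> \<epsilon> / 2" "norm X \<le> norm X1 + d" "norm U \<le> norm U1 + d"
    if "(X, U) \<in> G" for X U
  proof -
    have dd: "dist (X, U) (X1, U1) < d" using that by (simp add: G_def dist_commute)
    from d(2)[OF this] show "a * s1 / 2 \<le> lam X" "lam X \<le> 2 * (a * s1)" "0 \<le> \<theta> U - a * lam X"
      "\<theta> U - a * lam X \<le> \<kappa> * L" "norm (X - a *\<^sub>R w1) \<le> \<epsilon> / 2" by auto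
    have "dist X X1 < d" "dist U U1 < d"
      using dd dist_fst_le[of "(X, U)" "(X1, U1)"] dist_snd_le[of "(X, U)" "(X1, U1)"] by auto
    then show "norm X \<le> norm X1 + d" "norm U \<le> norm U1 + d"
      using norm_triangle_ineq2[of X X1] norm_triangle_ineq2[of U U1] by (auto simp: dist_norm)
  qed
  let ?W = "\<lambda>X U t w. U - (t/2) *\<^sub>R layer_bracket br X w - t\<^sup>2 *\<^sub>R \<Lambda> w"
  define \<rho> where "\<rho> = min (\<epsilon> / b) r1"
  have \<rho>: "0 < \<rho>" "\<rho> \<le> \<epsilon> / b" "\<rho> \<le> r1" using \<epsilon> ab r1 by (auto simp: \<rho>_def)
  define Q where "Q = norm X1 + norm U1 + norm w1 + d + r1"
  obtain R where R: "0 < R" "\<And>X U w t. norm X \<le> Q \<Longrightarrow> norm U \<le> Q \<Longrightarrow> norm w \<le> Q \<Longrightarrow> 0 \<le> t \<Longrightarrow> t \<le> b \<Longrightarrow> norm (?W X U t w) \<le> R"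
    using second_layer_bound[OF br, of Q b \<Lambda>] by blast
  define A where "A = S \<inter> ball w1 r1"
  have \<sigma>: "space \<sigma> = S" "sets \<sigma> = sets (restrict_space borel S)"
    using S(2) by (auto simp: surface_measure_def)
  have A: "A \<in> sets \<sigma>" unfolding A_def by (intro surface_measure_ball_sets[OF S(2)]) auto
  define N where "N = S \<inter> ball w1 \<rho>"
  have N: "N \<in> sets \<sigma>" "N \<subseteq> A" using \<rho> by (auto simp: N_def A_def intro!: surface_measure_ball_sets[OF S(2)])
  define \<nu> where "\<nu> = measure \<sigma> N"
  have \<nu>: "0 < \<nu>" "emeasure \<sigma> N = ennreal \<nu>"
  proof -
    have "emeasure \<sigma> N \<le> emeasure \<sigma> A" using N A by (intro emeasure_mono)
    also have "\<dots> < \<infinity>" using r1(2) by (simp add: A_def)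
    finally show 1: "emeasure \<sigma> N = ennreal \<nu>"
      by (auto simp: \<nu>_def less_top intro!: emeasure_eq_ennreal_measure)
    show "0 < \<nu>" using surface_measure_ball_pos[OF S w1(1) \<rho>(1)] 1 by (simp add: N_def)
  qed
  define m where "m = chi w1 / 2 * \<nu>"
  have m: "0 < m" using chi1 \<nu> by (simp add: m_def)
  obtain C where C: "0 \<le> C" and test': "\<forall>F A m h. continuous_on UNIV F \<longrightarrow> compactly_supported F \<longrightarrow> (\<forall>z. 0 \<le> F z) \<longrightarrow>
    0 \<le> A \<longrightarrow> 0 \<le> m \<longrightarrow> (\<integral>\<^sup>+z. ennreal (F z powr q) \<partial>lborel) \<le> ennreal A \<longrightarrow>
    h \<in> borel_measurable lborel \<longrightarrow>
    (\<forall>x\<in>G. h x \<le> maximal_op br \<Lambda> \<sigma> chi {a..b} (\<lambda>z. complex_of_real (F z)) x) \<longrightarrow>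
    ennreal m \<le> (\<integral>\<^sup>+x\<in>G. h x \<partial>lborel) \<longrightarrow> m powr q \<le> C * A"
    using maximal_op_bounded_test[OF bdd q Gsets Gfin] by (elim exE conjE) (rule that)
  note test = test'[rule_format]
  have E1: "lam ((1 / s1) *\<^sub>R w1) = 1" using s1 by (simp add: blinfun.scaleR_right s1_def[symmetric])
  have E2: "\<theta> ((1 / s1) *\<^sub>R \<Lambda> w1) = 1" using s1 by (simp add: blinfun.scaleR_right lam s1_def[symmetric])
  let ?P = "\<lambda>\<tau> c \<gamma> d1 d2. {z::'a \<times> 'b. norm z \<le> 4 * \<epsilon> + 2 * R \<and> \<bar>lam (fst z) - c\<bar> \<le> d1 \<and>
       \<bar>\<theta> (snd z) - \<tau> * lam (fst z) - \<gamma>\<bar> \<le> d2}"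
  obtain M where M: "0 \<le> M" and par': "\<forall>\<tau> c \<gamma> d1 d2. \<bar>\<tau>\<bar> \<le> b \<longrightarrow> 0 < d1 \<longrightarrow> d1 \<le> 1 \<longrightarrow> 0 < d2 \<longrightarrow> d2 \<le> 1 \<longrightarrow>
    emeasure lborel (?P \<tau> c \<gamma> d1 d2) \<le> ennreal (M * (d1 * d2)) \<and> ?P \<tau> c \<gamma> d1 d2 \<in> sets borel"
    using parallelogram_measure[OF E1 E2, of b "4 * \<epsilon> + 2 * R"] by (elim exE conjE) (rule that)
  note par = par'[rule_format]
  have main: "(m * vG) powr q \<le> C * (M * \<eta>)" if \<eta>: "0 < \<eta>" for \<eta>
  proof -
    have M2: "0 < 2 * (a * s1)" using ab s1 by simp
    obtain P :: "(real \<times> real) set" and \<delta> and J :: "(nat \<times> (nat \<Rightarrow> nat)) set" and c d1 \<tau> \<gamma> d2 where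
      P: "finite P" "0 < \<delta>" "finite J" "\<forall>s\<in>P. 0 \<le> fst s \<and> fst s \<le> \<kappa>"
      and cover': "\<forall>x u. L + L \<le> x \<longrightarrow> x \<le> 2 * (a * s1) \<longrightarrow> 0 \<le> u \<longrightarrow> u \<le> \<kappa> * L \<longrightarrow>
        (\<exists>s\<in>P. \<bar>u - (fst s * x + snd s)\<bar> \<le> \<delta>)"
      and J: "\<forall>j\<in>J. 0 < d1 j \<and> d1 j \<le> 1 \<and> 0 < d2 j \<and> d2 j \<le> 1 \<and> 0 \<le> \<tau> j \<and> \<tau> j \<le> \<kappa>"
      and thin': "\<forall>y v. \<bar>y\<bar> \<le> L \<longrightarrow> (\<exists>s\<in>P. \<bar>v - (fst s * y + snd s)\<bar> \<le> 2 * \<delta>) \<longrightarrow>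
        (\<exists>j\<in>J. \<bar>y - c j\<bar> \<le> d1 j \<and> \<bar>v - (\<tau> j * y + \<gamma> j)\<bar> \<le> d2 j)"
      and sumJ: "(\<Sum>j\<in>J. d1 j * d2 j) \<le> \<eta>"
      using thin_line_family[OF L \<kappa>(1) L M2 \<eta>] by (elim exE conjE) (rule that)
    define g where "g s z = bump (\<bar>\<theta> (snd z) - a * lam (fst z) - (fst s * lam (fst z) + snd s)\<bar> / \<delta>)"
      for s and z :: "'a \<times> 'b"
    define F where "F z = cutoff \<epsilon> R z * min 1 (\<Sum>s\<in>P. g s z)" for z
    have g0: "0 \<le> g s z" for s z by (simp add: g_def bump_simps)
    have min01: "0 \<le> min 1 (\<Sum>s\<in>P. g s z)" "min 1 (\<Sum>s\<in>P. g s z) \<le> 1" for z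
      using g0 by (simp_all add: sum_nonneg)
    have F0: "0 \<le> F z" for z unfolding F_def by (intro mult_nonneg_nonneg cutoff_range min01)
    have F1: "F z \<le> 1" for z unfolding F_def by (intro mult_le_one cutoff_range min01)
    have Fcont: "continuous_on UNIV F"
      unfolding F_def g_def using P(2) by (intro continuous_intros continuous_on_cutoff \<epsilon> R(1)) auto
    have Fcs: "compactly_supported F"
      unfolding F_def by (rule compactly_supported_cutoff[OF \<epsilon> R(1)])
    let ?Z = "\<lambda>j. ?P (a + \<tau> j) (c j) (\<gamma> j) (d1 j) (d2 j)"
    have Z: "emeasure lborel (?Z j) \<le> ennreal (M * (d1 j * d2 j))" "?Z j \<in> sets borel" if "j \<in> J" for j
    proof -
      have "\<bar>a + \<tau> j\<bar> \<le> b" using J that \<kappa>(2) ab by fastforce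
      from par[OF this, of "d1 j" "d2 j" "c j" "\<gamma> j"] J that
      show "emeasure lborel (?Z j) \<le> ennreal (M * (d1 j * d2 j))" "?Z j \<in> sets borel" by blast+
    qed
    have supp: "\<exists>j\<in>J. z \<in> ?Z j" if "F z \<noteq> 0" for z
    proof -
      have cz: "cutoff \<epsilon> R z \<noteq> 0" and "(\<Sum>s\<in>P. g s z) \<noteq> 0" using that by (auto simp: F_def)
      then obtain s where s: "s \<in> P" "g s z \<noteq> 0" by (meson sum.neutral)
      have "\<bar>lam (fst z)\<bar> \<le> norm lam * norm (fst z)" using norm_blinfun[of lam "fst z"] by simp
      also have "\<dots> \<le> norm lam * (4 * \<epsilon>)"
        using cutoff_support(1)[OF cz \<epsilon> R(1)] by (intro mult_left_mono) auto
      finally have y: "\<bar>lam (fst z)\<bar> \<le> L" using \<epsilon>2 by linarith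
      have "\<bar>\<theta> (snd z) - a * lam (fst z) - (fst s * lam (fst z) + snd s)\<bar> / \<delta> < 2"
        using s(2) bump_simps(4) unfolding g_def by (meson linorder_not_le)
      then have "\<bar>\<theta> (snd z) - a * lam (fst z) - (fst s * lam (fst z) + snd s)\<bar> \<le> 2 * \<delta>"
        using P(2) by (simp add: pos_divide_less_eq)
      then obtain j where j: "j \<in> J" "\<bar>lam (fst z) - c j\<bar> \<le> d1 j"
        "\<bar>\<theta> (snd z) - a * lam (fst z) - (\<tau> j * lam (fst z) + \<gamma> j)\<bar> \<le> d2 j"
        using thin'[rule_format, OF y, of "\<theta> (snd z) - a * lam (fst z)"] s(1) by blast
      have "\<theta> (snd z) - (a + \<tau> j) * lam (fst z) - \<gamma> j = \<theta> (snd z) - a * lam (fst z) - (\<tau> j * lam (fst z) + \<gamma> j)"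
        by (simp add: algebra_simps)
      then have "z \<in> ?Z j" using j cutoff_support(2)[OF cz \<epsilon> R(1)] by simp
      then show ?thesis using j(1) by blast
    qed
    have "(\<integral>\<^sup>+z. ennreal (F z powr q) \<partial>lborel) \<le> (\<integral>\<^sup>+z. (\<Sum>j\<in>J. indicator (?Z j) z) \<partial>lborel)"
    proof (intro nn_integral_mono)
      fix z
      show "ennreal (F z powr q) \<le> (\<Sum>j\<in>J. indicator (?Z j) z)"
      proof (cases "F z = 0")
        case False
        then obtain j where j: "j \<in> J" "z \<in> ?Z j" using supp by blast
        have "F z powr q \<le> 1" using F0 F1 q by (simp add: powr_le1)
        then have "ennreal (F z powr q) \<le> 1" by (simp add: ennreal_le_1)
        also have "\<dots> = indicator (?Z j) z" using j(2) by (simp add: indicator_def)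
        also have "\<dots> \<le> (\<Sum>j\<in>J. indicator (?Z j) z)" using j(1) P(3) by (intro member_le_sum) auto
        finally show ?thesis .
      qed simp
    qed
    also have "\<dots> = (\<Sum>j\<in>J. emeasure lborel (?Z j))"
      using Z(2) by (subst nn_integral_sum) auto
    also have "\<dots> \<le> (\<Sum>j\<in>J. ennreal (M * (d1 j * d2 j)))" by (intro sum_mono Z(1))
    also have "\<dots> = ennreal (M * (\<Sum>j\<in>J. d1 j * d2 j))"
      using J M by (subst sum_ennreal) (auto simp: sum_distrib_left less_imp_le)
    also have "\<dots> \<le> ennreal (M * \<eta>)" using sumJ M by (intro ennreal_leI mult_left_mono)
    finally have Fq: "(\<integral>\<^sup>+z. ennreal (F z powr q) \<partial>lborel) \<le> ennreal (M * \<eta>)" .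
    have hM: "ennreal m \<le> maximal_op br \<Lambda> \<sigma> chi {a..b} (\<lambda>z. complex_of_real (F z)) x" if x: "x \<in> G" for x
    proof -
      obtain X U where xXU: "x = (X, U)" by (cases x)
      note GX = GD[of X U, OF x[unfolded xXU]]
      have "L + L \<le> lam X" using GX(1) by (simp add: L_def)
      then obtain s where s: "s \<in> P" "\<bar>(\<theta> U - a * lam X) - (fst s * lam X + snd s)\<bar> \<le> \<delta>"
        using cover'[rule_format, OF _ GX(2,3,4)] by blast
      define t where "t = a + fst s"
      have t: "a \<le> t" "t \<le> b" "t - a \<le> \<kappa>" using P(4) s(1) \<kappa>(2) by (force simp: t_def)+
      have near: "norm (X - t *\<^sub>R w1) \<le> \<epsilon>"
      proof -
        have eq: "X - t *\<^sub>R w1 = (X - a *\<^sub>R w1) - (t - a) *\<^sub>R w1" by (simp add: algebra_simps)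
        have "norm ((t - a) *\<^sub>R w1) \<le> \<kappa> * norm w1" using t by (simp add: mult_right_mono)
        then show ?thesis
          using norm_triangle_ineq4[of "X - a *\<^sub>R w1" "(t - a) *\<^sub>R w1"] GX(5) \<kappa>w unfolding eq by linarith
      qed
      have one: "F (X - t *\<^sub>R w, ?W X U t w) = 1" if w: "w \<in> ball w1 \<rho>" for w
      proof -
        have "w \<in> ball w1 (\<epsilon> / b)" using w \<rho>(2) by auto
        then have Yn: "norm (X - t *\<^sub>R w) \<le> 2 * \<epsilon>"
          using localization(2)[OF ab(1) t(1,2) \<epsilon> near] by blast
        have "norm w \<le> norm w1 + r1"
          using w \<rho>(3) norm_triangle_ineq2[of w w1] by (simp add: dist_norm norm_minus_commute)
        then have "norm X \<le> Q" "norm U \<le> Q" "norm w \<le> Q"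
          unfolding Q_def
          using GX(6,7) d(1) r1(1) norm_ge_zero[of X1] norm_ge_zero[of U1] norm_ge_zero[of w1] by linarith+
        then have "norm (?W X U t w) \<le> R"
          using t(1,2) ab(1) by (intro R(2)) auto
        then have c1: "cutoff \<epsilon> R (X - t *\<^sub>R w, ?W X U t w) = 1"
          using Yn by (intro cutoff_one \<epsilon> R(1))
        have "\<theta> (?W X U t w) = \<theta> U - t * lam X + t * lam (X - t *\<^sub>R w)"
          unfolding second_layer_identity[OF br] J0 lam by (simp add: lam_def scaleR_blinfun.rep_eq)
        then have "\<theta> (?W X U t w) - a * lam (X - t *\<^sub>R w) - (fst s * lam (X - t *\<^sub>R w) + snd s)
           = (\<theta> U - a * lam X) - (fst s * lam X + snd s)"
          by (simp add: t_def algebra_simps)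
        then have "g s (X - t *\<^sub>R w, ?W X U t w) = 1"
          using s(2) P(2) unfolding g_def fst_conv snd_conv by (intro bump_simps(3)) (simp add: divide_le_eq)
        moreover have "g s (X - t *\<^sub>R w, ?W X U t w) \<le> (\<Sum>s\<in>P. g s (X - t *\<^sub>R w, ?W X U t w))"
          using s(1) P(1) g0 by (intro member_le_sum) auto
        ultimately show ?thesis using c1 by (simp add: F_def)
      qed
      have "ennreal m = (\<integral>\<^sup>+w. ennreal (chi w1 / 2) * indicator N w \<partial>\<sigma>)"
        using N(1) chi1 \<nu> by (simp add: nn_integral_cmult_indicator m_def ennreal_mult[symmetric])
      also have "\<dots> \<le> (\<integral>\<^sup>+w\<in>A. ennreal (chi w * F (X - t *\<^sub>R w, ?W X U t w)) \<partial>\<sigma>)"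
      proof (intro nn_integral_mono)
        fix w
        show "ennreal (chi w1 / 2) * indicator N w \<le> ennreal (chi w * F (X - t *\<^sub>R w, ?W X U t w)) * indicator A w"
        proof (cases "w \<in> N")
          case True
          then have "w \<in> ball w1 \<rho>" "w \<in> A" "w \<in> ball w1 r1" using N(2) by (auto simp: N_def A_def)
          then show ?thesis using True r1(3)[of w] one[of w] by (simp add: ennreal_leI)
        qed simp
      qed
      also have "\<dots> = ennreal (norm (conv_mu br \<Lambda> \<sigma> chi t (\<lambda>z. complex_of_real (F z)) (X, U)))"
      proof (rule conv_mu_nn_integral[symmetric, OF br \<sigma>(2,1) A _ chi Fcont F0 F1])
        show "emeasure \<sigma> A < \<infinity>" using r1 by (simp add: A_def)
        fix w assume w: "w \<in> S" "w \<notin> A"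
        show "F (X - t *\<^sub>R w, ?W X U t w) = 0"
        proof (rule ccontr)
          assume "F (X - t *\<^sub>R w, ?W X U t w) \<noteq> 0"
          then have "cutoff \<epsilon> R (X - t *\<^sub>R w, ?W X U t w) \<noteq> 0" by (auto simp: F_def)
          from cutoff_support(1)[OF this \<epsilon> R(1)] have "norm (X - t *\<^sub>R w) < 4 * \<epsilon>" by simp
          then have "w \<in> ball w1 (6 * \<epsilon> / a)"
            using localization(1)[OF ab(1) t(1,2) \<epsilon> near] by blast
          then show False using w \<epsilon>1 by (simp add: A_def)
        qed
      qed
      also have "\<dots> \<le> maximal_op br \<Lambda> \<sigma> chi {a..b} (\<lambda>z. complex_of_real (F z)) x"
        unfolding xXU using t by (intro maximal_op_lower) simp
      finally show ?thesis .
    qed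
    have "ennreal (m * vG) \<le> (\<integral>\<^sup>+x\<in>G. ennreal m \<partial>lborel)"
      using Gsets vG m by (simp add: nn_integral_cmult_indicator ennreal_mult)
    then show ?thesis
      by (intro test[OF Fcont Fcs F0 _ _ Fq _ hM]) (use M \<eta> m vG in auto)
  qed
  have pos: "0 < (m * vG) powr q" using m vG by simp
  define \<eta> where "\<eta> = (m * vG) powr q / (2 * (C * M + 1))"
  have CM: "0 \<le> C * M" using C M by simp
  have \<eta>0: "0 < \<eta>" using pos CM by (simp add: \<eta>_def add_nonneg_pos)
  have "\<eta> * (2 * (C * M + 1)) = (m * vG) powr q" using CM by (simp add: \<eta>_def)
  moreover have "(m * vG) powr q \<le> \<eta> * (C * M)" using main[OF \<eta>0] by (simp add: mult_ac)
  moreover have "0 \<le> \<eta> * (C * M)" using \<eta>0 CM by simp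
  ultimately show False using \<eta>0 by (simp add: distrib_left)
qed

text \<open>
  \<open>J_map br \<theta> Y\<close> is a multiple of the basis functional \<open>l\<close> and annihilates \<open>Y\<close>, so it is 0 when \<open>l Y \<noteq> 0\<close>; vectors of this kind
  span the space.
\<close>

lemma J_map_eq_zero_of_rank_one:
  fixes br :: "'a::euclidean_space \<times> 'b::euclidean_space \<Rightarrow> 'a \<times> 'b \<Rightarrow> 'a \<times> 'b"
    and \<Lambda> :: "'a \<Rightarrow>\<^sub>L 'b" and \<theta> :: "'b \<Rightarrow>\<^sub>L real"
  assumes br: "two_step_bracket br" and dim: "dim (V_space br \<Lambda> \<theta>) = 1" and nz: "\<theta> o\<^sub>L \<Lambda> \<noteq> 0"
  shows "J_map br \<theta> X = 0"
proof -
  let ?lam = "\<theta> o\<^sub>L \<Lambda>"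
  have JV: "J_map br \<theta> Y \<in> V_space br \<Lambda> \<theta>" for Y
    using V_space_member[of br \<theta> Y 0 \<Lambda>] by simp
  have lamV: "?lam \<in> V_space br \<Lambda> \<theta>"
    using V_space_member[of br \<theta> 0 1 \<Lambda>] by (simp add: J_map_zero[OF br])
  obtain B E where B: "finite B" "card B = 1"
    and coord: "\<forall>v\<in>V_space br \<Lambda> \<theta>. \<forall>z. blinfun_apply v z = (\<Sum>l\<in>B. blinfun_apply v (E l) * blinfun_apply l z)"
    using functional_coordinates[OF V_space_subspace[OF br] dim zero_less_one] by (elim exE conjE) (rule that)
  obtain l where l: "B = {l}" using B(2) card_1_singletonE by blast
  have rep: "blinfun_apply v z = blinfun_apply v (E l) * blinfun_apply l z" if "v \<in> V_space br \<Lambda> \<theta>" for v z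
    using spec[OF bspec[OF coord that], of z] unfolding l by simp
  have self: "J_map br \<theta> Y Y = 0" for Y
    by (simp add: J_map_apply[OF br] layer_bracket_self[OF br] blinfun.zero_right)
  obtain Z where Z: "?lam Z \<noteq> 0" using nz by (metis blinfun_eqI zero_blinfun.rep_eq)
  have lZ: "l Z \<noteq> 0" using rep[OF lamV, of Z] Z by auto
  have J0: "J_map br \<theta> Y = 0" if "l Y \<noteq> 0" for Y
  proof -
    have "J_map br \<theta> Y (E l) = 0" using rep[OF JV, of Y Y] self[of Y] that by simp
    then have "J_map br \<theta> Y z = 0" for z using rep[OF JV, of Y z] by simp
    then show ?thesis by (intro blinfun_eqI) (simp add: zero_blinfun.rep_eq)
  qed
  show ?thesis
  proof (cases "l X = 0")
    case True
    then have "J_map br \<theta> (X + Z) = 0" "J_map br \<theta> Z = 0"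
      using lZ by (auto intro!: J0 simp: blinfun.add_right)
    then have "J_map br \<theta> (X + Z) Y = 0" "J_map br \<theta> Z Y = 0" for Y by simp_all
    then have "J_map br \<theta> X Y = 0" for Y
      unfolding J_map_apply[OF br] by (simp add: bilinear_ladd[OF layer_bracket_bilinear[OF br]] blinfun.add_right)
    then show ?thesis by (intro blinfun_eqI) (simp add: zero_blinfun.rep_eq)
  qed (rule J0)
qed

section \<open>Necessary conditions for the maximal inequality\<close>

lemma compactly_supported_bounded_above:
  fixes f :: "'a::euclidean_space \<Rightarrow> real"
  assumes "continuous_on UNIV f" "compactly_supported f"
  shows "\<exists>K. \<forall>x. f x \<le> K"
proof -
  let ?S = "closure {x. f x \<noteq> 0}"
  have "compact (f ` ?S)"
    using assms by (intro compact_continuous_image) (auto simp: compactly_supported_def intro: continuous_on_subset)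
  then obtain K where K: "\<forall>y\<in>f ` ?S. norm y \<le> K"
    using compact_imp_bounded bounded_iff by blast
  have "f x \<le> max K 0" for x
  proof (cases "f x = 0")
    case False
    then have "x \<in> ?S" by (intro subsetD[OF closure_subset]) simp
    then have "norm (f x) \<le> K" using K by blast
    then show ?thesis by simp
  qed simp
  then show ?thesis by blast
qed

theorem theorem1p1:
  fixes br :: "'a::euclidean_space \<times> 'b::euclidean_space \<Rightarrow> 'a \<times> 'b \<Rightarrow> 'a \<times> 'b"
    and \<Lambda> :: "'a \<Rightarrow>\<^sub>L 'b"
    and \<Sigma> :: "'a set"
    and \<sigma> :: "'a measure"
    and chi :: "'a \<Rightarrow> real"
    and I :: "real set"
    and a b :: real
    and r :: nat
    and p :: ennreal
    and \<theta> :: "'b \<Rightarrow>\<^sub>L real"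
    and \<omega>\<^sub>0 :: 'a
  assumes "DIM('a) \<ge> 2"
    and "two_step_bracket br"
    and "\<Lambda> \<noteq> 0"
    and "C1_submanifold TYPE('k::finite) \<Sigma>"
    and "surface_measure TYPE('k) \<Sigma> \<sigma>"
    and "\<forall>n. Ck_on n UNIV chi" and "compactly_supported chi"
    and "\<forall>x. chi x \<ge> 0" and "\<exists>x. chi x \<noteq> 0"
    and "I = {a..b}" and "0 < a" and "a < b"
    and "1 \<le> r" and "r \<le> CARD('k)" and "CARD('k) \<le> DIM('a)"
    and "1 \<le> p"
    and "\<omega>\<^sub>0 \<in> \<Sigma>" and "chi \<omega>\<^sub>0 \<noteq> 0"
    and "\<theta> o\<^sub>L \<Lambda> \<noteq> 0"
    and "V_space br \<Lambda> \<theta> \<inter> annihilator (tangent_space \<Sigma> \<omega>\<^sub>0) = {0}"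
    and "dim (V_space br \<Lambda> \<theta>) = r"
  shows "(2 \<le> r \<longrightarrow> maximal_op_bounded br \<Lambda> \<sigma> chi I p \<longrightarrow> p > ennreal ((real r + 1) / real r))
       \<and> (r = 1 \<longrightarrow> maximal_op_bounded br \<Lambda> \<sigma> chi I p \<longrightarrow> p = \<infinity>)"
proof -
  note br = assms(2) and S = assms(4,5) and ab = assms(11,12) and r = assms(13) and V = assms(21)
  have chi: "continuous_on UNIV chi" "\<And>x. 0 \<le> chi x"
    using assms(6)[rule_format, of 0] assms(8) by auto
  obtain K where K: "\<And>x. chi x \<le> K"
    using compactly_supported_bounded_above[OF chi(1) assms(7)] by blast
  have lamV: "\<theta> o\<^sub>L \<Lambda> \<in> V_space br \<Lambda> \<theta>"
    using V_space_member[of br \<theta> 0 1 \<Lambda>] by (simp add: J_map_zero[OF br])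
  then have notann: "\<theta> o\<^sub>L \<Lambda> \<notin> annihilator (tangent_space \<Sigma> \<omega>\<^sub>0)"
    using assms(19,20) by blast
  have "isCont chi \<omega>\<^sub>0" using chi(1) by (simp add: continuous_on_eq_continuous_at)
  then have "eventually (\<lambda>w. chi w \<in> - {0}) (nhds \<omega>\<^sub>0)"
    using assms(18) by (intro isCont_eventually_ball) auto
  then obtain e where e: "0 < e" "\<And>w. dist w \<omega>\<^sub>0 < e \<Longrightarrow> chi w \<noteq> 0"
    unfolding eventually_nhds_metric by auto
  \<comment> \<open>Transversality moves the base point, inside \<open>\<Sigma>\<close> and where \<open>chi \<noteq> 0\<close>, to one at which \<open>\<theta> \<circ> \<Lambda>\<close> does
    not vanish.\<close>
  obtain w1 where w1: "w1 \<in> \<Sigma>" "w1 \<in> ball \<omega>\<^sub>0 e" "\<theta> (\<Lambda> w1) \<noteq> 0"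
    using functional_nonzero_near_point[OF notann e(1)] by auto
  have chiw1: "chi w1 \<noteq> 0" using w1(2) e(2)[of w1] by (simp add: dist_commute)
  have finite_p: "\<exists>q. p = ennreal q \<and> 1 \<le> q" if "p \<noteq> \<infinity>"
  proof (cases p)
    case (real q)
    then have "ennreal 1 \<le> ennreal q" using assms(16) by simp
    then have "1 \<le> q" using real(1) by (subst (asm) ennreal_le_iff) auto
    then show ?thesis using real(2) by blast
  qed (use that in simp)
  show ?thesis
  proof (intro conjI impI)
    assume r2: "2 \<le> r" and bdd: "maximal_op_bounded br \<Lambda> \<sigma> chi I p"
    show "p > ennreal ((real r + 1) / real r)"
    proof (rule ccontr)
      assume "\<not> ?thesis"
      then have le: "p \<le> ennreal ((real r + 1) / real r)" by simp
      then have "p \<noteq> \<infinity>" by (auto simp: top_unique)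
      then obtain q where q: "p = ennreal q" "1 \<le> q" using finite_p by blast
      have "q \<le> (real r + 1) / real r"
        using le unfolding q(1) by (subst (asm) ennreal_le_iff) auto
      then have "q * real r \<le> real r + 1" using r by (simp add: pos_le_divide_eq)
      then show False
        by (rule subcritical_maximal_op_unbounded[OF br S chi K ab w1(1) chiw1 w1(3) V r q(2) _
              bdd[unfolded q(1) assms(10)]])
    qed
  next
    assume r1: "r = 1" and bdd: "maximal_op_bounded br \<Lambda> \<sigma> chi I p"
    show "p = \<infinity>"
    proof (rule ccontr)
      assume "p \<noteq> \<infinity>"
      then obtain q where q: "p = ennreal q" "1 \<le> q" using finite_p by blast
      have J: "J_map br \<theta> X = 0" for X
        using V r1 by (intro J_map_eq_zero_of_rank_one[OF br _ assms(19)]) simp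
      have J': "J_map br (- \<theta>) X = 0" for X
      proof (rule blinfun_eqI)
        fix Y
        have "J_map br \<theta> X Y = 0" using J by simp
        then show "J_map br (- \<theta>) X Y = (0 :: 'a \<Rightarrow>\<^sub>L real) Y"
          by (simp add: J_map_apply[OF br] blinfun.minus_left)
      qed
      note bdd' = bdd[unfolded q(1) assms(10)]
      consider "0 < \<theta> (\<Lambda> w1)" | "0 < (- \<theta>) (\<Lambda> w1)"
        using w1(3) unfolding blinfun.minus_left neg_0_less_iff_less by (meson linorder_neqE)
      then show False
      proof cases
        case 1
        show False
          by (rule rank_one_maximal_op_unbounded[OF br S chi K ab w1(1) chiw1 1 J q(2) bdd'])
      next
        case 2
        show False
          by (rule rank_one_maximal_op_unbounded[OF br S chi K ab w1(1) chiw1 2 J' q(2) bdd'])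
      qed
    qed
  qed
qed

end
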